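(* Let $M$ be a manifold and $\Omega$ a closed $2$-form on $M$. An $\Omega$-Poisson structure $\Pi$ on $M$ is equivalent with a pair $(Q,E)$, where $Q$ is a Poisson bivector on $M$ (i.e., $[Q,Q]=0$), and $E$ is a vector field such that $$L_EQ=\sharp_Q\Omega.$$
   Context: Everything is $C^\infty$. Sections of $TM\oplus\mathbf{R}$ are written $X+f\frac{\partial}{\partial t}$ with $X$ a vector field on $M$ and $f\in C^\infty(M)$; they are identified with vector fields on $M\times\mathbf{R}$ taken at $t=0$, where $t$ is the coordinate on $\mathbf{R}$. For a closed $2$-form $\Omega$ on $M$, $TM\oplus\mathbf{R}$ is a Lie algebroid with anchor $X+f\frac{\partial}{\partial t}\mapsto X$ and bracket $$\Big[X+f\frac{\partial}{\partial t},Y+g\frac{\partial}{\partial t}\Big]_\Omega=[X,Y]+(Xg-Yf+\Omega(X,Y))\frac{\partial}{\partial t}.$$ An $\Omega$-Poisson structure on $M$ is a Poisson bivector $\Pi$ on this Lie algebroid, i.e. a section $\Pi$ of $\wedge^2(TM\oplus\mathbf{R})$ with $[\Pi,\Pi]_\Omega=0$, where $[\,,\,]_\Omega$ also denotes the Schouten-Nijenhuis extension of the bracket. A section $\Pi$ of $\wedge^2(TM\oplus\mathbf{R})$ is written $\Pi=Q+\frac{\partial}{\partial t}\wedge E$, with $Q$ a bivector field and $E$ a vector field on $M$; this is how the pair $(Q,E)$ is associated with $\Pi$. $[Q,Q]$ is the usual Schouten-Nijenhuis bracket on $M$ and $L_E$ is the Lie derivative. For a bivector field $Q$, $\sharp_Q:T^*M\to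 TM$ is given by $\langle\sharp_Q\alpha,\beta\rangle=Q(\alpha,\beta)$, and $\sharp_Q\Omega$ is the bivector field which is the image of $\Omega$ under the extension of $\sharp_Q$ to forms: $(\sharp_Q\lambda)(\alpha_1,\dots,\alpha_k)=(-1)^k\lambda(\sharp_Q\alpha_1,\dots,\sharp_Q\alpha_k)$ for a $k$-form $\lambda$, so $(\sharp_Q\Omega)(\alpha,\beta)=\Omega(\sharp_Q\alpha,\sharp_Q\beta)$.
   Formalization: With the usual evaluation (X∧Y)(α,β)=α(X)β(Y)−α(Y)β(X) the relation is off by a sign (it should be L_EQ=−♯_QΩ); here (X∧Y)(α,β)=α(Y)β(X)−α(X)β(Y) is used throughout, making L_EQ=♯_QΩ correct. The trivial case dim M=0 is left out. *)

theory Defs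
  imports "HOL-Analysis.Analysis" "HOL-Library.Function_Algebras"
begin

text \<open>
  Functions, vector fields, forms and multivector fields are added and subtracted with the pointwise
  operations of \<^theory>\<open>HOL-Library.Function_Algebras\<close>. An object that is only meaningful on
  a subset of a type (a derivation on the smooth functions, a form on the vector fields, ...) takes
  the value 0 off that subset, so that equality of such objects is equality in HOL.
\<close>


section \<open>Smooth manifolds\<close>

primrec Ck_on :: "nat \<Rightarrow> 'b::real_normed_vector set \<Rightarrow> ('b \<Rightarrow> 'c::real_normed_vector) \<Rightarrow> bool" where
  "Ck_on 0 S f \<longleftrightarrow> continuous_on S f"
| "Ck_on (Suc k) S f \<longleftrightarrow>
     (\<forall>x\<in>S. f differentiable (at x)) \<and> (\<forall>v. Ck_on k S (\<lambda>x. frechet_derivative f (at x) v))"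

text \<open>To be used for open \<open>S\<close> only.\<close>

definition smooth_on :: "'b::real_normed_vector set \<Rightarrow> ('b \<Rightarrow> 'c::real_normed_vector) \<Rightarrow> bool" where
  "smooth_on S f \<longleftrightarrow> (\<forall>k. Ck_on k S f)"

text \<open>A chart is given by its domain and its coordinate map.\<close>

type_synonym ('a, 'b) chart = "'a set \<times> ('a \<Rightarrow> 'b)"

definition is_chart :: "('a::topological_space, 'b::euclidean_space) chart \<Rightarrow> bool" where
  "is_chart = (\<lambda>(U, \<phi>). open U \<and> open (\<phi> ` U) \<and> homeomorphism U (\<phi> ` U) \<phi> (inv_into U \<phi>))"

text \<open>The manifold is the whole type \<open>'a\<close>; its dimension is that of the model space \<open>'b\<close>.\<close>

definition smooth_atlas ::
  "('a::{t2_space, second_countable_topology}, 'b::euclidean_space) chart set \<Rightarrow> bool" where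
  "smooth_atlas \<A> \<longleftrightarrow>
     (\<forall>c\<in>\<A>. is_chart c) \<and> \<Union> (fst ` \<A>) = UNIV \<and>
     (\<forall>(U, \<phi>)\<in>\<A>. \<forall>(V, \<psi>)\<in>\<A>. smooth_on (\<phi> ` (U \<inter> V)) (\<psi> \<circ> inv_into U \<phi>))"

definition smooth_functions ::
  "('a::topological_space, 'b::euclidean_space) chart set \<Rightarrow> ('a \<Rightarrow> real) set" where
  "smooth_functions \<A> = {f. \<forall>(U, \<phi>)\<in>\<A>. smooth_on (\<phi> ` U) (f \<circ> inv_into U \<phi>)}"


section \<open>Vector fields\<close>

type_synonym 'a vfield = "('a \<Rightarrow> real) \<Rightarrow> ('a \<Rightarrow> real)"

text \<open>Vector fields are the derivations of the algebra of smooth functions.\<close>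

definition vector_fields ::
  "('a::topological_space, 'b::euclidean_space) chart set \<Rightarrow> 'a vfield set" where
  "vector_fields \<A> = {X.
     (\<forall>f\<in>smooth_functions \<A>. X f \<in> smooth_functions \<A>) \<and>
     (\<forall>f\<in>smooth_functions \<A>. \<forall>g\<in>smooth_functions \<A>. X (f + g) = X f + X g) \<and>
     (\<forall>c. \<forall>f\<in>smooth_functions \<A>. X (\<lambda>p. c * f p) = (\<lambda>p. c * X f p)) \<and>
     (\<forall>f\<in>smooth_functions \<A>. \<forall>g\<in>smooth_functions \<A>. X (f * g) = f * X g + X f * g) \<and>
     (\<forall>f. f \<notin> smooth_functions \<A> \<longrightarrow> X f = 0)}"

definition lie_bracket :: "'a vfield \<Rightarrow> 'a vfield \<Rightarrow> 'a vfield" where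
  "lie_bracket X Y = (\<lambda>f. X (Y f) - Y (X f))"


section \<open>Tensor fields\<close>

text \<open>
  Tensor fields are maps on sections that are multilinear over the ring \<open>C\<close> of smooth functions.
  In the next two definitions \<open>S\<close> is the \<open>C\<close>-module of arguments and \<open>sm\<close> its scalar
  multiplication.
\<close>

definition linear_maps ::
  "('a \<Rightarrow> real) set \<Rightarrow> 's::ab_group_add set \<Rightarrow> (('a \<Rightarrow> real) \<Rightarrow> 's \<Rightarrow> 's) \<Rightarrow> ('s \<Rightarrow> 'a \<Rightarrow> real) set" where
  "linear_maps C S sm = {\<alpha>.
     (\<forall>s\<in>S. \<alpha> s \<in> C) \<and>
     (\<forall>s\<in>S. \<forall>t\<in>S. \<alpha> (s + t) = \<alpha> s + \<alpha> t) \<and>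
     (\<forall>f\<in>C. \<forall>s\<in>S. \<alpha> (sm f s) = f * \<alpha> s) \<and>
     (\<forall>s. s \<notin> S \<longrightarrow> \<alpha> s = 0)}"

definition alternating_maps ::
  "('a \<Rightarrow> real) set \<Rightarrow> 's::ab_group_add set \<Rightarrow> (('a \<Rightarrow> real) \<Rightarrow> 's \<Rightarrow> 's) \<Rightarrow> ('s \<Rightarrow> 's \<Rightarrow> 'a \<Rightarrow> real) set" where
  "alternating_maps C S sm = {\<omega>.
     (\<forall>s\<in>S. \<omega> s \<in> linear_maps C S sm) \<and>
     (\<forall>s\<in>S. \<omega> s s = 0) \<and>
     (\<forall>s\<in>S. \<forall>t\<in>S. \<omega> s t = - \<omega> t s) \<and>
     (\<forall>s. s \<notin> S \<longrightarrow> \<omega> s = 0)}"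

text \<open>Multiplication of a vector field or of a form by a function.\<close>

definition fmult :: "('a \<Rightarrow> real) \<Rightarrow> ('x \<Rightarrow> 'a \<Rightarrow> real) \<Rightarrow> ('x \<Rightarrow> 'a \<Rightarrow> real)" where
  "fmult f F = (\<lambda>x. f * F x)"


section \<open>Lie algebroids and their bivectors\<close>

text \<open>A Lie algebroid is described by the module of its sections over the ring of smooth functions
  of the base.\<close>

record ('a, 's) lie_algebroid =
  base_ring :: "('a \<Rightarrow> real) set"
  sections :: "'s set"
  smul :: "('a \<Rightarrow> real) \<Rightarrow> 's \<Rightarrow> 's"
  anchor :: "'s \<Rightarrow> 'a vfield"
  bracket :: "'s \<Rightarrow> 's \<Rightarrow> 's"

definition dual :: "('a, 's::ab_group_add) lie_algebroid \<Rightarrow> ('s \<Rightarrow> 'a \<Rightarrow> real) set" where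
  "dual A = linear_maps (base_ring A) (sections A) (smul A)"

text \<open>A section of the second exterior power is identified with the alternating map by which it
  acts on pairs of sections of the dual.\<close>

type_synonym ('a, 's) bivector = "('s \<Rightarrow> 'a \<Rightarrow> real) \<Rightarrow> ('s \<Rightarrow> 'a \<Rightarrow> real) \<Rightarrow> 'a \<Rightarrow> real"

definition bivectors :: "('a, 's::ab_group_add) lie_algebroid \<Rightarrow> ('a, 's) bivector set" where
  "bivectors A = alternating_maps (base_ring A) (dual A) fmult"

text \<open>
  A \<open>k\<close>-vector is evaluated on \<open>k\<close> covectors by successive interior products,
  \<open>P(\<alpha>\<^sub>1, \<dots>, \<alpha>\<^sub>k) = i(\<alpha>\<^sub>1) \<dots> i(\<alpha>\<^sub>k) P\<close>, where \<open>i(\<alpha>)\<close> is the antiderivation with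
  \<open>i(\<alpha>) X = \<alpha>(X)\<close>. This differs from the convention \<open>(X\<^sub>1 \<and> \<dots> \<and> X\<^sub>k)(\<alpha>\<^sub>1, \<dots>, \<alpha>\<^sub>k) =
  det (\<alpha>\<^sub>i(X\<^sub>j))\<close> by the sign of the reversal of \<open>(1, \<dots>, k)\<close>. The choice matters: in the relation
  \<open>L\<^sub>E Q = \<sharp>\<^sub>Q \<Omega>\<close> the left-hand side is linear and the right-hand side quadratic in the map
  \<open>(\<alpha>, \<beta>) \<mapsto> Q(\<alpha>, \<beta>)\<close>, and with the determinant convention the relation equivalent to
  \<open>[\<Pi>, \<Pi>]\<^sub>\<Omega> = 0\<close> would be \<open>L\<^sub>E Q = - \<sharp>\<^sub>Q \<Omega>\<close>.
\<close>

definition wedge :: "('a, 's::ab_group_add) lie_algebroid \<Rightarrow> 's \<Rightarrow> 's \<Rightarrow> ('a, 's) bivector" where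
  "wedge A a b = (\<lambda>\<alpha> \<beta>. if \<alpha> \<in> dual A \<and> \<beta> \<in> dual A then \<beta> a * \<alpha> b - \<beta> b * \<alpha> a else 0)"

definition wedge3 ::
  "('a, 's::ab_group_add) lie_algebroid \<Rightarrow> 's \<Rightarrow> 's \<Rightarrow> 's
    \<Rightarrow> ('s \<Rightarrow> 'a \<Rightarrow> real) \<Rightarrow> ('s \<Rightarrow> 'a \<Rightarrow> real) \<Rightarrow> ('s \<Rightarrow> 'a \<Rightarrow> real) \<Rightarrow> 'a \<Rightarrow> real" where
  "wedge3 A a b c = (\<lambda>\<alpha> \<beta> \<gamma>. if \<alpha> \<in> dual A \<and> \<beta> \<in> dual A \<and> \<gamma> \<in> dual A
     then \<gamma> a * wedge A b c \<alpha> \<beta> - \<gamma> b * wedge A a c \<alpha> \<beta> + \<gamma> c * wedge A a b \<alpha> \<beta> else 0)"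

text \<open>
  The Schouten-Nijenhuis bracket of two bivectors is the biadditive, local extension of
  \<open>[a\<^sub>1 \<and> a\<^sub>2, b\<^sub>1 \<and> b\<^sub>2] = \<Sum>\<^sub>i\<^sub>j (-1)\<^sup>i\<^sup>+\<^sup>j [a\<^sub>i, b\<^sub>j] \<and> a\<^sub>3\<^sub>-\<^sub>i \<and> b\<^sub>3\<^sub>-\<^sub>j\<close>. Near every point a bivector
  is a finite sum of products \<open>a \<and> b\<close> of sections, and the value of the bracket at the point does
  not depend on the sum chosen.
\<close>

definition decomposition_near ::
  "('a::topological_space, 's::ab_group_add) lie_algebroid \<Rightarrow> ('a, 's) bivector \<Rightarrow> 'a \<Rightarrow> ('s \<times> 's) list \<Rightarrow> bool" where
  "decomposition_near A P p xs \<longleftrightarrow> set xs \<subseteq> sections A \<times> sections A \<and>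
     (\<forall>\<^sub>F q in nhds p. \<forall>\<alpha>\<in>dual A. \<forall>\<beta>\<in>dual A. P \<alpha> \<beta> q = (\<Sum>(a, b)\<leftarrow>xs. wedge A a b \<alpha> \<beta> q))"

definition schouten_wedge ::
  "('a, 's::ab_group_add) lie_algebroid \<Rightarrow> 's \<times> 's \<Rightarrow> 's \<times> 's
    \<Rightarrow> ('s \<Rightarrow> 'a \<Rightarrow> real) \<Rightarrow> ('s \<Rightarrow> 'a \<Rightarrow> real) \<Rightarrow> ('s \<Rightarrow> 'a \<Rightarrow> real) \<Rightarrow> 'a \<Rightarrow> real" where
  "schouten_wedge A = (\<lambda>(a1, a2) (b1, b2).
       wedge3 A (bracket A a1 b1) a2 b2 - wedge3 A (bracket A a1 b2) a2 b1
     - wedge3 A (bracket A a2 b1) a1 b2 + wedge3 A (bracket A a2 b2) a1 b1)"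

definition schouten ::
  "('a::topological_space, 's::ab_group_add) lie_algebroid \<Rightarrow> ('a, 's) bivector \<Rightarrow> ('a, 's) bivector
    \<Rightarrow> ('s \<Rightarrow> 'a \<Rightarrow> real) \<Rightarrow> ('s \<Rightarrow> 'a \<Rightarrow> real) \<Rightarrow> ('s \<Rightarrow> 'a \<Rightarrow> real) \<Rightarrow> 'a \<Rightarrow> real" where
  "schouten A P R = (\<lambda>\<alpha> \<beta> \<gamma> p.
     if \<alpha> \<in> dual A \<and> \<beta> \<in> dual A \<and> \<gamma> \<in> dual A
     then THE r. \<exists>xs ys. decomposition_near A P p xs \<and> decomposition_near A R p ys \<and>
            r = (\<Sum>x\<leftarrow>xs. \<Sum>y\<leftarrow>ys. schouten_wedge A x y \<alpha> \<beta> \<gamma> p)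
     else 0)"

definition poisson_bivector :: "('a::topological_space, 's::ab_group_add) lie_algebroid \<Rightarrow> ('a, 's) bivector \<Rightarrow> bool" where
  "poisson_bivector A P \<longleftrightarrow> P \<in> bivectors A \<and> schouten A P P = 0"


section \<open>Calculus on the manifold\<close>

definition TM ::
  "('a::topological_space, 'b::euclidean_space) chart set \<Rightarrow> ('a, 'a vfield) lie_algebroid" where
  "TM \<A> = \<lparr>base_ring = smooth_functions \<A>, sections = vector_fields \<A>, smul = fmult,
            anchor = (\<lambda>X. X), bracket = lie_bracket\<rparr>"

abbreviation one_forms ::
  "('a::topological_space, 'b::euclidean_space) chart set \<Rightarrow> ('a vfield \<Rightarrow> 'a \<Rightarrow> real) set" where
  "one_forms \<A> \<equiv> dual (TM \<A>)"

abbreviation bivector_fields ::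
  "('a::topological_space, 'b::euclidean_space) chart set \<Rightarrow> ('a, 'a vfield) bivector set" where
  "bivector_fields \<A> \<equiv> bivectors (TM \<A>)"

definition two_forms ::
  "('a::topological_space, 'b::euclidean_space) chart set \<Rightarrow> ('a vfield \<Rightarrow> 'a vfield \<Rightarrow> 'a \<Rightarrow> real) set" where
  "two_forms \<A> = alternating_maps (smooth_functions \<A>) (vector_fields \<A>) fmult"

definition closed_two_form ::
  "('a::topological_space, 'b::euclidean_space) chart set \<Rightarrow> ('a vfield \<Rightarrow> 'a vfield \<Rightarrow> 'a \<Rightarrow> real) \<Rightarrow> bool" where
  "closed_two_form \<A> \<Omega> \<longleftrightarrow> \<Omega> \<in> two_forms \<A> \<and>
     (\<forall>X\<in>vector_fields \<A>. \<forall>Y\<in>vector_fields \<A>. \<forall>Z\<in>vector_fields \<A>.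
        X (\<Omega> Y Z) + Y (\<Omega> Z X) + Z (\<Omega> X Y)
        - \<Omega> (lie_bracket X Y) Z - \<Omega> (lie_bracket Y Z) X - \<Omega> (lie_bracket Z X) Y = 0)"

definition lie_one_form ::
  "('a::topological_space, 'b::euclidean_space) chart set \<Rightarrow> 'a vfield
    \<Rightarrow> ('a vfield \<Rightarrow> 'a \<Rightarrow> real) \<Rightarrow> ('a vfield \<Rightarrow> 'a \<Rightarrow> real)" where
  "lie_one_form \<A> E \<alpha> =
     (\<lambda>X. if X \<in> vector_fields \<A> then E (\<alpha> X) - \<alpha> (lie_bracket E X) else 0)"

definition lie_bivector ::
  "('a::topological_space, 'b::euclidean_space) chart set \<Rightarrow> 'a vfield
    \<Rightarrow> ('a, 'a vfield) bivector \<Rightarrow> ('a, 'a vfield) bivector" where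
  "lie_bivector \<A> E Q =
     (\<lambda>\<alpha> \<beta>. if \<alpha> \<in> one_forms \<A> \<and> \<beta> \<in> one_forms \<A>
        then E (Q \<alpha> \<beta>) - Q (lie_one_form \<A> E \<alpha>) \<beta> - Q \<alpha> (lie_one_form \<A> E \<beta>) else 0)"

definition sharp ::
  "('a::topological_space, 'b::euclidean_space) chart set \<Rightarrow> ('a, 'a vfield) bivector
    \<Rightarrow> ('a vfield \<Rightarrow> 'a \<Rightarrow> real) \<Rightarrow> 'a vfield" where
  "sharp \<A> Q \<alpha> = (THE X. X \<in> vector_fields \<A> \<and> (\<forall>\<beta>\<in>one_forms \<A>. \<beta> X = Q \<alpha> \<beta>))"

definition sharp_two_form ::
  "('a::topological_space, 'b::euclidean_space) chart set \<Rightarrow> ('a, 'a vfield) bivector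
    \<Rightarrow> ('a vfield \<Rightarrow> 'a vfield \<Rightarrow> 'a \<Rightarrow> real) \<Rightarrow> ('a, 'a vfield) bivector" where
  "sharp_two_form \<A> Q \<Omega> =
     (\<lambda>\<alpha> \<beta>. if \<alpha> \<in> one_forms \<A> \<and> \<beta> \<in> one_forms \<A> then \<Omega> (sharp \<A> Q \<alpha>) (sharp \<A> Q \<beta>) else 0)"


section \<open>The Lie algebroid \<open>TM \<oplus> \<real>\<close>\<close>

text \<open>The section \<open>X + f \<partial>/\<partial>t\<close> is the pair \<open>(X, f)\<close>.\<close>

definition TMR ::
  "('a::topological_space, 'b::euclidean_space) chart set \<Rightarrow> ('a vfield \<Rightarrow> 'a vfield \<Rightarrow> 'a \<Rightarrow> real)
    \<Rightarrow> ('a, 'a vfield \<times> ('a \<Rightarrow> real)) lie_algebroid" where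
  "TMR \<A> \<Omega> = \<lparr>base_ring = smooth_functions \<A>,
     sections = vector_fields \<A> \<times> smooth_functions \<A>,
     smul = (\<lambda>h (X, f). (fmult h X, h * f)),
     anchor = (\<lambda>(X, f). X),
     bracket = (\<lambda>(X, f) (Y, g). (lie_bracket X Y, X g - Y f + \<Omega> X Y))\<rparr>"

abbreviation Omega_Poisson ::
  "('a::topological_space, 'b::euclidean_space) chart set \<Rightarrow> ('a vfield \<Rightarrow> 'a vfield \<Rightarrow> 'a \<Rightarrow> real)
    \<Rightarrow> ('a, 'a vfield \<times> ('a \<Rightarrow> real)) bivector \<Rightarrow> bool" where
  "Omega_Poisson \<A> \<Omega> P \<equiv> poisson_bivector (TMR \<A> \<Omega>) P"

definition d_dt :: "'a vfield \<times> ('a \<Rightarrow> real)" where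
  "d_dt = (0, 1)"

text \<open>A bivector field of \<open>M\<close> as a section of the second exterior power of \<open>TM \<oplus> \<real>\<close>: it is
  evaluated on the restrictions of the covectors to \<open>TM\<close>.\<close>

definition include_bivector ::
  "('a::topological_space, 'b::euclidean_space) chart set \<Rightarrow> ('a vfield \<Rightarrow> 'a vfield \<Rightarrow> 'a \<Rightarrow> real)
    \<Rightarrow> ('a, 'a vfield) bivector \<Rightarrow> ('a, 'a vfield \<times> ('a \<Rightarrow> real)) bivector" where
  "include_bivector \<A> \<Omega> Q =
     (\<lambda>\<xi> \<eta>. if \<xi> \<in> dual (TMR \<A> \<Omega>) \<and> \<eta> \<in> dual (TMR \<A> \<Omega>)
        then Q (\<lambda>X. \<xi> (X, 0)) (\<lambda>X. \<eta> (X, 0)) else 0)"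

text \<open>\<open>Q + \<partial>/\<partial>t \<and> E\<close>\<close>

definition assemble ::
  "('a::topological_space, 'b::euclidean_space) chart set \<Rightarrow> ('a vfield \<Rightarrow> 'a vfield \<Rightarrow> 'a \<Rightarrow> real)
    \<Rightarrow> ('a, 'a vfield) bivector \<Rightarrow> 'a vfield \<Rightarrow> ('a, 'a vfield \<times> ('a \<Rightarrow> real)) bivector" where
  "assemble \<A> \<Omega> Q E = include_bivector \<A> \<Omega> Q + wedge (TMR \<A> \<Omega>) d_dt (E, 0)"

end

theory Submission
  imports Defs
begin

text \<open>
  A covector of \<open>TM \<oplus> \<real>\<close> is \<open>\<alpha> + f dt\<close> with a 1-form \<open>\<alpha>\<close> and a function \<open>f\<close>. A bivector \<open>\<Pi>\<close> is
  determined by its values on pairs \<open>(\<alpha>, \<beta>)\<close>, which form the bivector field \<open>Q\<close>, and on pairs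
  \<open>(\<alpha>, dt)\<close>, which are the values \<open>\<alpha>(E)\<close> of a vector field \<open>E\<close>; this is the bijection between
  bivectors and pairs \<open>(Q, E)\<close> (\<open>assemble_inj\<close>, \<open>assemble_surj\<close>).

  The condition \<open>[\<Pi>, \<Pi>] = 0\<close> is evaluated with the classical formula
  \<open>[P, P](\<alpha>, \<beta>, \<gamma>) / 2 = \<Sum> \<rho>(\<sharp>\<alpha>) P(\<beta>, \<gamma>) - \<Sum> \<gamma>[\<sharp>\<alpha>, \<sharp>\<beta>]\<close> (cyclic sums), valid in every
  Lie algebroid (\<open>schouten_eq_form\<close> is its polarized form). For \<open>\<Pi> = Q + \<partial>/\<partial>t \<and> E\<close> the sharp map is
  \<open>\<alpha> + f dt \<mapsto> (\<sharp>\<^sub>Q \<alpha> - f E) + \<alpha>(E) \<partial>/\<partial>t\<close>. On three 1-forms the formula returns the one for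
  \<open>[Q, Q]\<close> (\<open>assembled_form_pull_back\<close>); on \<open>(\<alpha>, \<beta>, dt)\<close> it returns \<open>L\<^sub>E Q - \<sharp>\<^sub>Q \<Omega>\<close>
  on \<open>(\<alpha>, \<beta>)\<close>, up to the factor 2 (\<open>assembled_form_dt\<close>). As \<open>[\<Pi>, \<Pi>]\<close> is alternating and trilinear
  over functions, it vanishes if and only if these two kinds of values do (\<open>schouten_eq_0I\<close>).

  The Schouten bracket is defined by local decompositions into products of sections. To prove the
  classical formula, it is checked on products, where all derivatives of coefficients cancel
  (\<open>schouten_wedge_eq_form\<close>), summed, and seen to depend only on germs
  (\<open>schouten_form_cong_near\<close>); this also shows that the bracket is well defined.

  Since vector fields are derivations and tensor fields are multilinear maps, the geometry of the
  manifold enters through three facts. Smooth bumps exist (\<open>bump_function\<close>), which makes all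
  operations local. Near each point a derivation is \<open>\<Sum> X(x\<^sub>i) E\<^sub>i\<close> for a coordinate frame
  (\<open>coordinate_frame\<close>), by Hadamard's lemma; this provides the decompositions. Every linear functional
  on the 1-forms is evaluation on a vector field (\<open>one_forms_reflexive\<close>); this provides the sharp map
  of \<open>Q\<close> and the vector field \<open>E\<close>.
\<close>


section \<open>Functions of class \<open>C\<^sup>k\<close> on open sets\<close>

lemma Ck_on_cong:
  fixes f g :: "'b::real_normed_vector \<Rightarrow> 'c::real_normed_vector"
  assumes "open S" "Ck_on k S f" "\<And>x. x \<in> S \<Longrightarrow> f x = g x"
  shows "Ck_on k S g"
  using assms(2,3)
proof (induction k arbitrary: f g)
  case 0
  then show ?case using continuous_on_cong[of S S f g] by simp
next
  case (Suc k)
  have D: "(g has_derivative frechet_derivative f (at x)) (at x)" if "x \<in> S" for x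
    by (rule has_derivative_transform_within_open[of f _ _ _ S, OF _ assms(1) that])
      (use Suc.prems that in \<open>simp_all add: frechet_derivative_works\<close>)
  have E: "frechet_derivative f (at x) = frechet_derivative g (at x)" if "x \<in> S" for x
    by (rule frechet_derivative_at[OF D[OF that]])
  have "Ck_on k S (\<lambda>x. frechet_derivative g (at x) v)" for v
    by (rule Suc.IH[of "\<lambda>x. frechet_derivative f (at x) v"]) (use Suc.prems(1) E in auto)
  with D show ?case by (auto simp: differentiable_def)
qed

lemma Ck_on_SucI:
  assumes "open S" "\<And>x. x \<in> S \<Longrightarrow> (f has_derivative f' x) (at x)"
    and "\<And>v. Ck_on k S (\<lambda>x. f' x v)"
  shows "Ck_on (Suc k) S f"
proof -
  have "Ck_on k S (\<lambda>x. frechet_derivative f (at x) v)" for v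
    by (rule Ck_on_cong[OF assms(1) assms(3)[of v]]) (simp add: frechet_derivative_at[OF assms(2)])
  then show ?thesis using assms(2) by (auto simp: differentiable_def)
qed

lemma Ck_on_SucD:
  assumes "Ck_on (Suc k) S f"
  shows "x \<in> S \<Longrightarrow> (f has_derivative frechet_derivative f (at x)) (at x)"
    and "Ck_on k S (\<lambda>x. frechet_derivative f (at x) v)"
  using assms by (auto simp: frechet_derivative_works)

lemma Ck_on_lower: "Ck_on (Suc k) S f \<Longrightarrow> Ck_on k S f"
proof (induction k arbitrary: f)
  case 0
  then show ?case
    by (auto intro!: continuous_at_imp_continuous_on differentiable_imp_continuous_within)
qed auto

lemma Ck_on_continuous_on: "Ck_on k S f \<Longrightarrow> continuous_on S f"
proof (induction k)
  case (Suc k)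
  from Suc.IH[OF Ck_on_lower[OF Suc.prems]] show ?case .
qed simp

lemma Ck_on_subset: "Ck_on k S f \<Longrightarrow> T \<subseteq> S \<Longrightarrow> Ck_on k T f"
  by (induction k arbitrary: f) (auto intro: continuous_on_subset)

lemma Ck_on_local:
  assumes "\<And>x. x \<in> S \<Longrightarrow> \<exists>T. open T \<and> x \<in> T \<and> Ck_on k T f"
  shows "Ck_on k S f"
  using assms
proof (induction k arbitrary: f)
  case 0
  show ?case
    using 0 by (simp add: continuous_at_imp_continuous_on) (metis continuous_at_imp_continuous_on continuous_on_eq_continuous_at)
next
  case (Suc k)
  show ?case
    unfolding Ck_on.simps
  proof (intro conjI ballI allI Suc.IH)
    fix x v assume "x \<in> S"
    from Suc.prems[OF this] obtain T where T: "open T" "x \<in> T" "Ck_on (Suc k) T f" by blast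
    from T(2,3) show "f differentiable at x" by simp
    from T show "\<exists>T. open T \<and> x \<in> T \<and> Ck_on k T (\<lambda>x. frechet_derivative f (at x) v)" by auto
  qed
qed

lemma Ck_on_const: "Ck_on k S (\<lambda>x. c)"
  by (induction k arbitrary: c) simp_all

lemma Ck_on_linear:
  assumes "bounded_linear L" "open S" "Ck_on k S f"
  shows "Ck_on k S (\<lambda>x. L (f x))"
  using assms(3)
proof (induction k arbitrary: f)
  case 0
  then show ?case by (simp add: bounded_linear.continuous_on assms(1))
next
  case (Suc k)
  note f = Ck_on_SucD[OF Suc.prems]
  show ?case
    by (rule Ck_on_SucI[OF assms(2) bounded_linear.has_derivative[OF assms(1) f(1)] Suc.IH[OF f(2)]])
qed

lemma Ck_on_bounded_linear:
  assumes "bounded_linear L" "open S"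
  shows "Ck_on k S L"
proof -
  have "Ck_on k S (\<lambda>x. x :: 'a)"
  proof (cases k)
    case (Suc j)
    show ?thesis unfolding Suc by (rule Ck_on_SucI[OF assms(2) has_derivative_ident Ck_on_const])
  qed auto
  from Ck_on_linear[OF assms this] show ?thesis .
qed

lemma Ck_on_add:
  assumes "open S" "Ck_on k S f" "Ck_on k S g"
  shows "Ck_on k S (\<lambda>x. f x + g x)"
  using assms(2,3)
proof (induction k arbitrary: f g)
  case 0
  then show ?case by (simp add: continuous_on_add)
next
  case (Suc k)
  note f = Ck_on_SucD[OF Suc.prems(1)] and g = Ck_on_SucD[OF Suc.prems(2)]
  show ?case
    by (rule Ck_on_SucI[OF assms(1) has_derivative_add[OF f(1) g(1)] Suc.IH[OF f(2) g(2)]])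
qed

lemma Ck_on_mult:
  fixes f g :: "'b::real_normed_vector \<Rightarrow> real"
  assumes "open S" "Ck_on k S f" "Ck_on k S g"
  shows "Ck_on k S (\<lambda>x. f x * g x)"
  using assms(2,3)
proof (induction k arbitrary: f g)
  case 0
  then show ?case by (simp add: continuous_on_mult)
next
  case (Suc k)
  note f = Ck_on_SucD[OF Suc.prems(1)] and g = Ck_on_SucD[OF Suc.prems(2)]
  note lower = Suc.prems[THEN Ck_on_lower]
  show ?case
    by (rule Ck_on_SucI[OF assms(1) has_derivative_mult[OF f(1) g(1)]
          Ck_on_add[OF assms(1) Suc.IH[OF lower(1) g(2)] Suc.IH[OF f(2) lower(2)]]])
qed

lemma Ck_on_sum:
  assumes "open S" "\<And>i. i \<in> I \<Longrightarrow> Ck_on k S (f i)"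
  shows "Ck_on k S (\<lambda>x. \<Sum>i\<in>I. f i x)"
  using assms(2) by (induction I rule: infinite_finite_induct) (auto intro: Ck_on_const Ck_on_add assms(1))

lemma linear_expand:
  fixes L :: "'b::euclidean_space \<Rightarrow> real"
  assumes "linear L"
  shows "L w = (\<Sum>i\<in>Basis. (w \<bullet> i) * L i)"
proof -
  have "L (\<Sum>i\<in>Basis. (w \<bullet> i) *\<^sub>R i) = (\<Sum>i\<in>Basis. (w \<bullet> i) * L i)"
    by (simp add: linear_sum[OF assms] linear_cmul[OF assms])
  then show ?thesis by (simp add: euclidean_representation)
qed

text \<open>
  Only real-valued outer functions are treated, so that the chain rule writes the directional derivative
  of the composite as a sum of products of real functions of class \<open>C\<^sup>k\<close>.
\<close>

lemma Ck_on_compose: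
  fixes f :: "'b::real_normed_vector \<Rightarrow> 'd::euclidean_space" and g :: "'d \<Rightarrow> real"
  assumes "open S" "open T" "f ` S \<subseteq> T" "Ck_on k S f" "Ck_on k T g"
  shows "Ck_on k S (\<lambda>x. g (f x))"
  using assms(4,5)
proof (induction k arbitrary: g)
  case 0
  then show ?case
    using assms(3) continuous_on_compose2 by (auto simp del: image_subset_iff)
next
  case (Suc k)
  note f = Ck_on_SucD[OF Suc.prems(1)] and g = Ck_on_SucD[OF Suc.prems(2)]
  have D: "((\<lambda>x. g (f x)) has_derivative (\<lambda>v. \<Sum>i\<in>Basis.
      (frechet_derivative f (at x) v \<bullet> i) * frechet_derivative g (at (f x)) i)) (at x)" if "x \<in> S" for x
  proof -
    have gx: "(g has_derivative frechet_derivative g (at (f x))) (at (f x))"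
      using g(1) that assms(3) by blast
    show ?thesis
      using has_derivative_compose[OF f(1)[OF that] gx]
      by (subst (asm) linear_expand[OF has_derivative_linear[OF gx]])
  qed
  show ?case
    by (intro Ck_on_SucI[OF assms(1) D] Ck_on_sum[OF assms(1)] Ck_on_mult[OF assms(1)] Suc.IH
        Ck_on_linear[OF bounded_linear_inner_left assms(1)] f(2) g(2) Ck_on_lower[OF Suc.prems(1)])
qed

lemma Ck_on_inverse: "Ck_on k {t. t \<noteq> 0} (inverse :: real \<Rightarrow> real)"
proof (induction k)
  case (Suc k)
  have op: "open {t::real. t \<noteq> 0}" by (simp add: open_Collect_neq)
  have D: "(inverse has_derivative (\<lambda>v. (- 1 * v) * (inverse t * inverse t))) (at t)"
    if "t \<in> {t. t \<noteq> 0}" for t :: real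
    by (rule has_derivative_eq_rhs[OF has_derivative_inverse'[of t]]) (use that in auto)
  show ?case
    by (intro Ck_on_SucI[OF op D] Ck_on_mult[OF op] Ck_on_const Suc)
qed (auto intro: continuous_intros)


section \<open>Smooth bumps on Euclidean space\<close>

text \<open>
  The function \<open>exp (-1/t)\<close>, extended by 0 to \<open>t \<le> 0\<close>, together with its products with powers of
  \<open>1/t\<close>. The derivative of a member of this family is a linear combination of two members, which turns
  smoothness into an induction.
\<close>

definition flat :: "nat \<Rightarrow> real \<Rightarrow> real" where
  "flat n t = (if t \<le> 0 then 0 else inverse t ^ n * exp (- inverse t))"

text \<open>
  Exponential decay beats the pole. The difference quotient of \<open>flat n\<close> at 0 is \<open>flat (Suc n)\<close>, so
  this limit also gives the derivative at 0.
\<close>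

lemma flat_tendsto_0: "(flat n \<longlongrightarrow> 0) (at 0)"
proof -
  have "((\<lambda>t. inverse t ^ n / exp (inverse t)) \<longlongrightarrow> (0::real)) (at_right 0)"
    using tendsto_power_div_exp_0[of n] filterlim_inverse_at_top_right
    by (rule filterlim_compose)
  then have "(flat n \<longlongrightarrow> 0) (at_right 0)"
    by (rule Lim_transform_eventually)
      (auto simp: flat_def eventually_at_filter exp_minus field_simps)
  moreover have "(flat n \<longlongrightarrow> 0) (at_left 0)"
    by (rule Lim_transform_eventually[OF tendsto_const[of 0]])
      (auto simp: flat_def eventually_at_filter)
  ultimately show ?thesis by (simp add: filterlim_split_at)
qed

lemma flat_derivative:
  "(flat n has_real_derivative flat (Suc (Suc n)) t - real n * flat (Suc n) t) (at t)"
proof -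
  consider "t < 0" | "t = 0" | "t > 0" by linarith
  then show ?thesis
  proof cases
    case 1
    have "(flat n has_real_derivative 0) (at t)"
      by (rule has_field_derivative_transform_within_open[OF DERIV_const open_lessThan])
        (use 1 in \<open>auto simp: flat_def\<close>)
    with 1 show ?thesis by (simp add: flat_def)
  next
    case 2
    have "(flat n has_real_derivative 0) (at 0)"
      unfolding has_field_derivative_iff
      by (rule Lim_transform_eventually[OF flat_tendsto_0[of "Suc n"]])
        (auto simp: flat_def eventually_at_filter field_simps)
    then show ?thesis using 2 by (simp add: flat_def)
  next
    case 3
    have "((\<lambda>t. inverse t ^ n * exp (- inverse t)) has_real_derivative
        - (real n * (inverse t * inverse t * inverse t ^ (n - Suc 0)) * exp (- inverse t))
        + inverse t ^ n * (exp (- inverse t) * (inverse t * inverse t))) (at t)"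
      using 3 by (auto intro!: derivative_eq_intros)
    moreover have "- (real n * (inverse t * inverse t * inverse t ^ (n - Suc 0)) * exp (- inverse t))
        + inverse t ^ n * (exp (- inverse t) * (inverse t * inverse t))
        = flat (Suc (Suc n)) t - real n * flat (Suc n) t"
      using 3 by (cases n) (auto simp: flat_def algebra_simps)
    ultimately have "((\<lambda>t. inverse t ^ n * exp (- inverse t)) has_real_derivative
        flat (Suc (Suc n)) t - real n * flat (Suc n) t) (at t)"
      by simp
    then show ?thesis
      by (rule has_field_derivative_transform_within_open[OF _ open_greaterThan[of 0]])
        (use 3 in \<open>auto simp: flat_def\<close>)
  qed
qed

lemma Ck_on_flat: "Ck_on k UNIV (flat n)"
proof (induction k arbitrary: n)
  case 0
  show ?case
    using DERIV_isCont[OF flat_derivative] by (simp add: continuous_at_imp_continuous_on)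
next
  case (Suc k)
  have D: "(flat n has_derivative (\<lambda>v. flat (Suc (Suc n)) t * v + flat (Suc n) t * (- real n * v))) (at t)" for t
    by (rule has_derivative_eq_rhs[OF flat_derivative[unfolded has_field_derivative_def]])
      (auto simp: algebra_simps)
  show ?case
    by (intro Ck_on_SucI[OF open_UNIV D] Ck_on_add Ck_on_mult Ck_on_const Suc open_UNIV)
qed

text \<open>
  With \<open>u\<close> positive inside the sphere of radius \<open>2r\<close> and 0 outside it, and \<open>w\<close> positive outside the
  sphere of radius \<open>r\<close> and 0 inside it, the sum \<open>u + w\<close> has no zero and \<open>u / (u + w)\<close> is the bump.
\<close>

lemma exists_bump:
  fixes x0 :: "'b::euclidean_space"
  assumes "r > 0"
  obtains b :: "'b \<Rightarrow> real" where "smooth_on UNIV b" "\<And>x. x \<in> ball x0 r \<Longrightarrow> b x = 1"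
    "\<And>x. x \<notin> cball x0 (2 * r) \<Longrightarrow> b x = 0"
proof -
  define d where "d x = (x - x0) \<bullet> (x - x0)" for x
  have d: "d x = (dist x0 x)\<^sup>2" for x
    by (simp only: d_def dist_norm norm_minus_commute[of x0 x] power2_norm_eq_inner)
  define u where "u x = flat 0 (4 * r\<^sup>2 + - 1 * d x)" for x
  define w where "w x = flat 0 (d x + - (r\<^sup>2))" for x
  have pos: "u x + w x \<noteq> 0" for x
  proof -
    have "d x < 4 * r\<^sup>2 \<or> d x > r\<^sup>2" using assms by (smt (verit) zero_less_power)
    then show ?thesis by (auto simp: u_def w_def flat_def add_pos_pos add_nonneg_pos)
        (smt (verit) exp_gt_zero)+
  qed
  have Cd: "Ck_on k UNIV d" for k
  proof -
    have "Ck_on k UNIV (\<lambda>x. (x + - x0) \<bullet> i)" for i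
      by (intro Ck_on_linear[OF bounded_linear_inner_left] Ck_on_add Ck_on_const open_UNIV
          Ck_on_bounded_linear bounded_linear_ident)
    then have "Ck_on k UNIV (\<lambda>x. \<Sum>i\<in>Basis. ((x + - x0) \<bullet> i) * ((x + - x0) \<bullet> i))"
      by (intro Ck_on_sum Ck_on_mult open_UNIV)
    then show ?thesis unfolding d_def by (subst euclidean_inner) simp
  qed
  have "Ck_on k UNIV (\<lambda>x. 4 * r\<^sup>2 + - 1 * d x)" for k
    by (rule Ck_on_add[OF open_UNIV Ck_on_const Ck_on_mult[OF open_UNIV Ck_on_const Cd]])
  from Ck_on_compose[OF open_UNIV open_UNIV subset_UNIV this Ck_on_flat]
  have Cu: "Ck_on k UNIV u" for k unfolding u_def[abs_def] .
  have "Ck_on k UNIV (\<lambda>x. d x + - (r\<^sup>2))" for k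
    by (rule Ck_on_add[OF open_UNIV Cd Ck_on_const])
  from Ck_on_compose[OF open_UNIV open_UNIV subset_UNIV this Ck_on_flat]
  have Cw: "Ck_on k UNIV w" for k unfolding w_def[abs_def] .
  have "(\<lambda>x. u x + w x) ` UNIV \<subseteq> {t. t \<noteq> 0}" using pos by auto
  from Ck_on_compose[OF open_UNIV _ this Ck_on_add[OF open_UNIV Cu Cw] Ck_on_inverse]
  have Ci: "Ck_on k UNIV (\<lambda>x. inverse (u x + w x))" for k by (simp add: open_Collect_neq)
  show thesis
  proof
    show "smooth_on UNIV (\<lambda>x. u x * inverse (u x + w x))"
      unfolding smooth_on_def by (intro allI Ck_on_mult Cu Ci open_UNIV)
  next
    fix x assume "x \<in> ball x0 r"
    then have "d x < r\<^sup>2" by (simp add: d power_strict_mono)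
    then have "w x = 0" by (simp add: w_def flat_def)
    with pos[of x] show "u x * inverse (u x + w x) = 1" by simp
  next
    fix x assume "x \<notin> cball x0 (2 * r)"
    then have "(2 * r)\<^sup>2 < d x" unfolding d using assms by (intro power_strict_mono) auto
    then show "u x * inverse (u x + w x) = 0" by (simp add: u_def flat_def power_mult_distrib)
  qed
qed


section \<open>Hadamard's lemma\<close>

text \<open>
  Differentiation under the integral sign produces a factor \<open>t\<close>; the weight \<open>t ^ m\<close> absorbs it, so
  that the derivative is again an average of this form, of a directional derivative of \<open>g\<close>.
\<close>

lemma Ck_on_segment_average:
  fixes g :: "'b::euclidean_space \<Rightarrow> real"
  assumes "open B" "convex B" "y0 \<in> B" "Ck_on k B g"
  shows "Ck_on k B (\<lambda>y. integral {0..1} (\<lambda>t. t ^ m * g (y0 + t *\<^sub>R (y - y0))))"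
  using assms(4)
proof (induction k arbitrary: g m)
  case 0
  have seg: "y0 + t *\<^sub>R (y - y0) \<in> B" if "y \<in> B" "t \<in> {0..1}" for y t
    using convexD[OF assms(2) assms(3) that(1), of "1 - t" t] that(2) by (simp add: algebra_simps)
  have "continuous_on (B \<times> cbox 0 1) (\<lambda>(y, t). t ^ m * g (y0 + t *\<^sub>R (y - y0)))"
    unfolding split_beta using 0 seg
    by (auto intro!: continuous_intros continuous_on_compose2[of B g])
  from integral_continuous_on_param[OF this] show ?case by simp
next
  case (Suc k)
  note g = Ck_on_SucD[OF Suc.prems]
  have seg: "y0 + t *\<^sub>R (y - y0) \<in> B" if "y \<in> B" "t \<in> {0..1}" for y t
    using convexD[OF assms(2) assms(3) that(1), of "1 - t" t] that(2) by (simp add: algebra_simps)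
  define fx where "fx y t = Blinfun (\<lambda>v. t ^ Suc m * frechet_derivative g (at (y0 + t *\<^sub>R (y - y0))) v)" for y t
  have fx: "blinfun_apply (fx y t) = (\<lambda>v. t ^ Suc m * frechet_derivative g (at (y0 + t *\<^sub>R (y - y0))) v)"
    if "y \<in> B" "t \<in> {0..1}" for y t
    unfolding fx_def using has_derivative_bounded_linear[OF g(1)[OF seg[OF that]]]
    by (intro bounded_linear_Blinfun_apply bounded_linear_const_mult)
  have D: "((\<lambda>y. t ^ m * g (y0 + t *\<^sub>R (y - y0))) has_derivative blinfun_apply (fx y t)) (at y within B)"
    if "y \<in> B" "t \<in> cbox 0 1" for y t
  proof -
    have t: "t \<in> {0..1}" using that by simp
    have "((\<lambda>y. y0 + t *\<^sub>R (y - y0)) has_derivative (\<lambda>v. t *\<^sub>R v)) (at y)"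
      by (auto intro!: derivative_eq_intros)
    from has_derivative_compose[OF this g(1)[OF seg[OF that(1) t]]]
    have "((\<lambda>y. t ^ m * g (y0 + t *\<^sub>R (y - y0))) has_derivative
      (\<lambda>v. t ^ m * frechet_derivative g (at (y0 + t *\<^sub>R (y - y0))) (t *\<^sub>R v))) (at y)"
      by (rule has_derivative_mult_right)
    moreover have "frechet_derivative g (at (y0 + t *\<^sub>R (y - y0))) (t *\<^sub>R v)
        = t * frechet_derivative g (at (y0 + t *\<^sub>R (y - y0))) v" for v
      using has_derivative_linear[OF g(1)[OF seg[OF that(1) t]]] linear_cmul by fastforce
    ultimately show ?thesis
      by (subst fx[OF that(1) t]) (auto intro: has_derivative_at_withinI simp: algebra_simps)
  qed
  have contg: "continuous_on B g" and contd: "continuous_on B (\<lambda>x. frechet_derivative g (at x) v)" for v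
    using Ck_on_continuous_on Suc.prems g(2) by blast+
  have int: "(\<lambda>t. t ^ m * g (y0 + t *\<^sub>R (y - y0))) integrable_on cbox 0 1" if "y \<in> B" for y
    using seg[OF that]
    by (intro integrable_continuous) (auto intro!: continuous_intros continuous_on_compose2[OF contg])
  have contfx: "continuous_on (B \<times> cbox 0 1) (\<lambda>(y, t). fx y t)"
    unfolding split_beta
  proof (rule continuous_on_blinfun_componentwise)
    fix i :: 'b
    have "continuous_on (B \<times> cbox 0 1)
       (\<lambda>z. snd z ^ Suc m * frechet_derivative g (at (y0 + snd z *\<^sub>R (fst z - y0))) i)"
      using seg by (auto intro!: continuous_intros continuous_on_compose2[OF contd])
    then show "continuous_on (B \<times> cbox 0 1) (\<lambda>z. blinfun_apply (fx (fst z) (snd z)) i)"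
      by (rule continuous_on_eq) (auto simp: fx)
  qed
  have D0: "((\<lambda>y. integral (cbox 0 1) (\<lambda>t. t ^ m * g (y0 + t *\<^sub>R (y - y0)))) has_derivative
      blinfun_apply (integral (cbox 0 1) (fx y))) (at y)" if "y \<in> B" for y
    using leibniz_rule[OF D int contfx that assms(2)] at_within_open[OF that assms(1)] by simp
  have D': "((\<lambda>y. integral {0..1} (\<lambda>t. t ^ m * g (y0 + t *\<^sub>R (y - y0)))) has_derivative
      (\<lambda>v. integral {0..1} (\<lambda>t. t ^ Suc m * frechet_derivative g (at (y0 + t *\<^sub>R (y - y0))) v))) (at y)"
    if "y \<in> B" for y
  proof -
    have "continuous_on (cbox 0 1) (fx y)"
    proof -
      have "continuous_on (cbox 0 1) (\<lambda>t. case (y, t) of (y, t) \<Rightarrow> fx y t)"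
        by (rule continuous_on_compose2[OF contfx continuous_on_Pair[OF continuous_on_const continuous_on_id]])
          (use that in auto)
      then show ?thesis by simp
    qed
    then have "fx y integrable_on {0..1}"
      using integrable_continuous[of 0 1 "fx y"] by simp
    then have "blinfun_apply (integral {0..1} (fx y)) v = integral {0..1} (\<lambda>t. blinfun_apply (fx y t) v)" for v
      by (rule blinfun_apply_integral)
    also have "\<dots> v = integral {0..1} (\<lambda>t. t ^ Suc m * frechet_derivative g (at (y0 + t *\<^sub>R (y - y0))) v)" for v
      using fx[OF that] by (intro Henstock_Kurzweil_Integration.integral_cong) simp
    finally have "blinfun_apply (integral {0..1} (fx y)) = (\<lambda>v. integral {0..1}
        (\<lambda>t. t ^ Suc m * frechet_derivative g (at (y0 + t *\<^sub>R (y - y0))) v))"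
      by (rule ext)
    with D0[OF that] show ?thesis by (simp del: power_Suc)
  qed
  show ?case
    by (rule Ck_on_SucI[OF assms(1) D' Suc.IH[OF g(2)]])
qed

text \<open>
  The fundamental theorem of calculus along the segment from \<open>y0\<close> to \<open>y\<close>; the coefficient \<open>G i\<close>
  is the average of the \<open>i\<close>-th partial derivative over that segment.
\<close>

lemma Hadamard:
  fixes F :: "'b::euclidean_space \<Rightarrow> real"
  assumes "open B" "convex B" "y0 \<in> B" "smooth_on B F"
  obtains G where "\<And>i. smooth_on B (G i)"
    "\<And>i. G i y0 = frechet_derivative F (at y0) i"
    "\<And>y. y \<in> B \<Longrightarrow> F y = F y0 + (\<Sum>i\<in>Basis. ((y - y0) \<bullet> i) * G i y)"
proof
  define dF where "dF x = frechet_derivative F (at x)" for x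
  let ?G = "\<lambda>i y. integral {0..1} (\<lambda>t. t ^ 0 * dF (y0 + t *\<^sub>R (y - y0)) i)"
  have CF: "Ck_on (Suc k) B F" for k using assms(4) by (simp add: smooth_on_def del: Ck_on.simps)
  note F = Ck_on_SucD[OF CF, folded dF_def]
  show "smooth_on B (?G i)" for i
    unfolding smooth_on_def using Ck_on_segment_average[OF assms(1-3) F(2), where m = 0] by blast
  show "?G i y0 = frechet_derivative F (at y0) i" for i by (simp add: dF_def)
  show "F y = F y0 + (\<Sum>i\<in>Basis. ((y - y0) \<bullet> i) * ?G i y)" if "y \<in> B" for y
  proof -
    have seg: "y0 + t *\<^sub>R (y - y0) \<in> B" if "t \<in> {0..1}" for t
      using convexD[OF assms(2) assms(3) \<open>y \<in> B\<close>, of "1 - t" t] that by (simp add: algebra_simps)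
    have contd: "continuous_on B (\<lambda>x. dF x v)" for v
      using Ck_on_continuous_on F(2) by blast
    have D: "((\<lambda>t. F (y0 + t *\<^sub>R (y - y0))) has_vector_derivative dF (y0 + t *\<^sub>R (y - y0)) (y - y0))
        (at t within {0..1})" if "t \<in> {0..1}" for t
    proof -
      have "((\<lambda>t. y0 + t *\<^sub>R (y - y0)) has_derivative (\<lambda>s. s *\<^sub>R (y - y0))) (at t within {0..1})"
        by (auto intro!: derivative_eq_intros)
      from has_derivative_compose[OF this F(1)[OF seg[OF that]]]
      show ?thesis
        using has_derivative_linear[OF F(1)[OF seg[OF that]]] linear_cmul
        unfolding has_vector_derivative_def by fastforce
    qed
    have "((\<lambda>t. dF (y0 + t *\<^sub>R (y - y0)) (y - y0)) has_integral F y - F y0) {0..1}"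
      using fundamental_theorem_of_calculus[OF zero_le_one D] by simp
    moreover have "dF (y0 + t *\<^sub>R (y - y0)) (y - y0)
        = (\<Sum>i\<in>Basis. ((y - y0) \<bullet> i) * (dF (y0 + t *\<^sub>R (y - y0)) i))" if "t \<in> {0..1}" for t
    proof -
      have "linear (dF (y0 + t *\<^sub>R (y - y0)))"
        by (rule has_derivative_linear[OF F(1)[OF seg[OF that]]])
      then show ?thesis
        by (rule linear_expand)
    qed
    ultimately have 1: "((\<lambda>t. \<Sum>i\<in>Basis. ((y - y0) \<bullet> i) * (dF (y0 + t *\<^sub>R (y - y0)) i)) has_integral F y - F y0) {0..1}"
      by (rule has_integral_eq[rotated]) 
    have "(\<lambda>t. dF (y0 + t *\<^sub>R (y - y0)) i) integrable_on {0..1}" for i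
      using seg by (intro integrable_continuous_real)
        (auto intro!: continuous_intros continuous_on_compose2[OF contd])
    then have "((\<lambda>t. \<Sum>i\<in>Basis. ((y - y0) \<bullet> i) * (dF (y0 + t *\<^sub>R (y - y0)) i)) has_integral
        (\<Sum>i\<in>Basis. ((y - y0) \<bullet> i) * ?G i y)) {0..1}"
      by (intro has_integral_sum has_integral_mult_right) (auto simp: integrable_integral)
    from has_integral_unique[OF 1 this] show ?thesis by simp
  qed
qed


section \<open>Algebroids in which sections can be localized\<close>

lemma linear_mapsD:
  assumes "\<alpha> \<in> linear_maps C S sm"
  shows "s \<in> S \<Longrightarrow> \<alpha> s \<in> C" "s \<in> S \<Longrightarrow> t \<in> S \<Longrightarrow> \<alpha> (s + t) = \<alpha> s + \<alpha> t"
    "f \<in> C \<Longrightarrow> s \<in> S \<Longrightarrow> \<alpha> (sm f s) = f * \<alpha> s" "s \<notin> S \<Longrightarrow> \<alpha> s = 0"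
  using assms by (auto simp: linear_maps_def)

lemma linear_maps_sum:
  assumes "\<Phi> \<in> linear_maps C S sm" "0 \<in> S" "\<And>s t. s \<in> S \<Longrightarrow> t \<in> S \<Longrightarrow> s + t \<in> S"
    and "\<And>i. f i \<in> C" "\<And>i. s i \<in> S" "\<And>i. sm (f i) (s i) \<in> S"
  shows "(\<Sum>i\<in>I. sm (f i) (s i)) \<in> S" and "\<Phi> (\<Sum>i\<in>I. sm (f i) (s i)) = (\<Sum>i\<in>I. f i * \<Phi> (s i))"
proof -
  note \<Phi> = linear_mapsD[OF assms(1)]
  have "\<Phi> 0 = 0" using \<Phi>(2)[OF assms(2,2)] by simp
  then have "(\<Sum>i\<in>I. sm (f i) (s i)) \<in> S \<and> \<Phi> (\<Sum>i\<in>I. sm (f i) (s i)) = (\<Sum>i\<in>I. f i * \<Phi> (s i))"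
    by (induction I rule: infinite_finite_induct) (simp_all add: assms(2-) \<Phi>(2,3))
  then show "(\<Sum>i\<in>I. sm (f i) (s i)) \<in> S" "\<Phi> (\<Sum>i\<in>I. sm (f i) (s i)) = (\<Sum>i\<in>I. f i * \<Phi> (s i))"
    by blast+
qed

lemma alternating_mapsD:
  assumes "\<omega> \<in> alternating_maps C S sm"
  shows "s \<in> S \<Longrightarrow> \<omega> s \<in> linear_maps C S sm" "s \<in> S \<Longrightarrow> t \<in> S \<Longrightarrow> \<omega> s t = - \<omega> t s"
    "s \<notin> S \<Longrightarrow> \<omega> s = 0" "s \<in> S \<Longrightarrow> \<omega> s s = 0"
  using assms unfolding alternating_maps_def by blast+

text \<open>
  The structure in which Schouten brackets are computed: sections over a ring of functions with a skew
  bracket that satisfies the Leibniz rule. The axiom \<open>bump\<close> makes derivations and brackets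
  local; \<open>separating\<close> makes a section recoverable from its pairings with covectors, the only access
  to the value of an abstract section at a point.
\<close>

locale local_algebroid =
  fixes A :: "('a::topological_space, 's::ab_group_add) lie_algebroid"
  assumes ring_const: "(\<lambda>_. c) \<in> base_ring A"
    and ring_add: "f \<in> base_ring A \<Longrightarrow> g \<in> base_ring A \<Longrightarrow> f + g \<in> base_ring A"
    and ring_mult: "f \<in> base_ring A \<Longrightarrow> g \<in> base_ring A \<Longrightarrow> f * g \<in> base_ring A"
    and section_0: "0 \<in> sections A"
    and section_add: "s \<in> sections A \<Longrightarrow> t \<in> sections A \<Longrightarrow> s + t \<in> sections A"
    and section_uminus: "s \<in> sections A \<Longrightarrow> - s \<in> sections A"
    and section_smul: "f \<in> base_ring A \<Longrightarrow> s \<in> sections A \<Longrightarrow> smul A f s \<in> sections A"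
    and anchor_ring: "s \<in> sections A \<Longrightarrow> f \<in> base_ring A \<Longrightarrow> anchor A s f \<in> base_ring A"
    and anchor_add: "s \<in> sections A \<Longrightarrow> f \<in> base_ring A \<Longrightarrow> g \<in> base_ring A \<Longrightarrow>
      anchor A s (f + g) = anchor A s f + anchor A s g"
    and anchor_mult: "s \<in> sections A \<Longrightarrow> f \<in> base_ring A \<Longrightarrow> g \<in> base_ring A \<Longrightarrow>
      anchor A s (f * g) = f * anchor A s g + anchor A s f * g"
    and anchor_section_add: "s \<in> sections A \<Longrightarrow> t \<in> sections A \<Longrightarrow>
      anchor A (s + t) f = anchor A s f + anchor A t f"
    and anchor_smul: "s \<in> sections A \<Longrightarrow> f \<in> base_ring A \<Longrightarrow> anchor A (smul A f s) g = f * anchor A s g"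
    and bracket_section: "s \<in> sections A \<Longrightarrow> t \<in> sections A \<Longrightarrow> bracket A s t \<in> sections A"
    and bracket_skew: "s \<in> sections A \<Longrightarrow> t \<in> sections A \<Longrightarrow> bracket A s t = - bracket A t s"
    and bracket_add: "s \<in> sections A \<Longrightarrow> t \<in> sections A \<Longrightarrow> u \<in> sections A \<Longrightarrow>
      bracket A s (t + u) = bracket A s t + bracket A s u"
    and bracket_smul: "s \<in> sections A \<Longrightarrow> t \<in> sections A \<Longrightarrow> f \<in> base_ring A \<Longrightarrow>
      bracket A s (smul A f t) = smul A f (bracket A s t) + smul A (anchor A s f) t"
    and separating: "s \<in> sections A \<Longrightarrow> (\<And>\<xi>. \<xi> \<in> dual A \<Longrightarrow> \<xi> s = 0) \<Longrightarrow> s = 0"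
    and bump: "open U \<Longrightarrow> p \<in> U \<Longrightarrow> \<exists>h\<in>base_ring A. h p = 1 \<and> (\<forall>q. q \<notin> U \<longrightarrow> h q = 0)"
begin

abbreviation "C \<equiv> base_ring A"
abbreviation "S \<equiv> sections A"
abbreviation "\<rho> \<equiv> anchor A"
abbreviation "br \<equiv> bracket A"

lemma ring_0: "0 \<in> C" using ring_const[of 0] by (simp add: func_zero)

lemma ring_uminus: "f \<in> C \<Longrightarrow> - f \<in> C"
  using ring_mult[OF ring_const[of "-1"], of f] by (simp add: func_times fun_Compl_def)

lemma ring_minus: "f \<in> C \<Longrightarrow> g \<in> C \<Longrightarrow> f - g \<in> C"
  using ring_add[OF _ ring_uminus, of f g] by simp

lemma section_minus: "s \<in> S \<Longrightarrow> t \<in> S \<Longrightarrow> s - t \<in> S"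
  using section_add[OF _ section_uminus, of s t] by simp

lemma dual_ring: "\<xi> \<in> dual A \<Longrightarrow> s \<in> S \<Longrightarrow> \<xi> s \<in> C"
  and dual_add: "\<xi> \<in> dual A \<Longrightarrow> s \<in> S \<Longrightarrow> t \<in> S \<Longrightarrow> \<xi> (s + t) = \<xi> s + \<xi> t"
  and dual_smul: "\<xi> \<in> dual A \<Longrightarrow> f \<in> C \<Longrightarrow> s \<in> S \<Longrightarrow> \<xi> (smul A f s) = f * \<xi> s"
  unfolding dual_def by (auto dest: linear_mapsD)

lemma dual_0: "\<xi> \<in> dual A \<Longrightarrow> \<xi> 0 = 0"
  using dual_add[of \<xi> 0 0] section_0 by simp

lemma dual_uminus: "\<xi> \<in> dual A \<Longrightarrow> s \<in> S \<Longrightarrow> \<xi> (- s) = - \<xi> s"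
  using dual_add[of \<xi> s "- s"] dual_0[of \<xi>] section_uminus[of s] by (simp add: eq_neg_iff_add_eq_0 add.commute)

lemma dual_minus: "\<xi> \<in> dual A \<Longrightarrow> s \<in> S \<Longrightarrow> t \<in> S \<Longrightarrow> \<xi> (s - t) = \<xi> s - \<xi> t"
  using dual_add[of \<xi> s "- t"] dual_uminus[of \<xi> t] section_uminus[of t] by simp

lemmas dual_linear = dual_ring dual_add dual_smul dual_0 dual_uminus dual_minus

lemma anchor_0: "s \<in> S \<Longrightarrow> \<rho> s 0 = 0"
  using anchor_add[of s 0 0] ring_0 by simp

lemma anchor_uminus: "s \<in> S \<Longrightarrow> f \<in> C \<Longrightarrow> \<rho> s (- f) = - \<rho> s f"
  using anchor_add[of s f "- f"] anchor_0 ring_uminus by (simp add: eq_neg_iff_add_eq_0 add.commute)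

lemma anchor_minus: "s \<in> S \<Longrightarrow> f \<in> C \<Longrightarrow> g \<in> C \<Longrightarrow> \<rho> s (f - g) = \<rho> s f - \<rho> s g"
  using anchor_add[of s f "- g"] anchor_uminus ring_uminus by simp

lemma anchor_section_0: "\<rho> 0 f = 0"
  using anchor_section_add[of 0 0 f] section_0 by simp

lemma anchor_section_uminus: "s \<in> S \<Longrightarrow> \<rho> (- s) f = - \<rho> s f"
  using anchor_section_add[of s "- s" f] anchor_section_0 section_uminus
  by (simp add: eq_neg_iff_add_eq_0 add.commute)

lemma anchor_section_minus: "s \<in> S \<Longrightarrow> t \<in> S \<Longrightarrow> \<rho> (s - t) f = \<rho> s f - \<rho> t f"
  using anchor_section_add[of s "- t"] anchor_section_uminus section_uminus by simp

lemma bracket_0: "s \<in> S \<Longrightarrow> br s 0 = 0"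
  using bracket_add[of s 0 0] section_0 by simp

lemma bracket_uminus: "s \<in> S \<Longrightarrow> t \<in> S \<Longrightarrow> br s (- t) = - br s t"
  using bracket_add[of s t "- t"] bracket_0 section_uminus
  by (simp add: eq_neg_iff_add_eq_0 add.commute)

lemma bracket_minus: "s \<in> S \<Longrightarrow> t \<in> S \<Longrightarrow> u \<in> S \<Longrightarrow> br s (t - u) = br s t - br s u"
  using bracket_add[of s t "- u"] bracket_uminus section_uminus by simp

lemma bracket_add_left: "s \<in> S \<Longrightarrow> t \<in> S \<Longrightarrow> u \<in> S \<Longrightarrow> br (s + t) u = br s u + br t u"
  using bracket_skew[of "s + t" u] bracket_skew[of u s] bracket_skew[of u t]
    bracket_add[of u s t] section_add[of s t] by simp

lemma bracket_minus_left: "s \<in> S \<Longrightarrow> t \<in> S \<Longrightarrow> u \<in> S \<Longrightarrow> br (s - t) u = br s u - br t u"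
  using bracket_skew[of "s - t" u] bracket_skew[of u s] bracket_skew[of u t]
    bracket_minus[of u s t] section_minus[of s t] by simp

lemma bracket_0_left: "s \<in> S \<Longrightarrow> br 0 s = 0"
  using bracket_skew[of 0 s] bracket_0 section_0 by simp

lemma dual_bracket_smul:
  assumes "\<gamma> \<in> dual A" "s \<in> S" "t \<in> S" "f \<in> C"
  shows "\<gamma> (br s (smul A f t)) = f * \<gamma> (br s t) + \<rho> s f * \<gamma> t"
  using assms(2-)
  by (simp add: bracket_smul dual_linear[OF assms(1)] section_smul anchor_ring bracket_section)

lemma dual_bracket_smul_left:
  assumes "\<gamma> \<in> dual A" "s \<in> S" "t \<in> S" "f \<in> C"
  shows "\<gamma> (br (smul A f s) t) = f * \<gamma> (br s t) - \<rho> t f * \<gamma> s"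
  using dual_bracket_smul[OF assms(1,3,2,4)] bracket_skew[of "smul A f s" t] bracket_skew[of s t] assms(2-)
  by (simp add: dual_linear[OF assms(1)] section_smul bracket_section algebra_simps)

lemma dual_bracket_smul_smul:
  assumes "\<gamma> \<in> dual A" "s \<in> S" "t \<in> S" "f \<in> C" "g \<in> C"
  shows "\<gamma> (br (smul A f s) (smul A g t)) = f * g * \<gamma> (br s t) + f * \<rho> s g * \<gamma> t - g * \<rho> t f * \<gamma> s"
  using assms(2-)
  by (simp add: dual_bracket_smul[OF assms(1)] section_smul dual_bracket_smul_left[OF assms(1)]
      anchor_smul algebra_simps)


section \<open>Germs of sections\<close>

text \<open>
  Equality of germs at \<open>p\<close>, tested by all covectors on one common neighbourhood.
\<close>

definition agree_near :: "'a \<Rightarrow> 's \<Rightarrow> 's \<Rightarrow> bool" where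
  "agree_near p s t \<longleftrightarrow> (\<forall>\<^sub>F q in nhds p. \<forall>\<xi>\<in>dual A. \<xi> s q = \<xi> t q)"

text \<open>
  If \<open>f - g\<close> vanishes on a neighbourhood on which a bump \<open>h\<close> lives, then \<open>(f - g) h = 0\<close>, and
  the Leibniz rule at \<open>p\<close>, where \<open>h\<close> is 1, leaves only the derivative of \<open>f - g\<close>.
\<close>

lemma anchor_cong_near:
  assumes "s \<in> S" "f \<in> C" "g \<in> C" "\<forall>\<^sub>F q in nhds p. f q = g q"
  shows "\<rho> s f p = \<rho> s g p"
proof -
  obtain U where U: "open U" "p \<in> U" "\<And>q. q \<in> U \<Longrightarrow> f q = g q"
    using assms(4) by (auto simp: eventually_nhds)
  obtain h where h: "h \<in> C" "h p = 1" "\<And>q. q \<notin> U \<Longrightarrow> h q = 0"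
    using bump[OF U(1,2)] by blast
  have "(f - g) * h = 0"
  proof
    fix q show "((f - g) * h) q = 0 q" using U(3) h(3) by (cases "q \<in> U") auto
  qed
  then have "(f - g) * \<rho> s h + \<rho> s (f - g) * h = 0"
    using anchor_mult[OF assms(1) ring_minus[OF assms(2,3)] h(1)] anchor_0[OF assms(1)] by simp
  then have "((f - g) * \<rho> s h + \<rho> s (f - g) * h) p = 0" by simp
  then show ?thesis
    using U(2,3) h(2) assms by (simp add: anchor_minus)
qed

text \<open>
  Multiplying the difference of two sections with the same germ by a bump kills it globally, since
  all covectors vanish on the product. The next two lemmas apply the Leibniz rules to this product.
\<close>

lemma cut_off:
  assumes "s \<in> S" "t \<in> S" "agree_near p s t"
  obtains h where "h \<in> C" "h p = 1" "smul A h (s - t) = 0"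
proof -
  obtain U where U: "open U" "p \<in> U" "\<And>q \<xi>. q \<in> U \<Longrightarrow> \<xi> \<in> dual A \<Longrightarrow> \<xi> s q = \<xi> t q"
    using assms(3) by (auto simp: eventually_nhds agree_near_def)
  obtain h where h: "h \<in> C" "h p = 1" "\<And>q. q \<notin> U \<Longrightarrow> h q = 0"
    using bump[OF U(1,2)] by blast
  have "\<xi> (smul A h (s - t)) = 0" if "\<xi> \<in> dual A" for \<xi>
  proof
    fix q
    show "\<xi> (smul A h (s - t)) q = 0 q"
      using that U(3)[of q \<xi>] h assms by (cases "q \<in> U") (auto simp: dual_smul[OF that] dual_minus[OF that] section_minus)
  qed
  then have "smul A h (s - t) = 0"
    using separating section_smul section_minus h assms by blast
  with h(1,2) show thesis by (rule that)
qed

lemma anchor_agree_near: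
  assumes "s \<in> S" "t \<in> S" "agree_near p s t"
  shows "\<rho> s f p = \<rho> t f p"
proof -
  obtain h where h: "h \<in> C" "h p = 1" "smul A h (s - t) = 0"
    using cut_off[OF assms] .
  have "h * \<rho> (s - t) f = 0"
    using anchor_smul[of "s - t" h f] h section_minus assms anchor_section_0 by simp
  then have "(h * \<rho> (s - t) f) p = 0" by simp
  then show ?thesis using h(2) assms by (simp add: anchor_section_minus)
qed

lemma bracket_agree_near:
  assumes "s \<in> S" "t \<in> S" "agree_near p s t" "u \<in> S" "\<gamma> \<in> dual A"
  shows "\<gamma> (br u s) p = \<gamma> (br u t) p"
proof -
  obtain h where h: "h \<in> C" "h p = 1" "smul A h (s - t) = 0"
    using cut_off[OF assms(1-3)] .
  have "\<gamma> s p = \<gamma> t p"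
    using assms(3,5) by (auto simp: agree_near_def dest: eventually_nhds_x_imp_x)
  moreover have "h * \<gamma> (br u (s - t)) + \<rho> u h * \<gamma> (s - t) = 0"
    using dual_bracket_smul[OF assms(5,4) section_minus[OF assms(1,2)] h(1)] assms(4)
    by (simp add: h(3) bracket_0 dual_0[OF assms(5)])
  then have "(h * \<gamma> (br u (s - t)) + \<rho> u h * \<gamma> (s - t)) p = 0" by simp
  ultimately show ?thesis
    using h(2) assms(1-4) by (simp add: bracket_minus dual_linear[OF assms(5)] bracket_section)
qed

lemma bracket_agree_near2:
  assumes "s \<in> S" "t \<in> S" "agree_near p s t" "s' \<in> S" "t' \<in> S" "agree_near p s' t'" "\<gamma> \<in> dual A"
  shows "\<gamma> (br s s') p = \<gamma> (br t t') p"
proof -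
  have "\<gamma> (br s s') p = \<gamma> (br s t') p" using bracket_agree_near assms by blast
  also have "\<dots> = \<gamma> (br t t') p"
    using bracket_agree_near[OF assms(1,2,3,5,7)] assms(1-6) bracket_skew[of s t'] bracket_skew[of t t']
    by (simp add: dual_linear[OF assms(7)] bracket_section)
  finally show ?thesis .
qed


section \<open>The Schouten bracket in terms of the sharp map\<close>

text \<open>
  For a bivector \<open>P\<close> with \<open>\<beta> (s \<alpha>) = P \<alpha> \<beta>\<close>, half of \<open>koszul s s\<close> is
  \<open>\<rho>(s \<alpha>) (P(\<beta>, \<gamma>)) - \<gamma> [s \<alpha>, s \<beta>]\<close>; its cyclic sum is the classical formula for half of \<open>[P, P]\<close>.
  This is the polarization, symmetric and biadditive in \<open>s\<close> and \<open>s'\<close>, as summing over two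
  decompositions requires.
\<close>

definition koszul ::
  "(('s \<Rightarrow> 'a \<Rightarrow> real) \<Rightarrow> 's) \<Rightarrow> (('s \<Rightarrow> 'a \<Rightarrow> real) \<Rightarrow> 's)
    \<Rightarrow> ('s \<Rightarrow> 'a \<Rightarrow> real) \<Rightarrow> ('s \<Rightarrow> 'a \<Rightarrow> real) \<Rightarrow> ('s \<Rightarrow> 'a \<Rightarrow> real) \<Rightarrow> 'a \<Rightarrow> real" where
  "koszul s s' \<alpha> \<beta> \<gamma> = \<rho> (s \<alpha>) (\<gamma> (s' \<beta>)) + \<rho> (s' \<alpha>) (\<gamma> (s \<beta>))
     - \<gamma> (br (s \<alpha>) (s' \<beta>)) - \<gamma> (br (s' \<alpha>) (s \<beta>))"

definition schouten_form ::
  "(('s \<Rightarrow> 'a \<Rightarrow> real) \<Rightarrow> 's) \<Rightarrow> (('s \<Rightarrow> 'a \<Rightarrow> real) \<Rightarrow> 's)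
    \<Rightarrow> ('s \<Rightarrow> 'a \<Rightarrow> real) \<Rightarrow> ('s \<Rightarrow> 'a \<Rightarrow> real) \<Rightarrow> ('s \<Rightarrow> 'a \<Rightarrow> real) \<Rightarrow> 'a \<Rightarrow> real" where
  "schouten_form s s' \<alpha> \<beta> \<gamma> = koszul s s' \<alpha> \<beta> \<gamma> + koszul s s' \<beta> \<gamma> \<alpha> + koszul s s' \<gamma> \<alpha> \<beta>"

text \<open>
  The sharp map of the product \<open>a \<and> b\<close>.
\<close>

definition contract :: "'s \<times> 's \<Rightarrow> ('s \<Rightarrow> 'a \<Rightarrow> real) \<Rightarrow> 's" where
  "contract = (\<lambda>(a, b) \<alpha>. smul A (\<alpha> b) a - smul A (\<alpha> a) b)"

lemma contract_section: "x \<in> S \<times> S \<Longrightarrow> \<alpha> \<in> dual A \<Longrightarrow> contract x \<alpha> \<in> S"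
  by (auto simp: contract_def section_minus section_smul dual_ring)

lemma dual_contract:
  "a \<in> S \<Longrightarrow> b \<in> S \<Longrightarrow> \<alpha> \<in> dual A \<Longrightarrow> \<beta> \<in> dual A \<Longrightarrow> \<beta> (contract (a, b) \<alpha>) = wedge A a b \<alpha> \<beta>"
  by (simp add: contract_def wedge_def dual_linear[of \<beta>] section_smul dual_ring[of \<alpha>] algebra_simps)

text \<open>
  The Leibniz rules for anchor and bracket. The derivatives of \<open>\<beta> c\<close> and \<open>\<beta> d\<close> have already
  cancelled here. The others are of values of the first covector on the first product and of the third
  covector on the second; they cancel in the cyclic sum against the summands with the two products
  interchanged.
\<close>

lemma koszul_contract:
  assumes "a \<in> S" "b \<in> S" "c \<in> S" "d \<in> S" "\<alpha> \<in> dual A" "\<beta> \<in> dual A" "\<gamma> \<in> dual A"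
  shows "\<rho> (contract (a, b) \<alpha>) (\<gamma> (contract (c, d) \<beta>)) - \<gamma> (br (contract (a, b) \<alpha>) (contract (c, d) \<beta>))
    = \<alpha> b * \<beta> d * (\<rho> a (\<gamma> c) - \<gamma> (br a c)) - \<alpha> b * \<beta> c * (\<rho> a (\<gamma> d) - \<gamma> (br a d))
    - \<alpha> a * \<beta> d * (\<rho> b (\<gamma> c) - \<gamma> (br b c)) + \<alpha> a * \<beta> c * (\<rho> b (\<gamma> d) - \<gamma> (br b d))
    + \<gamma> a * (\<beta> d * \<rho> c (\<alpha> b) - \<beta> c * \<rho> d (\<alpha> b)) - \<gamma> b * (\<beta> d * \<rho> c (\<alpha> a) - \<beta> c * \<rho> d (\<alpha> a))"
  using assms(1-4)
  by (simp add: contract_def section_minus section_smul dual_linear[OF assms(5)] dual_linear[OF assms(6)]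
      dual_linear[OF assms(7)] anchor_section_minus anchor_smul anchor_minus anchor_mult ring_mult
      bracket_minus bracket_minus_left bracket_section dual_bracket_smul_smul[OF assms(7)],
    simp only: algebra_simps)

text \<open>
  After the derivatives of coefficients have cancelled, the remaining terms each pair one covector
  with a bracket of two factors and multiply by values on the other two factors, which is the
  expansion of the defining sum of triple products.
\<close>

lemma schouten_wedge_eq_form:
  assumes "a \<in> S" "b \<in> S" "c \<in> S" "d \<in> S" "\<alpha> \<in> dual A" "\<beta> \<in> dual A" "\<gamma> \<in> dual A"
  shows "schouten_wedge A (a, b) (c, d) \<alpha> \<beta> \<gamma> = schouten_form (contract (a, b)) (contract (c, d)) \<alpha> \<beta> \<gamma>"
proof -
  have skew: "\<zeta> (br c a) = - \<zeta> (br a c)" "\<zeta> (br d a) = - \<zeta> (br a d)"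
    "\<zeta> (br c b) = - \<zeta> (br b c)" "\<zeta> (br d b) = - \<zeta> (br b d)" if "\<zeta> \<in> dual A" for \<zeta>
    using assms(1-4) bracket_skew[of c a] bracket_skew[of d a] bracket_skew[of c b] bracket_skew[of d b]
    by (simp_all add: dual_linear[OF that] bracket_section)
  have split: "koszul s s' \<alpha> \<beta> \<gamma> = (\<rho> (s \<alpha>) (\<gamma> (s' \<beta>)) - \<gamma> (br (s \<alpha>) (s' \<beta>)))
     + (\<rho> (s' \<alpha>) (\<gamma> (s \<beta>)) - \<gamma> (br (s' \<alpha>) (s \<beta>)))" for s s' \<alpha> \<beta> \<gamma>
    by (simp add: koszul_def)
  show ?thesis
    using assms
    by (simp add: schouten_wedge_def wedge3_def wedge_def schouten_form_def split koszul_contract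
        skew[OF assms(5)] skew[OF assms(6)] skew[OF assms(7)] bracket_section algebra_simps)
qed

lemma schouten_form_commute: "schouten_form s s' \<alpha> \<beta> \<gamma> = schouten_form s' s \<alpha> \<beta> \<gamma>"
  by (simp add: schouten_form_def koszul_def algebra_simps)

lemma schouten_form_0:
  assumes "\<alpha> \<in> dual A" "\<beta> \<in> dual A" "\<gamma> \<in> dual A" "\<And>\<zeta>. \<zeta> \<in> dual A \<Longrightarrow> s \<zeta> \<in> S"
  shows "schouten_form (\<lambda>_. 0) s \<alpha> \<beta> \<gamma> = 0"
  by (simp add: schouten_form_def koszul_def anchor_section_0 anchor_0 bracket_0 bracket_0_left
      dual_0[OF assms(1)] dual_0[OF assms(2)] dual_0[OF assms(3)] assms)

lemma schouten_form_add:
  assumes "\<alpha> \<in> dual A" "\<beta> \<in> dual A" "\<gamma> \<in> dual A" "\<And>\<zeta>. \<zeta> \<in> dual A \<Longrightarrow> s \<zeta> \<in> S"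
    "\<And>\<zeta>. \<zeta> \<in> dual A \<Longrightarrow> t \<zeta> \<in> S" "\<And>\<zeta>. \<zeta> \<in> dual A \<Longrightarrow> u \<zeta> \<in> S"
  shows "schouten_form (\<lambda>\<zeta>. s \<zeta> + t \<zeta>) u \<alpha> \<beta> \<gamma> = schouten_form s u \<alpha> \<beta> \<gamma> + schouten_form t u \<alpha> \<beta> \<gamma>"
  by (simp add: schouten_form_def koszul_def anchor_section_add anchor_add bracket_add
      bracket_add_left section_add bracket_section dual_linear[OF assms(1)] dual_linear[OF assms(2)]
      dual_linear[OF assms(3)] assms algebra_simps)

text \<open>
  At a point the form sees only germs; this is why the Schouten bracket does not depend on the
  decompositions used to compute it.
\<close>

lemma schouten_form_cong_near:
  assumes "\<And>\<zeta>. \<zeta> \<in> dual A \<Longrightarrow> s \<zeta> \<in> S \<and> t \<zeta> \<in> S \<and> agree_near p (s \<zeta>) (t \<zeta>)"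
    "\<And>\<zeta>. \<zeta> \<in> dual A \<Longrightarrow> s' \<zeta> \<in> S \<and> t' \<zeta> \<in> S \<and> agree_near p (s' \<zeta>) (t' \<zeta>)"
    "\<alpha> \<in> dual A" "\<beta> \<in> dual A" "\<gamma> \<in> dual A"
  shows "schouten_form s s' \<alpha> \<beta> \<gamma> p = schouten_form t t' \<alpha> \<beta> \<gamma> p"
proof -
  have 1: "\<rho> (s \<alpha>) (\<gamma> (s' \<beta>)) p = \<rho> (t \<alpha>) (\<gamma> (t' \<beta>)) p"
    if "\<And>\<zeta>. \<zeta> \<in> dual A \<Longrightarrow> s \<zeta> \<in> S \<and> t \<zeta> \<in> S \<and> agree_near p (s \<zeta>) (t \<zeta>)"
      "\<And>\<zeta>. \<zeta> \<in> dual A \<Longrightarrow> s' \<zeta> \<in> S \<and> t' \<zeta> \<in> S \<and> agree_near p (s' \<zeta>) (t' \<zeta>)"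
      "\<alpha> \<in> dual A" "\<beta> \<in> dual A" "\<gamma> \<in> dual A" for s t s' t' \<alpha> \<beta> \<gamma>
  proof -
    have "\<rho> (s \<alpha>) (\<gamma> (s' \<beta>)) p = \<rho> (s \<alpha>) (\<gamma> (t' \<beta>)) p"
    proof (rule anchor_cong_near)
      show "\<forall>\<^sub>F q in nhds p. \<gamma> (s' \<beta>) q = \<gamma> (t' \<beta>) q"
        using that(2)[OF that(4)] that(5) by (auto simp: agree_near_def elim: eventually_mono)
    qed (use that dual_ring in blast)+
    also have "\<dots> = \<rho> (t \<alpha>) (\<gamma> (t' \<beta>)) p"
      using that anchor_agree_near by blast
    finally show ?thesis .
  qed
  have 2: "\<gamma> (br (s \<alpha>) (s' \<beta>)) p = \<gamma> (br (t \<alpha>) (t' \<beta>)) p"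
    if "\<And>\<zeta>. \<zeta> \<in> dual A \<Longrightarrow> s \<zeta> \<in> S \<and> t \<zeta> \<in> S \<and> agree_near p (s \<zeta>) (t \<zeta>)"
      "\<And>\<zeta>. \<zeta> \<in> dual A \<Longrightarrow> s' \<zeta> \<in> S \<and> t' \<zeta> \<in> S \<and> agree_near p (s' \<zeta>) (t' \<zeta>)"
      "\<alpha> \<in> dual A" "\<beta> \<in> dual A" "\<gamma> \<in> dual A" for s t s' t' \<alpha> \<beta> \<gamma>
    by (rule bracket_agree_near2) (use that in blast)+
  have "koszul s s' \<alpha> \<beta> \<gamma> p = koszul t t' \<alpha> \<beta> \<gamma> p"
    if "\<alpha> \<in> dual A" "\<beta> \<in> dual A" "\<gamma> \<in> dual A" for \<alpha> \<beta> \<gamma>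
    unfolding koszul_def
    by (simp add: 1[of s t s' t', OF assms(1,2) that] 1[of s' t' s t, OF assms(2,1) that]
        2[of s t s' t', OF assms(1,2) that] 2[of s' t' s t, OF assms(2,1) that])
  from this[of \<alpha> \<beta> \<gamma>] this[of \<beta> \<gamma> \<alpha>] this[of \<gamma> \<alpha> \<beta>] assms(3-5)
  show ?thesis by (simp add: schouten_form_def)
qed

definition contract_list :: "('s \<times> 's) list \<Rightarrow> ('s \<Rightarrow> 'a \<Rightarrow> real) \<Rightarrow> 's" where
  "contract_list xs \<alpha> = (\<Sum>x\<leftarrow>xs. contract x \<alpha>)"

lemma contract_list_section: "set xs \<subseteq> S \<times> S \<Longrightarrow> \<alpha> \<in> dual A \<Longrightarrow> contract_list xs \<alpha> \<in> S"
  by (induction xs) (auto simp: contract_list_def section_0 intro!: section_add contract_section)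

lemma dual_contract_list:
  "set xs \<subseteq> S \<times> S \<Longrightarrow> \<alpha> \<in> dual A \<Longrightarrow> \<beta> \<in> dual A \<Longrightarrow>
    \<beta> (contract_list xs \<alpha>) q = (\<Sum>(a, b)\<leftarrow>xs. wedge A a b \<alpha> \<beta> q)"
proof (induction xs)
  case (Cons x xs)
  have "contract_list (x # xs) \<alpha> = contract x \<alpha> + contract_list xs \<alpha>" by (simp add: contract_list_def)
  with Cons show ?case
    by (cases x) (simp add: dual_add[of \<beta>] contract_list_section contract_section dual_contract)
qed (simp add: contract_list_def dual_0[of \<beta>])

lemma sum_schouten_form_contract:
  assumes "set xs \<subseteq> S \<times> S" "\<alpha> \<in> dual A" "\<beta> \<in> dual A" "\<gamma> \<in> dual A"
    "\<And>\<zeta>. \<zeta> \<in> dual A \<Longrightarrow> s \<zeta> \<in> S"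
  shows "(\<Sum>x\<leftarrow>xs. schouten_form (contract x) s \<alpha> \<beta> \<gamma> p) = schouten_form (contract_list xs) s \<alpha> \<beta> \<gamma> p"
  using assms(1)
proof (induction xs)
  case Nil
  have "contract_list [] = (\<lambda>_. 0)" by (auto simp: contract_list_def)
  then show ?case using assms(2-5) by (simp add: schouten_form_0)
next
  case (Cons x xs)
  have "contract_list (x # xs) = (\<lambda>\<alpha>. contract x \<alpha> + contract_list xs \<alpha>)" by (auto simp: contract_list_def)
  with Cons assms(2-5) show ?case
    by (simp add: schouten_form_add contract_section contract_list_section)
qed

lemma sum_schouten_wedge:
  assumes "set xs \<subseteq> S \<times> S" "set ys \<subseteq> S \<times> S" "\<alpha> \<in> dual A" "\<beta> \<in> dual A" "\<gamma> \<in> dual A"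
  shows "(\<Sum>x\<leftarrow>xs. \<Sum>y\<leftarrow>ys. schouten_wedge A x y \<alpha> \<beta> \<gamma> p)
    = schouten_form (contract_list xs) (contract_list ys) \<alpha> \<beta> \<gamma> p"
proof -
  have "(\<Sum>y\<leftarrow>ys. schouten_wedge A x y \<alpha> \<beta> \<gamma> p) = schouten_form (contract x) (contract_list ys) \<alpha> \<beta> \<gamma> p"
    if "x \<in> set xs" for x
  proof -
    have x: "x \<in> S \<times> S" using that assms(1) by blast
    have "(\<Sum>y\<leftarrow>ys. schouten_wedge A x y \<alpha> \<beta> \<gamma> p) = (\<Sum>y\<leftarrow>ys. schouten_form (contract y) (contract x) \<alpha> \<beta> \<gamma> p)"
    proof (intro arg_cong[of _ _ sum_list] map_cong refl)
      fix y assume "y \<in> set ys"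
      then have "y \<in> S \<times> S" using assms(2) by blast
      with x assms(3-5) show "schouten_wedge A x y \<alpha> \<beta> \<gamma> p = schouten_form (contract y) (contract x) \<alpha> \<beta> \<gamma> p"
        by (cases x, cases y) (simp add: schouten_wedge_eq_form schouten_form_commute)
    qed
    also have "\<dots> = schouten_form (contract_list ys) (contract x) \<alpha> \<beta> \<gamma> p"
      using assms x by (intro sum_schouten_form_contract) (auto simp: contract_section)
    finally show ?thesis by (simp add: schouten_form_commute)
  qed
  then have "(\<Sum>x\<leftarrow>xs. \<Sum>y\<leftarrow>ys. schouten_wedge A x y \<alpha> \<beta> \<gamma> p)
      = (\<Sum>x\<leftarrow>xs. schouten_form (contract x) (contract_list ys) \<alpha> \<beta> \<gamma> p)"
    by (intro arg_cong[of _ _ sum_list] map_cong) auto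
  also have "\<dots> = schouten_form (contract_list xs) (contract_list ys) \<alpha> \<beta> \<gamma> p"
    using assms by (intro sum_schouten_form_contract) (auto simp: contract_list_section)
  finally show ?thesis .
qed

text \<open>
  A lift of \<open>\<alpha> \<mapsto> P \<alpha>\<close> from functionals on covectors to sections.
\<close>

definition is_sharp :: "('a, 's) bivector \<Rightarrow> (('s \<Rightarrow> 'a \<Rightarrow> real) \<Rightarrow> 's) \<Rightarrow> bool" where
  "is_sharp P sh \<longleftrightarrow> (\<forall>\<alpha>\<in>dual A. sh \<alpha> \<in> S \<and> (\<forall>\<beta>\<in>dual A. \<beta> (sh \<alpha>) = P \<alpha> \<beta>))"

lemma is_sharpD:
  assumes "is_sharp P sh" "\<alpha> \<in> dual A"
  shows "sh \<alpha> \<in> S" "\<beta> \<in> dual A \<Longrightarrow> \<beta> (sh \<alpha>) = P \<alpha> \<beta>"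
  using assms by (auto simp: is_sharp_def)

lemma decomposition_sharp:
  assumes "is_sharp P sh" "decomposition_near A P p xs" "\<alpha> \<in> dual A"
  shows "sh \<alpha> \<in> S \<and> contract_list xs \<alpha> \<in> S \<and> agree_near p (sh \<alpha>) (contract_list xs \<alpha>)"
proof -
  have xs: "set xs \<subseteq> S \<times> S" and
    ev: "\<forall>\<^sub>F q in nhds p. \<forall>\<alpha>\<in>dual A. \<forall>\<beta>\<in>dual A. P \<alpha> \<beta> q = (\<Sum>(a, b)\<leftarrow>xs. wedge A a b \<alpha> \<beta> q)"
    using assms(2) by (auto simp: decomposition_near_def)
  show ?thesis
    unfolding agree_near_def using ev
    by (auto simp: is_sharpD[OF assms(1,3)] dual_contract_list[OF xs] assms(3) contract_list_section[OF xs]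
        elim!: eventually_mono)
qed

end

text \<open>
  Near every point there are sections \<open>e\<close> and covectors \<open>\<epsilon>\<close>, forming dual frames in the sense that
  \<open>s = \<Sum> \<epsilon>(s) e\<close> as far as covectors can tell.
\<close>

locale framed_algebroid = local_algebroid A
  for A :: "('a::topological_space, 's::ab_group_add) lie_algebroid" +
  assumes local_frame: "\<exists>fs. set fs \<subseteq> sections A \<times> dual A \<and>
      (\<forall>\<^sub>F q in nhds p. \<forall>s\<in>sections A. \<forall>\<xi>\<in>dual A. \<xi> s q = (\<Sum>(e, \<epsilon>)\<leftarrow>fs. \<epsilon> s q * \<xi> e q))"
begin

text \<open>
  Expanding the section \<open>sh \<alpha>\<close> in the frame gives \<open>P(\<alpha>, \<beta>) = \<Sum> P(\<alpha>, \<epsilon>) \<beta>(e)\<close>. Skew-symmetrizing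
  this yields \<open>P = \<Sum> (sh \<epsilon> / 2) \<and> e\<close>.
\<close>

lemma decomposition_exists:
  assumes "P \<in> bivectors A" "is_sharp P sh"
  shows "\<exists>xs. decomposition_near A P p xs"
proof -
  obtain fs where fs: "set fs \<subseteq> S \<times> dual A" and
    frame: "\<forall>\<^sub>F q in nhds p. \<forall>s\<in>S. \<forall>\<xi>\<in>dual A. \<xi> s q = (\<Sum>(e, \<epsilon>)\<leftarrow>fs. \<epsilon> s q * \<xi> e q)"
    using local_frame by blast
  let ?h = "\<lambda>_. 1 / 2 :: real"
  define xs where "xs = map (\<lambda>(e, \<epsilon>). (smul A ?h (sh \<epsilon>), e)) fs"
  have skew: "P \<alpha> \<beta> = - P \<beta> \<alpha>" if "\<alpha> \<in> dual A" "\<beta> \<in> dual A" for \<alpha> \<beta>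
    using assms(1) that unfolding bivectors_def by (rule alternating_mapsD)
  have "P \<alpha> \<beta> q = (\<Sum>(a, b)\<leftarrow>xs. wedge A a b \<alpha> \<beta> q)"
    if q: "\<forall>s\<in>S. \<forall>\<xi>\<in>dual A. \<xi> s q = (\<Sum>(e, \<epsilon>)\<leftarrow>fs. \<epsilon> s q * \<xi> e q)" and \<alpha>: "\<alpha> \<in> dual A" and \<beta>: "\<beta> \<in> dual A" for \<alpha> \<beta> q
  proof -
    have exp: "P \<alpha> \<beta> q = (\<Sum>(e, \<epsilon>)\<leftarrow>fs. - \<alpha> (sh \<epsilon>) q * \<beta> e q)" if "\<alpha> \<in> dual A" "\<beta> \<in> dual A" for \<alpha> \<beta>
    proof -
      have "P \<alpha> \<beta> q = (\<Sum>(e, \<epsilon>)\<leftarrow>fs. \<epsilon> (sh \<alpha>) q * \<beta> e q)"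
        using q is_sharpD[OF assms(2)] that by metis
      also have "\<dots> = (\<Sum>(e, \<epsilon>)\<leftarrow>fs. - \<alpha> (sh \<epsilon>) q * \<beta> e q)"
      proof (intro arg_cong[of _ _ sum_list] map_cong refl, clarify)
        fix e \<epsilon> assume "(e, \<epsilon>) \<in> set fs"
        with fs have "\<epsilon> \<in> dual A" by blast
        then show "\<epsilon> (sh \<alpha>) q * \<beta> e q = - \<alpha> (sh \<epsilon>) q * \<beta> e q"
          using is_sharpD[OF assms(2)] that skew[of \<alpha> \<epsilon>] by simp
      qed
      finally show ?thesis .
    qed
    have eq: "(\<beta> (sh (snd x)) q * \<alpha> (fst x) q - \<alpha> (sh (snd x)) q * \<beta> (fst x) q) / 2
        = wedge A (smul A ?h (sh (snd x))) (fst x) \<alpha> \<beta> q" if "x \<in> set fs" for x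
    proof -
      have "snd x \<in> dual A" using fs that by auto
      from is_sharpD(1)[OF assms(2) this] show ?thesis
        by (simp add: wedge_def \<alpha> \<beta> dual_smul[OF \<alpha>] dual_smul[OF \<beta>] ring_const field_simps)
    qed
    have "P \<alpha> \<beta> q = (P \<alpha> \<beta> q - P \<beta> \<alpha> q) / 2"
      using skew[OF that(2,3)] by simp
    also have "\<dots> = (\<Sum>(e, \<epsilon>)\<leftarrow>fs. (\<beta> (sh \<epsilon>) q * \<alpha> e q - \<alpha> (sh \<epsilon>) q * \<beta> e q) / 2)"
      unfolding exp[OF that(2,3)] exp[OF that(3,2)]
      by (induction fs) (auto simp: field_simps)
    also have "\<dots> = (\<Sum>(a, b)\<leftarrow>xs. wedge A a b \<alpha> \<beta> q)"
      by (auto simp: xs_def o_def split_beta eq intro!: arg_cong[of _ _ sum_list])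
    finally show ?thesis .
  qed
  then have "\<forall>\<^sub>F q in nhds p. \<forall>\<alpha>\<in>dual A. \<forall>\<beta>\<in>dual A. P \<alpha> \<beta> q = (\<Sum>(a, b)\<leftarrow>xs. wedge A a b \<alpha> \<beta> q)"
    using frame by (auto elim!: eventually_mono)
  moreover have "set xs \<subseteq> S \<times> S"
    using fs is_sharpD(1)[OF assms(2)] by (auto simp: xs_def intro!: section_smul ring_const)
  ultimately show ?thesis unfolding decomposition_near_def by blast
qed

lemma sum_schouten_wedge_eq_form:
  assumes "is_sharp P sh" "is_sharp R sh'" "decomposition_near A P p xs" "decomposition_near A R p ys"
    "\<alpha> \<in> dual A" "\<beta> \<in> dual A" "\<gamma> \<in> dual A"
  shows "(\<Sum>x\<leftarrow>xs. \<Sum>y\<leftarrow>ys. schouten_wedge A x y \<alpha> \<beta> \<gamma> p) = schouten_form sh sh' \<alpha> \<beta> \<gamma> p"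
proof -
  have "schouten_form sh sh' \<alpha> \<beta> \<gamma> p = schouten_form (contract_list xs) (contract_list ys) \<alpha> \<beta> \<gamma> p"
    by (rule schouten_form_cong_near[OF decomposition_sharp decomposition_sharp]) (use assms in auto)
  then show ?thesis
    using sum_schouten_wedge[of xs ys] assms by (simp add: decomposition_near_def)
qed

text \<open>
  Any two decompositions near \<open>p\<close> give the same number, so the description in the definition of the
  Schouten bracket has exactly one solution.
\<close>

lemma schouten_eq_form:
  assumes "P \<in> bivectors A" "R \<in> bivectors A" "is_sharp P sh" "is_sharp R sh'"
    "\<alpha> \<in> dual A" "\<beta> \<in> dual A" "\<gamma> \<in> dual A"
  shows "schouten A P R \<alpha> \<beta> \<gamma> = schouten_form sh sh' \<alpha> \<beta> \<gamma>"
proof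
  fix p
  have "(THE r. \<exists>xs ys. decomposition_near A P p xs \<and> decomposition_near A R p ys \<and>
      r = (\<Sum>x\<leftarrow>xs. \<Sum>y\<leftarrow>ys. schouten_wedge A x y \<alpha> \<beta> \<gamma> p)) = schouten_form sh sh' \<alpha> \<beta> \<gamma> p"
    using decomposition_exists[OF assms(1,3)] decomposition_exists[OF assms(2,4)]
      sum_schouten_wedge_eq_form[OF assms(3,4) _ _ assms(5-7)]
    by (intro the_equality) (metis, blast)
  then show "schouten A P R \<alpha> \<beta> \<gamma> p = schouten_form sh sh' \<alpha> \<beta> \<gamma> p"
    using assms(5-7) by (simp add: schouten_def)
qed

lemma dual_closed_add: "\<alpha> \<in> dual A \<Longrightarrow> \<beta> \<in> dual A \<Longrightarrow> \<alpha> + \<beta> \<in> dual A"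
  by (auto simp: dual_def linear_maps_def ring_add algebra_simps)

lemma dual_closed_fmult: "f \<in> C \<Longrightarrow> \<alpha> \<in> dual A \<Longrightarrow> fmult f \<alpha> \<in> dual A"
  by (auto simp: dual_def linear_maps_def ring_mult fmult_def algebra_simps)

text \<open>
  These properties are hidden in the formula with the sharp maps, which differentiates the covectors,
  but evident for the triple products of a decomposition.
\<close>

lemma schouten_trilinear:
  assumes "P \<in> bivectors A" "R \<in> bivectors A" "is_sharp P sh" "is_sharp R sh'"
    "\<alpha> \<in> dual A" "\<beta> \<in> dual A" "\<gamma> \<in> dual A"
  shows "schouten A P R \<beta> \<alpha> \<gamma> = - schouten A P R \<alpha> \<beta> \<gamma>"
    and "schouten A P R \<alpha> \<gamma> \<beta> = - schouten A P R \<alpha> \<beta> \<gamma>"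
    and "\<alpha>' \<in> dual A \<Longrightarrow> f \<in> C \<Longrightarrow> schouten A P R (\<alpha> + fmult f \<alpha>') \<beta> \<gamma> =
      schouten A P R \<alpha> \<beta> \<gamma> + f * schouten A P R \<alpha>' \<beta> \<gamma>"
proof -
  have sum_uminus: "(\<Sum>x\<leftarrow>xs. \<Sum>y\<leftarrow>ys. - F x y) = - (\<Sum>x\<leftarrow>xs. \<Sum>y\<leftarrow>ys. F x y)" for xs ys and F :: "_ \<Rightarrow> _ \<Rightarrow> real"
    by (simp add: uminus_sum_list_map o_def)
  have sum_lin: "(\<Sum>x\<leftarrow>xs. \<Sum>y\<leftarrow>ys. F x y + c * G x y) =
      (\<Sum>x\<leftarrow>xs. \<Sum>y\<leftarrow>ys. F x y) + c * (\<Sum>x\<leftarrow>xs. \<Sum>y\<leftarrow>ys. G x y)" for xs ys c and F G :: "_ \<Rightarrow> _ \<Rightarrow> real"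
    by (simp add: sum_list_addf sum_list_const_mult)
  have sw: "\<exists>xs ys. \<forall>\<alpha>\<in>dual A. \<forall>\<beta>\<in>dual A. \<forall>\<gamma>\<in>dual A. schouten A P R \<alpha> \<beta> \<gamma> p =
     (\<Sum>x\<leftarrow>xs. \<Sum>y\<leftarrow>ys. schouten_wedge A x y \<alpha> \<beta> \<gamma> p)" for p
    using decomposition_exists[OF assms(1,3)] decomposition_exists[OF assms(2,4)]
      sum_schouten_wedge_eq_form[OF assms(3,4)] schouten_eq_form[OF assms(1-4)] by metis
  have w3: "wedge3 A a b c \<beta> \<alpha> \<gamma> p = - wedge3 A a b c \<alpha> \<beta> \<gamma> p"
    "wedge3 A a b c \<alpha> \<gamma> \<beta> p = - wedge3 A a b c \<alpha> \<beta> \<gamma> p"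
    "\<alpha>' \<in> dual A \<Longrightarrow> f \<in> C \<Longrightarrow> wedge3 A a b c (\<alpha> + fmult f \<alpha>') \<beta> \<gamma> p =
      wedge3 A a b c \<alpha> \<beta> \<gamma> p + f p * wedge3 A a b c \<alpha>' \<beta> \<gamma> p" for a b c p f \<alpha>'
    using assms(5-7) dual_closed_add[OF _ dual_closed_fmult, of \<alpha> f \<alpha>']
    by (simp_all add: wedge3_def wedge_def fmult_def algebra_simps)
  have w: "schouten_wedge A x y \<beta> \<alpha> \<gamma> p = - schouten_wedge A x y \<alpha> \<beta> \<gamma> p"
    "schouten_wedge A x y \<alpha> \<gamma> \<beta> p = - schouten_wedge A x y \<alpha> \<beta> \<gamma> p"
    "\<alpha>' \<in> dual A \<Longrightarrow> f \<in> C \<Longrightarrow> schouten_wedge A x y (\<alpha> + fmult f \<alpha>') \<beta> \<gamma> p =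
      schouten_wedge A x y \<alpha> \<beta> \<gamma> p + f p * schouten_wedge A x y \<alpha>' \<beta> \<gamma> p" for x y p f \<alpha>'
    by (cases x; cases y; simp add: schouten_wedge_def w3 algebra_simps)+
  show "schouten A P R \<beta> \<alpha> \<gamma> = - schouten A P R \<alpha> \<beta> \<gamma>"
  proof
    fix p obtain xs ys where "\<forall>\<alpha>\<in>dual A. \<forall>\<beta>\<in>dual A. \<forall>\<gamma>\<in>dual A. schouten A P R \<alpha> \<beta> \<gamma> p =
     (\<Sum>x\<leftarrow>xs. \<Sum>y\<leftarrow>ys. schouten_wedge A x y \<alpha> \<beta> \<gamma> p)" using sw by blast
    with assms(5-7) show "schouten A P R \<beta> \<alpha> \<gamma> p = (- schouten A P R \<alpha> \<beta> \<gamma>) p"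
      by (simp add: w(1) sum_uminus)
  qed
  show "schouten A P R \<alpha> \<gamma> \<beta> = - schouten A P R \<alpha> \<beta> \<gamma>"
  proof
    fix p obtain xs ys where "\<forall>\<alpha>\<in>dual A. \<forall>\<beta>\<in>dual A. \<forall>\<gamma>\<in>dual A. schouten A P R \<alpha> \<beta> \<gamma> p =
     (\<Sum>x\<leftarrow>xs. \<Sum>y\<leftarrow>ys. schouten_wedge A x y \<alpha> \<beta> \<gamma> p)" using sw by blast
    with assms(5-7) show "schouten A P R \<alpha> \<gamma> \<beta> p = (- schouten A P R \<alpha> \<beta> \<gamma>) p"
      by (simp add: w(2) sum_uminus)
  qed
  assume lin: "\<alpha>' \<in> dual A" "f \<in> C"
  show "schouten A P R (\<alpha> + fmult f \<alpha>') \<beta> \<gamma> = schouten A P R \<alpha> \<beta> \<gamma> + f * schouten A P R \<alpha>' \<beta> \<gamma>"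
  proof
    fix p obtain xs ys where "\<forall>\<alpha>\<in>dual A. \<forall>\<beta>\<in>dual A. \<forall>\<gamma>\<in>dual A. schouten A P R \<alpha> \<beta> \<gamma> p =
     (\<Sum>x\<leftarrow>xs. \<Sum>y\<leftarrow>ys. schouten_wedge A x y \<alpha> \<beta> \<gamma> p)" using sw by blast
    with assms(5-7) lin show "schouten A P R (\<alpha> + fmult f \<alpha>') \<beta> \<gamma> p = (schouten A P R \<alpha> \<beta> \<gamma> + f * schouten A P R \<alpha>' \<beta> \<gamma>) p"
      by (simp add: w(3) sum_lin dual_closed_add dual_closed_fmult)
  qed
qed

text \<open>
  An alternating trilinear map on \<open>K + C \<tau>\<close> is determined by its values on triples from \<open>K\<close> and on
  triples of two elements of \<open>K\<close> and \<open>\<tau>\<close>, since a repeated \<open>\<tau>\<close> gives 0.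
\<close>

lemma schouten_eq_0I:
  assumes "P \<in> bivectors A" "R \<in> bivectors A" "is_sharp P sh" "is_sharp R sh'"
    and "K \<subseteq> dual A" "\<tau> \<in> dual A"
    and span: "\<And>\<xi>. \<xi> \<in> dual A \<Longrightarrow> \<exists>\<kappa>\<in>K. \<exists>f\<in>C. \<xi> = \<kappa> + fmult f \<tau>"
    and K3: "\<And>\<kappa>1 \<kappa>2 \<kappa>3. \<kappa>1 \<in> K \<Longrightarrow> \<kappa>2 \<in> K \<Longrightarrow> \<kappa>3 \<in> K \<Longrightarrow> schouten A P R \<kappa>1 \<kappa>2 \<kappa>3 = 0"
    and K2: "\<And>\<kappa>1 \<kappa>2. \<kappa>1 \<in> K \<Longrightarrow> \<kappa>2 \<in> K \<Longrightarrow> schouten A P R \<kappa>1 \<kappa>2 \<tau> = 0"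
  shows "schouten A P R = 0"
proof -
  let ?G = "schouten A P R"
  note tri = schouten_trilinear[OF assms(1-4)]
  have K: "\<kappa> \<in> dual A" if "\<kappa> \<in> K" for \<kappa> using that assms(5) by blast
  have expand: "?G \<xi> \<beta> \<gamma> = 0"
    if \<xi>: "\<xi> \<in> dual A" and \<beta>\<gamma>: "\<beta> \<in> dual A" "\<gamma> \<in> dual A"
      and 0: "\<And>\<kappa>. \<kappa> \<in> K \<Longrightarrow> ?G \<kappa> \<beta> \<gamma> = 0" "?G \<tau> \<beta> \<gamma> = 0" for \<xi> \<beta> \<gamma>
  proof -
    obtain \<kappa> f where "\<kappa> \<in> K" "f \<in> C" "\<xi> = \<kappa> + fmult f \<tau>" using span[OF \<xi>] by blast
    then show ?thesis using tri(3)[OF K \<beta>\<gamma> assms(6)] 0 by simp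
  qed
  have swap12: "?G \<alpha> \<beta> \<gamma> = 0" if "?G \<beta> \<alpha> \<gamma> = 0" "\<alpha> \<in> dual A" "\<beta> \<in> dual A" "\<gamma> \<in> dual A" for \<alpha> \<beta> \<gamma>
    using tri(1)[OF that(3,2,4)] that(1) by simp
  have swap23: "?G \<alpha> \<beta> \<gamma> = 0" if "?G \<alpha> \<gamma> \<beta> = 0" "\<alpha> \<in> dual A" "\<beta> \<in> dual A" "\<gamma> \<in> dual A" for \<alpha> \<beta> \<gamma>
    using tri(2)[OF that(2,4,3)] that(1) by simp
  have \<tau>\<tau>: "?G \<tau> \<tau> \<gamma> = 0" if "\<gamma> \<in> dual A" for \<gamma>
  proof
    fix p show "?G \<tau> \<tau> \<gamma> p = 0 p"
      using fun_cong[OF tri(1)[OF assms(6,6) that], of p] by simp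
  qed
  have \<tau>\<kappa>\<kappa>: "?G \<tau> \<kappa>1 \<kappa>2 = 0" if "\<kappa>1 \<in> K" "\<kappa>2 \<in> K" for \<kappa>1 \<kappa>2
    by (rule swap12[OF swap23[OF K2[OF that]]]) (simp_all add: that K assms(6))
  have \<tau>\<kappa>: "?G \<tau> \<kappa> \<zeta> = 0" if "\<kappa> \<in> K" "\<zeta> \<in> dual A" for \<kappa> \<zeta>
  proof -
    have \<kappa>\<tau>\<kappa>: "?G \<kappa>' \<tau> \<kappa> = 0" if "\<kappa>' \<in> K" for \<kappa>'
      by (rule swap12[OF \<tau>\<kappa>\<kappa>]) (simp_all add: that \<open>\<kappa> \<in> K\<close> K assms(6))
    have "?G \<zeta> \<tau> \<kappa> = 0"
      by (rule expand) (simp_all add: that \<kappa>\<tau>\<kappa> \<tau>\<tau> K assms(6))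
    from swap23[OF swap12[OF this]] show ?thesis by (simp add: that K assms(6))
  qed
  have \<kappa>\<kappa>: "?G \<kappa>1 \<kappa>2 \<zeta> = 0" if "\<kappa>1 \<in> K" "\<kappa>2 \<in> K" "\<zeta> \<in> dual A" for \<kappa>1 \<kappa>2 \<zeta>
  proof -
    have "?G \<zeta> \<kappa>1 \<kappa>2 = 0"
      by (rule expand) (simp_all add: that K3 \<tau>\<kappa>\<kappa> K)
    from swap23[OF swap12[OF this]] show ?thesis by (simp add: that K)
  qed
  have \<kappa>: "?G \<kappa> \<eta> \<zeta> = 0" if "\<kappa> \<in> K" "\<eta> \<in> dual A" "\<zeta> \<in> dual A" for \<kappa> \<eta> \<zeta>
    by (rule swap12[OF expand]) (simp_all add: that \<kappa>\<kappa> \<tau>\<kappa> K)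
  have \<tau>: "?G \<tau> \<eta> \<zeta> = 0" if "\<eta> \<in> dual A" "\<zeta> \<in> dual A" for \<eta> \<zeta>
    by (rule swap12[OF expand]) (simp_all add: that \<kappa> \<tau>\<tau> assms(6))
  show ?thesis
  proof (intro ext)
    fix \<xi> \<eta> \<zeta> p
    have "?G \<xi> \<eta> \<zeta> = 0"
    proof (cases "\<xi> \<in> dual A \<and> \<eta> \<in> dual A \<and> \<zeta> \<in> dual A")
      case True
      then show ?thesis by (simp add: expand \<kappa> \<tau>)
    next
      case False
      then show ?thesis by (auto simp: schouten_def fun_eq_iff)
    qed
    then show "?G \<xi> \<eta> \<zeta> p = 0 \<xi> \<eta> \<zeta> p" by simp
  qed
qed

end


section \<open>Smooth functions and vector fields on a manifold\<close>

lemma smooth_on_subset: "smooth_on S f \<Longrightarrow> T \<subseteq> S \<Longrightarrow> smooth_on T f"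
  unfolding smooth_on_def using Ck_on_subset by blast

lemma smooth_on_const: "smooth_on S (\<lambda>_. c)"
  by (simp add: smooth_on_def Ck_on_const)

lemma smooth_on_mult:
  fixes f g :: "'b::real_normed_vector \<Rightarrow> real"
  shows "open S \<Longrightarrow> smooth_on S f \<Longrightarrow> smooth_on S g \<Longrightarrow> smooth_on S (\<lambda>x. f x * g x)"
  unfolding smooth_on_def using Ck_on_mult by blast

lemma smooth_on_derivative:
  assumes "smooth_on S f"
  shows "smooth_on S (\<lambda>x. frechet_derivative f (at x) v)"
  unfolding smooth_on_def
proof
  fix k show "Ck_on k S (\<lambda>x. frechet_derivative f (at x) v)"
    by (rule Ck_on_SucD(2)) (use assms in \<open>simp add: smooth_on_def del: Ck_on.simps\<close>)
qed

lemma smooth_on_has_derivative: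
  assumes "smooth_on S f" "x \<in> S"
  shows "(f has_derivative frechet_derivative f (at x)) (at x)"
  by (rule Ck_on_SucD(1)[where k = 0]) (use assms in \<open>simp_all add: smooth_on_def del: Ck_on.simps\<close>)

lemma sum_fun_apply: "(\<Sum>i\<in>I. F i) x = (\<Sum>i\<in>I. F i x)"
  by (induction I rule: infinite_finite_induct) auto

lemma vector_fieldsD:
  assumes "X \<in> vector_fields \<A>"
  shows "f \<in> smooth_functions \<A> \<Longrightarrow> X f \<in> smooth_functions \<A>"
    and "f \<in> smooth_functions \<A> \<Longrightarrow> g \<in> smooth_functions \<A> \<Longrightarrow> X (f + g) = X f + X g"
    and "f \<in> smooth_functions \<A> \<Longrightarrow> X (\<lambda>p. c * f p) = (\<lambda>p. c * X f p)"
    and "f \<in> smooth_functions \<A> \<Longrightarrow> g \<in> smooth_functions \<A> \<Longrightarrow> X (f * g) = f * X g + X f * g"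
    and "f \<notin> smooth_functions \<A> \<Longrightarrow> X f = 0"
  using assms unfolding vector_fields_def by blast+

lemma TM_simps [simp]:
  "base_ring (TM \<A>) = smooth_functions \<A>" "sections (TM \<A>) = vector_fields \<A>"
  "smul (TM \<A>) = fmult" "anchor (TM \<A>) = (\<lambda>X. X)" "bracket (TM \<A>) = lie_bracket"
  by (simp_all add: TM_def)

locale smooth_manifold =
  fixes \<A> :: "('a::{t2_space, second_countable_topology}, 'b::euclidean_space) chart set"
  assumes atlas: "smooth_atlas \<A>"
begin

abbreviation "SF \<equiv> smooth_functions \<A>"
abbreviation "VF \<equiv> vector_fields \<A>"

lemma chart:
  assumes "(U, \<phi>) \<in> \<A>"
  shows chart_domain_open: "open U" and chart_range_open: "open (\<phi> ` U)"
    and chart_homeomorphism: "homeomorphism U (\<phi> ` U) \<phi> (inv_into U \<phi>)"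
  using atlas assms unfolding smooth_atlas_def is_chart_def by auto

lemma chart_inv: "(U, \<phi>) \<in> \<A> \<Longrightarrow> q \<in> U \<Longrightarrow> inv_into U \<phi> (\<phi> q) = q"
  using chart_homeomorphism homeomorphism_apply1 by fastforce

lemma chart_inv_in: "(U, \<phi>) \<in> \<A> \<Longrightarrow> y \<in> \<phi> ` U \<Longrightarrow> inv_into U \<phi> y \<in> U"
  by (rule inv_into_into)

lemma chart_inv2: "y \<in> \<phi> ` U \<Longrightarrow> \<phi> (inv_into U \<phi> y) = y"
  by (rule f_inv_into_f)

lemma chart_image_open:
  assumes "(U, \<phi>) \<in> \<A>" "open W"
  shows "open (\<phi> ` (U \<inter> W))"
proof -
  have "openin (top_of_set (\<phi> ` U)) (\<phi> ` (U \<inter> W))"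
    using homeomorphism_imp_open_map[OF chart_homeomorphism[OF assms(1)]] assms(2)
    by (simp add: openin_open_Int)
  then show ?thesis using chart_range_open[OF assms(1)] openin_open_eq by blast
qed

lemma chart_vimage_open:
  assumes "(U, \<phi>) \<in> \<A>" "open O'"
  shows "open {q \<in> U. \<phi> q \<in> O'}"
proof -
  have "continuous_on U \<phi>" using chart_homeomorphism[OF assms(1)] by (simp add: homeomorphism_def)
  from continuous_open_preimage[OF this chart_domain_open[OF assms(1)] assms(2)]
  show ?thesis by (simp add: vimage_def Int_def conj_commute)
qed

lemma charts_cover: "\<exists>U \<phi>. (U, \<phi>) \<in> \<A> \<and> p \<in> U"
proof -
  have "p \<in> \<Union> (fst ` \<A>)" using atlas by (simp add: smooth_atlas_def)
  then show ?thesis by auto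
qed

lemma transition_smooth:
  "(U, \<phi>) \<in> \<A> \<Longrightarrow> (V, \<psi>) \<in> \<A> \<Longrightarrow> smooth_on (\<phi> ` (U \<inter> V)) (\<lambda>y. \<psi> (inv_into U \<phi> y))"
  using atlas unfolding smooth_atlas_def o_def by fast

lemma smooth_functions_iff:
  "f \<in> SF \<longleftrightarrow> (\<forall>U \<phi>. (U, \<phi>) \<in> \<A> \<longrightarrow> smooth_on (\<phi> ` U) (\<lambda>y. f (inv_into U \<phi> y)))"
  unfolding smooth_functions_def o_def by auto

lemma SF_const: "(\<lambda>_. c) \<in> SF"
  by (simp add: smooth_functions_iff smooth_on_def Ck_on_const)

lemma SF_add: "f \<in> SF \<Longrightarrow> g \<in> SF \<Longrightarrow> f + g \<in> SF"
  by (auto simp: smooth_functions_iff smooth_on_def intro!: Ck_on_add chart_range_open)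

lemma SF_mult: "f \<in> SF \<Longrightarrow> g \<in> SF \<Longrightarrow> f * g \<in> SF"
  by (auto simp: smooth_functions_iff smooth_on_def intro!: Ck_on_mult chart_range_open)

lemma SF_0: "0 \<in> SF" and SF_1: "1 \<in> SF"
  using SF_const[of 0] SF_const[of 1] by (simp_all add: func_zero func_one)

lemma SF_sum: "(\<And>i. i \<in> I \<Longrightarrow> f i \<in> SF) \<Longrightarrow> (\<Sum>i\<in>I. f i) \<in> SF"
  by (induction I rule: infinite_finite_induct) (auto intro: SF_0 SF_add)

lemma SF_scale: "f \<in> SF \<Longrightarrow> (\<lambda>p. c * f p) \<in> SF"
  using SF_mult[OF SF_const[of c]] by (simp add: func_times)

lemma SF_uminus: "f \<in> SF \<Longrightarrow> - f \<in> SF"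
  using SF_scale[of f "-1"] by (simp add: fun_Compl_def)

lemma SF_minus: "f \<in> SF \<Longrightarrow> g \<in> SF \<Longrightarrow> f - g \<in> SF"
  using SF_add[OF _ SF_uminus, of f g] by simp

text \<open>
  Transport of \<open>u\<close> from the part of the chart lying over \<open>B\<close>, with value 0 elsewhere.
\<close>

definition extend ::
  "'a set \<Rightarrow> ('a \<Rightarrow> 'b) \<Rightarrow> 'b set \<Rightarrow> ('b \<Rightarrow> real) \<Rightarrow> 'a \<Rightarrow> real" where
  "extend U \<phi> B u = (\<lambda>q. if q \<in> U \<and> \<phi> q \<in> B then u (\<phi> q) else 0)"

text \<open>
  Compact sets are closed because \<open>M\<close> is Hausdorff, so \<open>M\<close> is covered by two open sets: the part
  of the chart over \<open>B\<close>, where smoothness is that of \<open>u\<close> composed with a change of coordinates, and the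
  complement of the preimage of \<open>K\<close>, where the function vanishes.
\<close>

lemma extend_smooth:
  fixes u :: "'b \<Rightarrow> real"
  assumes ch: "(U, \<phi>) \<in> \<A>" and B: "open B" "B \<subseteq> \<phi> ` U" and K: "compact K" "K \<subseteq> B"
    and u: "smooth_on B u" "\<And>y. y \<in> B \<Longrightarrow> y \<notin> K \<Longrightarrow> u y = 0"
  shows "extend U \<phi> B u \<in> SF"
  unfolding smooth_functions_iff smooth_on_def
proof (intro allI impI)
  fix V \<psi> k assume V: "(V, \<psi>) \<in> \<A>"
  let ?F = "\<lambda>y. extend U \<phi> B u (inv_into V \<psi> y)"
  show "Ck_on k (\<psi> ` V) ?F"
  proof (rule Ck_on_local)
    fix y assume y: "y \<in> \<psi> ` V"
    define q where "q = inv_into V \<psi> y"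
    have q: "q \<in> V" "\<psi> q = y" using y by (simp_all add: q_def chart_inv_in[OF V] chart_inv2)
    show "\<exists>T. open T \<and> y \<in> T \<and> Ck_on k T ?F"
    proof (cases "q \<in> U \<and> \<phi> q \<in> B")
      case True
      define W where "W = {q \<in> U. \<phi> q \<in> B}"
      define T where "T = \<psi> ` (V \<inter> W)"
      have T: "open T" unfolding T_def W_def by (rule chart_image_open[OF V chart_vimage_open[OF ch B(1)]])
      have inv: "inv_into V \<psi> z \<in> W" if "z \<in> T" for z
        using that by (auto simp: T_def chart_inv[OF V])
      have "T \<subseteq> \<psi> ` (V \<inter> U)" unfolding T_def W_def by auto
      then have sm: "Ck_on k T (\<lambda>y. \<phi> (inv_into V \<psi> y))"
        using transition_smooth[OF V ch] unfolding smooth_on_def by (blast intro: Ck_on_subset)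
      have "Ck_on k T (\<lambda>y. u (\<phi> (inv_into V \<psi> y)))"
        by (rule Ck_on_compose[OF T B(1) _ sm]) (use inv u(1) in \<open>auto simp: W_def smooth_on_def\<close>)
      then have "Ck_on k T ?F"
        by (rule Ck_on_cong[OF T]) (use inv in \<open>auto simp: W_def extend_def\<close>)
      moreover have "y \<in> T" using q True by (auto simp: T_def W_def)
      ultimately show ?thesis using T by blast
    next
      case False
      define K' where "K' = inv_into U \<phi> ` K"
      have K\<phi>: "K \<subseteq> \<phi> ` U" using K B by blast
      have "continuous_on K (inv_into U \<phi>)"
        using chart_homeomorphism[OF ch] K\<phi> by (auto simp: homeomorphism_def intro: continuous_on_subset)
      then have "closed K'" unfolding K'_def using compact_continuous_image compact_imp_closed K(1) by blast
      define T where "T = \<psi> ` (V \<inter> - K')"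
      have T: "open T" unfolding T_def using \<open>closed K'\<close> by (intro chart_image_open[OF V]) auto
      have inK': "\<phi> z \<in> K \<longleftrightarrow> z \<in> K'" if "z \<in> U" for z
        using that K\<phi> chart_inv[OF ch that] chart_inv2[of _ \<phi> U] unfolding K'_def by fastforce
      have "inv_into V \<psi> z \<notin> K'" if "z \<in> T" for z
        using that by (auto simp: T_def chart_inv[OF V])
      then have "?F z = 0" if "z \<in> T" for z
        using that inK' u(2) by (auto simp: extend_def)
      then have "Ck_on k T ?F" by (intro Ck_on_cong[OF T Ck_on_const[of k T 0]]) auto
      moreover have "q \<notin> K'"
      proof
        assume "q \<in> K'"
        then obtain y' where "y' \<in> K" "q = inv_into U \<phi> y'" by (auto simp: K'_def)
        then have "q \<in> U \<and> \<phi> q = y'" using K\<phi> chart_inv_in[OF ch, of y'] chart_inv2[of y' \<phi> U] by auto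
        with K(2) False \<open>y' \<in> K\<close> show False by auto
      qed
      then have "y \<in> T" using q by (auto simp: T_def)
      ultimately show ?thesis using T by blast
    qed
  qed
qed

text \<open>
  A coordinate ball with a cutoff \<open>b\<close> that is 1 on a smaller ball around \<open>p\<close>: after multiplication
  by \<open>b\<close>, every smooth function on the ball becomes a smooth function on the whole manifold.
\<close>

lemma coordinate_ball:
  assumes "open U0" "p \<in> U0"
  obtains U \<phi> r b where "(U, \<phi>) \<in> \<A>" "p \<in> U" "r > 0" "ball (\<phi> p) (3 * r) \<subseteq> \<phi> ` (U \<inter> U0)"
    "smooth_on UNIV b" "\<And>y. y \<in> ball (\<phi> p) r \<Longrightarrow> b y = (1::real)" "\<And>y. y \<notin> cball (\<phi> p) (2 * r) \<Longrightarrow> b y = 0"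
    "\<And>u. smooth_on (ball (\<phi> p) (3 * r)) u \<Longrightarrow> extend U \<phi> (ball (\<phi> p) (3 * r)) (\<lambda>y. b y * u y) \<in> SF"
proof -
  obtain U \<phi> where ch: "(U, \<phi>) \<in> \<A>" "p \<in> U" using charts_cover by blast
  have "open (\<phi> ` (U \<inter> U0))" "\<phi> p \<in> \<phi> ` (U \<inter> U0)" using chart_image_open ch assms by auto
  then obtain e where e: "e > 0" "ball (\<phi> p) e \<subseteq> \<phi> ` (U \<inter> U0)" using open_contains_ball by blast
  define r where "r = e / 3"
  have r: "r > 0" "3 * r = e" using e by (simp_all add: r_def)
  obtain b :: "'b \<Rightarrow> real" where b: "smooth_on UNIV b" "\<And>x. x \<in> ball (\<phi> p) r \<Longrightarrow> b x = 1"
    "\<And>x. x \<notin> cball (\<phi> p) (2 * r) \<Longrightarrow> b x = 0"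
    using exists_bump[OF r(1)] by blast
  have "extend U \<phi> (ball (\<phi> p) (3 * r)) (\<lambda>y. b y * u y) \<in> SF" if "smooth_on (ball (\<phi> p) (3 * r)) u" for u
  proof (rule extend_smooth[OF ch(1), where K = "cball (\<phi> p) (2 * r)"])
    show "ball (\<phi> p) (3 * r) \<subseteq> \<phi> ` U" using e(2) r(2) by auto
    show "cball (\<phi> p) (2 * r) \<subseteq> ball (\<phi> p) (3 * r)" using r(1) by auto
    show "smooth_on (ball (\<phi> p) (3 * r)) (\<lambda>y. b y * u y)"
      using that b(1) by (intro smooth_on_mult) (auto intro: smooth_on_subset)
  qed (auto simp: b(3) simp del: mem_cball)
  with ch r e b show thesis by (intro that[of U \<phi> r b]) auto
qed

lemma bump_function:
  assumes "open U" "p \<in> U"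
  shows "\<exists>h\<in>SF. h p = 1 \<and> (\<forall>q. q \<notin> U \<longrightarrow> h q = 0)"
proof -
  obtain V \<phi> r b where V: "(V, \<phi>) \<in> \<A>" "p \<in> V" "r > 0" "ball (\<phi> p) (3 * r) \<subseteq> \<phi> ` (V \<inter> U)"
    and "smooth_on UNIV b" and b: "\<And>y. y \<in> ball (\<phi> p) r \<Longrightarrow> b y = (1::real)"
    and "\<And>y. y \<notin> cball (\<phi> p) (2 * r) \<Longrightarrow> b y = 0"
    and ext: "\<And>u. smooth_on (ball (\<phi> p) (3 * r)) u \<Longrightarrow> extend V \<phi> (ball (\<phi> p) (3 * r)) (\<lambda>y. b y * u y) \<in> SF"
    by (rule coordinate_ball[OF assms]) blast
  let ?h = "extend V \<phi> (ball (\<phi> p) (3 * r)) (\<lambda>y. b y * 1)"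
  have "?h q = 0" if "q \<notin> U" for q
  proof -
    have "q \<notin> V \<or> \<phi> q \<notin> \<phi> ` (V \<inter> U)" using that chart_inv[OF V(1)] by (metis Int_iff imageE)
    then show ?thesis using V(4) by (auto simp: extend_def)
  qed
  moreover have "?h p = 1" using V(2,3) b[of "\<phi> p"] by (simp add: extend_def)
  ultimately show ?thesis using ext[OF smooth_on_const] by blast
qed

lemma fmult_apply: "fmult f X g = f * X g"
  by (simp add: fmult_def)

lemma VF_0: "0 \<in> VF"
  by (auto simp: vector_fields_def SF_0 fun_eq_iff)

lemma VF_add: "X \<in> VF \<Longrightarrow> Y \<in> VF \<Longrightarrow> X + Y \<in> VF"
  unfolding vector_fields_def by (auto simp: SF_add algebra_simps fun_eq_iff)

lemma VF_fmult: "f \<in> SF \<Longrightarrow> X \<in> VF \<Longrightarrow> fmult f X \<in> VF"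
  unfolding vector_fields_def fmult_def by (auto simp: SF_mult algebra_simps fun_eq_iff)

lemma VF_uminus: "X \<in> VF \<Longrightarrow> - X \<in> VF"
  using VF_fmult[OF SF_const[of "-1"], of X] by (simp add: fmult_def func_times fun_Compl_def)

lemma VF_apply_0: "X \<in> VF \<Longrightarrow> X 0 = 0"
  using vector_fieldsD(2)[of X \<A> 0 0] SF_0 by simp

lemma VF_apply_uminus: "X \<in> VF \<Longrightarrow> f \<in> SF \<Longrightarrow> X (- f) = - X f"
  using vector_fieldsD(3)[of X \<A> f "-1"] by (simp add: fun_Compl_def)

lemma VF_apply_const: "X \<in> VF \<Longrightarrow> X (\<lambda>_. c) = 0"
proof -
  assume X: "X \<in> VF"
  have "X 1 = 0" using vector_fieldsD(4)[OF X SF_1 SF_1] by simp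
  then show ?thesis using vector_fieldsD(3)[OF X SF_1, of c] by (simp add: func_one func_zero)
qed

lemma VF_lie_bracket:
  assumes "X \<in> VF" "Y \<in> VF"
  shows "lie_bracket X Y \<in> VF"
  unfolding vector_fields_def
proof (clarsimp simp: lie_bracket_def, intro conjI ballI allI impI)
  note X = vector_fieldsD[OF assms(1)] and Y = vector_fieldsD[OF assms(2)]
  fix f assume f: "f \<in> SF"
  then show "X (Y f) - Y (X f) \<in> SF" by (simp add: X Y SF_minus)
  show "X (Y (\<lambda>p. c * f p)) - Y (X (\<lambda>p. c * f p)) = (\<lambda>p. c * (X (Y f) p - Y (X f) p))" for c
    using f by (simp add: X Y algebra_simps fun_eq_iff)
  fix g assume g: "g \<in> SF"
  show "X (Y (f + g)) - Y (X (f + g)) = X (Y f) - Y (X f) + (X (Y g) - Y (X g))"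
    using f g by (simp add: X Y)
  show "X (Y (f * g)) - Y (X (f * g)) = f * (X (Y g) - Y (X g)) + (X (Y f) - Y (X f)) * g"
    using f g by (simp add: X Y SF_mult algebra_simps)
next
  fix f assume "f \<notin> SF"
  then show "X (Y f) = Y (X f)"
    using VF_apply_0 assms vector_fieldsD(5) by metis
qed

definition differential :: "('a \<Rightarrow> real) \<Rightarrow> 'a vfield \<Rightarrow> 'a \<Rightarrow> real" where
  "differential f = (\<lambda>X. if X \<in> VF then X f else 0)"

lemma differential_one_form: "f \<in> SF \<Longrightarrow> differential f \<in> one_forms \<A>"
  unfolding dual_def linear_maps_def differential_def
  by (auto simp: VF_add VF_fmult fmult_apply vector_fieldsD(1))

lemma local_algebroid_TM: "local_algebroid (TM \<A>)"
proof
  show "X \<in> sections (TM \<A>) \<Longrightarrow> (\<And>\<xi>. \<xi> \<in> one_forms \<A> \<Longrightarrow> \<xi> X = 0) \<Longrightarrow> X = 0" for X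
  proof
    fix f assume X: "X \<in> sections (TM \<A>)" and 0: "\<And>\<xi>. \<xi> \<in> one_forms \<A> \<Longrightarrow> \<xi> X = 0"
    show "X f = 0 f"
    proof (cases "f \<in> SF")
      case True
      from 0[OF differential_one_form[OF this]] X show ?thesis by (simp add: differential_def)
    next
      case False
      then show ?thesis using X vector_fieldsD(5)[of X \<A> f] by simp
    qed
  qed
  show "bracket (TM \<A>) s (smul (TM \<A>) f t) = smul (TM \<A>) f (bracket (TM \<A>) s t) + smul (TM \<A>) (anchor (TM \<A>) s f) t"
    if "s \<in> sections (TM \<A>)" "t \<in> sections (TM \<A>)" "f \<in> base_ring (TM \<A>)" for s t f
  proof
    fix g
    note s = vector_fieldsD[OF that(1)[unfolded TM_simps]] and t = vector_fieldsD[OF that(2)[unfolded TM_simps]]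
    show "bracket (TM \<A>) s (smul (TM \<A>) f t) g =
        (smul (TM \<A>) f (bracket (TM \<A>) s t) + smul (TM \<A>) (anchor (TM \<A>) s f) t) g"
    proof (cases "g \<in> SF")
      case True
      with that show ?thesis by (simp add: lie_bracket_def fmult_apply s(4) t(1) algebra_simps)
    next
      case False
      with that have "s g = 0" "t g = 0" "s 0 = 0" "t 0 = 0" by (auto simp: s(5) t(5) VF_apply_0)
      then show ?thesis by (simp add: lie_bracket_def fmult_apply)
    qed
  qed
  show "bracket (TM \<A>) s (t + u) = bracket (TM \<A>) s t + bracket (TM \<A>) s u"
    if "s \<in> sections (TM \<A>)" "t \<in> sections (TM \<A>)" "u \<in> sections (TM \<A>)" for s t u
  proof
    fix g
    note s = vector_fieldsD[OF that(1)[unfolded TM_simps]] and t = vector_fieldsD[OF that(2)[unfolded TM_simps]]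
      and u = vector_fieldsD[OF that(3)[unfolded TM_simps]]
    show "bracket (TM \<A>) s (t + u) g = (bracket (TM \<A>) s t + bracket (TM \<A>) s u) g"
    proof (cases "g \<in> SF")
      case True
      with that show ?thesis by (simp add: lie_bracket_def s(2) t(1) u(1) algebra_simps)
    next
      case False
      with that have "s g = 0" "t g = 0" "u g = 0" "s 0 = 0" "t 0 = 0" "u 0 = 0"
        by (auto simp: s(5) t(5) u(5) VF_apply_0)
      then show ?thesis by (simp add: lie_bracket_def)
    qed
  qed
  show "bracket (TM \<A>) s t = - bracket (TM \<A>) t s" for s t
    by (simp add: lie_bracket_def fun_eq_iff)
  show "anchor (TM \<A>) s (f * g) = f * anchor (TM \<A>) s g + anchor (TM \<A>) s f * g"
    if "s \<in> sections (TM \<A>)" "f \<in> base_ring (TM \<A>)" "g \<in> base_ring (TM \<A>)" for s f g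
    using that by (simp add: vector_fieldsD(4)[of s \<A>])
  show "anchor (TM \<A>) s (f + g) = anchor (TM \<A>) s f + anchor (TM \<A>) s g"
    if "s \<in> sections (TM \<A>)" "f \<in> base_ring (TM \<A>)" "g \<in> base_ring (TM \<A>)" for s f g
    using that by (simp add: vector_fieldsD(2)[of s \<A>])
  show "anchor (TM \<A>) s f \<in> base_ring (TM \<A>)"
    if "s \<in> sections (TM \<A>)" "f \<in> base_ring (TM \<A>)" for s f
    using that by (simp add: vector_fieldsD(1)[of s \<A>])
  show "open U \<Longrightarrow> p \<in> U \<Longrightarrow> \<exists>h\<in>base_ring (TM \<A>). h p = 1 \<and> (\<forall>q. q \<notin> U \<longrightarrow> h q = 0)" for U and p :: 'a
    using bump_function by simp
qed (simp_all add: SF_const SF_add SF_mult VF_0 VF_add VF_uminus VF_fmult VF_lie_bracket fmult_apply)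


section \<open>Coordinate frames and reflexivity\<close>

sublocale TM: local_algebroid "TM \<A>"
  by (rule local_algebroid_TM)

text \<open>
  In the coordinates \<open>y\<^sub>i\<close> of a chart, Hadamard's lemma writes \<open>f\<close> as
  \<open>f(q) + \<Sum> (y\<^sub>i - y\<^sub>i(q)) G\<^sub>i\<close> with \<open>G\<^sub>i(q)\<close> the partial derivative of \<open>f\<close> at \<open>q\<close>. A derivation evaluated at
  \<open>q\<close> kills the constant and, in each product, the term in which the vanishing factor survives. Cut
  off by a bump, the coordinates and partial derivatives become the global \<open>x i\<close> and \<open>E i\<close>.
\<close>

lemma coordinate_frame:
  obtains E :: "'b \<Rightarrow> 'a vfield" and x :: "'b \<Rightarrow> 'a \<Rightarrow> real"
  where "\<And>i. E i \<in> VF" "\<And>i. x i \<in> SF"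
    "\<forall>\<^sub>F q in nhds p. \<forall>X\<in>VF. \<forall>f\<in>SF. X f q = (\<Sum>i\<in>Basis. X (x i) q * E i f q)"
proof -
  obtain U \<phi> r b where ch: "(U, \<phi>) \<in> \<A>" "p \<in> U" "r > 0" "ball (\<phi> p) (3 * r) \<subseteq> \<phi> ` (U \<inter> UNIV)"
    and b: "smooth_on UNIV b" "\<And>y. y \<in> ball (\<phi> p) r \<Longrightarrow> b y = (1::real)"
    and "\<And>y. y \<notin> cball (\<phi> p) (2 * r) \<Longrightarrow> b y = 0"
    and ext: "\<And>u. smooth_on (ball (\<phi> p) (3 * r)) u \<Longrightarrow> extend U \<phi> (ball (\<phi> p) (3 * r)) (\<lambda>y. b y * u y) \<in> SF"
    by (rule coordinate_ball[OF open_UNIV UNIV_I[of p]]) blast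
  define B where "B = ball (\<phi> p) (3 * r)"
  have B: "open B" "convex B" "B \<subseteq> \<phi> ` U" using ch(4) by (auto simp: B_def)
  define lift where "lift u = extend U \<phi> B (\<lambda>y. b y * u y)" for u
  have lift: "lift u \<in> SF" if "smooth_on B u" for u
    using ext that by (simp add: B_def lift_def)
  have lift_eq: "lift u q = b (\<phi> q) * u (\<phi> q)" if "q \<in> U" "\<phi> q \<in> B" for u q
    using that by (simp add: lift_def extend_def)
  have lift_0: "lift u q = 0" if "\<not> (q \<in> U \<and> \<phi> q \<in> B)" for u q
    using that by (auto simp: lift_def extend_def)
  define local where "local f = (\<lambda>y. f (inv_into U \<phi> y))" for f :: "'a \<Rightarrow> real"
  have smooth_local: "smooth_on B (local f)" if "f \<in> SF" for f
    using that ch(1) B(3) by (auto simp: local_def smooth_functions_iff intro: smooth_on_subset)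
  have local_eq: "local f (\<phi> q) = f q" if "q \<in> U" for f q
    using that by (simp add: local_def chart_inv[OF ch(1)])
  define D where "D f i = (\<lambda>y. frechet_derivative (local f) (at y) i)" for f i
  have hd: "(local f has_derivative (\<lambda>i. D f i y)) (at y)" if "f \<in> SF" "y \<in> B" for f y
    using smooth_on_has_derivative[OF smooth_local] that by (simp add: D_def)
  have D_eq: "D f i y = L i" if "(local f has_derivative L) (at y)" for f i y L
    using frechet_derivative_at[OF that] by (simp add: D_def)
  define E where "E i f = (if f \<in> SF then lift (D f i) else 0)" for i f
  have "smooth_on B (D f i)" if "f \<in> SF" for f i
    unfolding D_def by (rule smooth_on_derivative[OF smooth_local[OF that]])
  then have E1: "E i f \<in> SF" if "f \<in> SF" for i f using that by (simp add: E_def lift)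
  have lift_cong: "lift u = v" if "\<And>q. q \<in> U \<Longrightarrow> \<phi> q \<in> B \<Longrightarrow> b (\<phi> q) * u (\<phi> q) = v q"
    "\<And>q. \<not> (q \<in> U \<and> \<phi> q \<in> B) \<Longrightarrow> v q = 0" for u v
  proof
    fix q show "lift u q = v q"
    proof (cases "q \<in> U \<and> \<phi> q \<in> B")
      case True
      then show ?thesis using that(1)[of q] lift_eq[of q u] by simp
    next
      case False
      then show ?thesis using that(2)[of q] lift_0[of q u] by simp
    qed
  qed
  have E2: "E i (f + g) = E i f + E i g" if "f \<in> SF" "g \<in> SF" for i f g
  proof -
    have "D (f + g) i y = D f i y + D g i y" if "y \<in> B" for y
    proof (rule D_eq)
      show "(local (f + g) has_derivative (\<lambda>i. D f i y + D g i y)) (at y)"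
        using has_derivative_add[OF hd[OF \<open>f \<in> SF\<close> that] hd[OF \<open>g \<in> SF\<close> that]] by (simp add: local_def)
    qed
    then have "lift (D (f + g) i) = lift (D f i) + lift (D g i)"
      by (intro lift_cong) (simp_all add: lift_eq lift_0 algebra_simps)
    then show ?thesis using that by (simp add: E_def SF_add)
  qed
  have E3: "E i (\<lambda>p. c * f p) = (\<lambda>p. c * E i f p)" if "f \<in> SF" for i f c
  proof -
    have "D (\<lambda>p. c * f p) i y = c * D f i y" if "y \<in> B" for y
    proof (rule D_eq)
      show "(local (\<lambda>p. c * f p) has_derivative (\<lambda>i. c * D f i y)) (at y)"
        using has_derivative_mult_right[OF hd[OF \<open>f \<in> SF\<close> that], of c] by (simp add: local_def)
    qed
    then have "lift (D (\<lambda>p. c * f p) i) = (\<lambda>p. c * lift (D f i) p)"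
      by (intro lift_cong) (simp_all add: lift_eq lift_0)
    then show ?thesis using that by (simp add: E_def SF_scale)
  qed
  have E4: "E i (f * g) = f * E i g + E i f * g" if "f \<in> SF" "g \<in> SF" for i f g
  proof -
    have "D (f * g) i y = local f y * D g i y + D f i y * local g y" if "y \<in> B" for y
    proof (rule D_eq)
      show "(local (f * g) has_derivative (\<lambda>i. local f y * D g i y + D f i y * local g y)) (at y)"
        using has_derivative_mult[OF hd[OF \<open>f \<in> SF\<close> that] hd[OF \<open>g \<in> SF\<close> that]] by (simp add: local_def)
    qed
    then have "lift (D (f * g) i) = f * lift (D g i) + lift (D f i) * g"
      by (intro lift_cong) (simp_all add: lift_eq lift_0 local_eq algebra_simps)
    then show ?thesis using that by (simp add: E_def SF_mult)
  qed
  have E: "E i \<in> VF" for i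
    unfolding vector_fields_def using E1 E2 E3 E4 by (auto simp: E_def)
  define x where "x i = lift (\<lambda>y. y \<bullet> i)" for i
  have "smooth_on B (\<lambda>y. y \<bullet> i)" for i
    using B(1) by (simp add: smooth_on_def Ck_on_bounded_linear bounded_linear_inner_left)
  then have x: "x i \<in> SF" for i unfolding x_def by (rule lift)
  define W where "W = {q \<in> U. \<phi> q \<in> ball (\<phi> p) r}"
  have W: "open W" "p \<in> W"
    using chart_vimage_open[OF ch(1) open_ball, of "\<phi> p" r] ch by (simp_all add: W_def)
  have WB: "q \<in> U" "\<phi> q \<in> B" "b (\<phi> q) = 1" if "q \<in> W" for q
    using that ch(3) b(2) by (auto simp: W_def B_def)
  have main: "X f q = (\<Sum>i\<in>Basis. X (x i) q * E i f q)" if q: "q \<in> W" and X: "X \<in> VF" and f: "f \<in> SF" for q X f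
  proof -
    note Xd = vector_fieldsD[OF X]
    define y0 where "y0 = \<phi> q"
    obtain G where G: "\<And>i. smooth_on B (G i)" "\<And>i. G i y0 = D f i y0"
      "\<And>y. y \<in> B \<Longrightarrow> local f y = local f y0 + (\<Sum>i\<in>Basis. ((y - y0) \<bullet> i) * G i y)"
      unfolding y0_def D_def by (rule Hadamard[OF B(1,2) WB(2)[OF q] smooth_local[OF f]]) blast
    define h where "h = lift (\<lambda>_. 1)"
    have h: "h \<in> SF" unfolding h_def by (rule lift[OF smooth_on_const])
    define c where "c i = (\<lambda>_::'a. - (y0 \<bullet> i))" for i
    \<comment> \<open>Hadamard's expansion times \<open>h\<^sup>2\<close>: one factor \<open>h\<close> cuts off the coordinate differences, the other the coefficients.\<close>
    have "h * h * f = (\<lambda>_. f q) * (h * h) + (\<Sum>i\<in>Basis. (x i + c i * h) * lift (G i))"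
    proof
      fix q'
      show "(h * h * f) q' = ((\<lambda>_. f q) * (h * h) + (\<Sum>i\<in>Basis. (x i + c i * h) * lift (G i))) q'"
      proof (cases "q' \<in> U \<and> \<phi> q' \<in> B")
        case True
        have "f q' = f q + (\<Sum>i\<in>Basis. ((\<phi> q' - y0) \<bullet> i) * G i (\<phi> q'))"
          using G(3)[of "\<phi> q'"] True WB(1)[OF q] by (simp add: local_eq y0_def)
        then show ?thesis
          using True by (simp add: sum_fun_apply h_def x_def c_def lift_eq sum_distrib_left algebra_simps)
      next
        case False
        then show ?thesis by (simp add: sum_fun_apply h_def x_def lift_0)
      qed
    qed
    then have eq: "X (h * h * f) q = X ((\<lambda>_. f q) * (h * h) + (\<Sum>i\<in>Basis. (x i + c i * h) * lift (G i))) q"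
      by simp
    have hq: "h q = 1" using WB[OF q] by (simp add: h_def lift_eq)
    have Xh: "X h q = 0"
    proof -
      have "\<forall>\<^sub>F q' in nhds q. h q' = 1"
        using W(1) q WB by (auto simp: eventually_nhds h_def lift_eq)
      then show ?thesis
        using TM.anchor_cong_near[of X h "\<lambda>_. 1" q] X h SF_const VF_apply_const[OF X] by simp
    qed
    have sm: "x i + c i * h \<in> SF" "lift (G i) \<in> SF" for i
      by (simp_all add: SF_add SF_mult x h c_def SF_const lift G(1))
    have Xsum: "X (\<Sum>i\<in>I. g i) = (\<Sum>i\<in>I. X (g i))" if "\<And>i. g i \<in> SF" for g :: "'b \<Rightarrow> 'a \<Rightarrow> real" and I
    proof (induction I rule: infinite_finite_induct)
      case (insert i I)
      have "X (g i + sum g I) = X (g i) + X (sum g I)" by (rule Xd(2)) (simp_all add: that SF_sum)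
      with insert show ?case by (simp only: sum.insert[OF insert(1,2)])
    qed (simp_all only: sum.infinite sum.empty not_False_eq_True VF_apply_0[OF X])
    have Xc: "X ((\<lambda>_. k) * g) = (\<lambda>p. k * X g p)" if "g \<in> SF" for k g
      using Xd(3)[OF that, of k] by (simp add: func_times)
    have "X (h * h * f) q = X f q"
      by (simp add: Xd(4) SF_mult h f hq Xh)
    moreover have "X ((\<lambda>_. f q) * (h * h) + (\<Sum>i\<in>Basis. (x i + c i * h) * lift (G i))) q
        = (\<Sum>i\<in>Basis. X (x i) q * D f i y0)"
    proof -
      have "(x i + c i * h) q = 0" for i
        using WB[OF q] by (simp add: x_def c_def hq lift_eq y0_def)
      moreover have "X (x i + c i * h) q = X (x i) q" for i
        using Xc[OF h, of "- (y0 \<bullet> i)"] by (simp add: Xd(2) x h SF_mult SF_const c_def Xh)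
      moreover have "lift (G i) q = D f i y0" for i
        using WB[OF q] G(2) by (simp add: lift_eq y0_def)
      ultimately show ?thesis
        by (simp add: Xd(2) Xd(4) VF_apply_const[OF X] Xsum Xc SF_mult SF_sum SF_const h sm hq Xh sum_fun_apply)
    qed
    moreover have "E i f q = D f i y0" for i
      using WB[OF q] f by (simp add: E_def lift_eq y0_def)
    ultimately show ?thesis using eq by simp
  qed
  show thesis
  proof (rule that[OF E x])
    show "\<forall>\<^sub>F q in nhds p. \<forall>X\<in>VF. \<forall>f\<in>SF. X f q = (\<Sum>i\<in>Basis. X (x i) q * E i f q)"
      unfolding eventually_nhds using W main by blast
  qed
qed

text \<open>
  Linearity over functions makes a 1-form local.
\<close>

lemma one_form_cong:
  assumes "X \<in> VF" "Y \<in> VF" "\<alpha> \<in> one_forms \<A>"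
    "\<forall>\<^sub>F q in nhds p. \<forall>f\<in>SF. X f q = Y f q"
  shows "\<alpha> X p = \<alpha> Y p"
proof -
  obtain W where W: "open W" "p \<in> W" "\<And>q f. q \<in> W \<Longrightarrow> f \<in> SF \<Longrightarrow> X f q = Y f q"
    using assms(4) by (auto simp: eventually_nhds)
  obtain h where h: "h \<in> SF" "h p = 1" "\<And>q. q \<notin> W \<Longrightarrow> h q = 0"
    using bump_function[OF W(1,2)] by blast
  have "fmult h X = fmult h Y"
  proof (intro ext)
    fix f q
    show "fmult h X f q = fmult h Y f q"
      using W(3)[of q f] h(3)[of q] vector_fieldsD(5)[OF assms(1)] vector_fieldsD(5)[OF assms(2)]
      by (cases "f \<in> SF"; cases "q \<in> W") (auto simp: fmult_apply)
  qed
  then have "h * \<alpha> X = h * \<alpha> Y"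
    using TM.dual_smul[OF assms(3), of h X] TM.dual_smul[OF assms(3), of h Y] assms h by simp
  from fun_cong[OF this, of p] show ?thesis using h(2) by simp
qed

lemma coframe:
  obtains E :: "'b \<Rightarrow> 'a vfield" and x :: "'b \<Rightarrow> 'a \<Rightarrow> real"
  where "\<And>i. E i \<in> VF" "\<And>i. x i \<in> SF"
    "\<forall>\<^sub>F q in nhds p. \<forall>X\<in>VF. \<forall>\<alpha>\<in>one_forms \<A>. \<alpha> X q = (\<Sum>i\<in>Basis. X (x i) q * \<alpha> (E i) q)"
proof -
  obtain E :: "'b \<Rightarrow> 'a vfield" and x where E: "\<And>i. E i \<in> VF" "\<And>i. x i \<in> SF"
    and ev: "\<forall>\<^sub>F q in nhds p. \<forall>X\<in>VF. \<forall>f\<in>SF. X f q = (\<Sum>i\<in>Basis. X (x i) q * E i f q)"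
    by (rule coordinate_frame[of p]) blast
  have "\<alpha> X q = (\<Sum>i\<in>Basis. X (x i) q * \<alpha> (E i) q)"
    if ev': "\<forall>\<^sub>F q in nhds q. \<forall>X\<in>VF. \<forall>f\<in>SF. X f q = (\<Sum>i\<in>Basis. X (x i) q * E i f q)"
      and X: "X \<in> VF" and \<alpha>: "\<alpha> \<in> one_forms \<A>" for X \<alpha> q
  proof -
    have Xx: "X (x i) \<in> SF" for i by (simp add: vector_fieldsD(1)[OF X] E)
    define Y where "Y I = (\<Sum>i\<in>I. fmult (X (x i)) (E i))" for I
    have Y: "Y I \<in> VF" "\<alpha> (Y I) = (\<Sum>i\<in>I. X (x i) * \<alpha> (E i))" for I
      using linear_maps_sum[of \<alpha> SF VF fmult "\<lambda>i. X (x i)" E I] \<alpha> Xx E VF_0 VF_add VF_fmult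
      unfolding Y_def by (simp_all add: dual_def)
    have "Y I f = (\<Sum>i\<in>I. X (x i) * E i f)" for I f
      by (simp add: Y_def sum_fun_apply fmult_apply)
    then have "\<forall>\<^sub>F q in nhds q. \<forall>f\<in>SF. X f q = Y Basis f q"
      using ev' X by (auto simp: sum_fun_apply elim!: eventually_mono)
    from one_form_cong[OF X Y(1) \<alpha> this] show ?thesis by (simp add: Y(2) sum_fun_apply)
  qed
  then have "\<forall>\<^sub>F q in nhds p. \<forall>X\<in>VF. \<forall>\<alpha>\<in>one_forms \<A>. \<alpha> X q = (\<Sum>i\<in>Basis. X (x i) q * \<alpha> (E i) q)"
    using ev[THEN eventually_eventually[THEN iffD2]] by (auto elim!: eventually_mono)
  with E show thesis by (rule that)
qed

lemma framed_algebroid_TM: "framed_algebroid (TM \<A>)"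
proof
  fix p
  obtain E :: "'b \<Rightarrow> 'a vfield" and x where E: "\<And>i. E i \<in> VF" "\<And>i. x i \<in> SF" and
    ev: "\<forall>\<^sub>F q in nhds p. \<forall>X\<in>VF. \<forall>\<alpha>\<in>one_forms \<A>. \<alpha> X q = (\<Sum>i\<in>Basis. X (x i) q * \<alpha> (E i) q)"
    by (rule coframe[of p]) blast
  obtain bs where bs: "set bs = (Basis :: 'b set)" "distinct bs"
    using finite_distinct_list[OF finite_Basis] by blast
  define fs where "fs = map (\<lambda>i. (E i, differential (x i))) bs"
  have "(\<Sum>(e, \<epsilon>)\<leftarrow>fs. \<epsilon> X q * \<alpha> e q) = (\<Sum>i\<in>Basis. X (x i) q * \<alpha> (E i) q)" if "X \<in> VF" for X \<alpha> q
    using that bs by (simp add: fs_def o_def differential_def sum_list_distinct_conv_sum_set)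
  then have "set fs \<subseteq> sections (TM \<A>) \<times> one_forms \<A> \<and>
      (\<forall>\<^sub>F q in nhds p. \<forall>s\<in>sections (TM \<A>). \<forall>\<xi>\<in>one_forms \<A>. \<xi> s q = (\<Sum>(e, \<epsilon>)\<leftarrow>fs. \<epsilon> s q * \<xi> e q))"
    using ev E by (auto simp: fs_def differential_one_form elim!: eventually_mono)
  then show "\<exists>fs. set fs \<subseteq> sections (TM \<A>) \<times> one_forms \<A> \<and>
      (\<forall>\<^sub>F q in nhds p. \<forall>s\<in>sections (TM \<A>). \<forall>\<xi>\<in>one_forms \<A>. \<xi> s q = (\<Sum>(e, \<epsilon>)\<leftarrow>fs. \<epsilon> s q * \<xi> e q))"
    by blast
qed

sublocale TM: framed_algebroid "TM \<A>"
  by (rule framed_algebroid_TM)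

text \<open>
  Applied to differentials, \<open>\<Phi>\<close> becomes a derivation \<open>X\<close>. Near a point a 1-form is a linear
  combination of differentials of coordinates, and linearity over functions, together with a bump,
  shows that \<open>\<Phi>\<close> at the point is evaluation on \<open>X\<close>. No gluing of local vector fields occurs.
\<close>

lemma one_forms_reflexive:
  assumes "\<Phi> \<in> linear_maps SF (one_forms \<A>) fmult"
  shows "\<exists>X\<in>VF. \<forall>\<alpha>\<in>one_forms \<A>. \<alpha> X = \<Phi> \<alpha>"
proof -
  note \<Phi> = linear_mapsD[OF assms]
  note d = differential_one_form
  define X where "X f = (if f \<in> SF then \<Phi> (differential f) else 0)" for f
  have d_add: "differential (f + g) = differential f + differential g" if "f \<in> SF" "g \<in> SF" for f g
    using that by (auto simp: differential_def fun_eq_iff vector_fieldsD(2))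
  have d_scale: "differential (\<lambda>p. c * f p) = fmult (\<lambda>_. c) (differential f)" if "f \<in> SF" for c f
    using that by (auto simp: differential_def fun_eq_iff fmult_def vector_fieldsD(3))
  have d_mult: "differential (f * g) = fmult f (differential g) + fmult g (differential f)"
    if "f \<in> SF" "g \<in> SF" for f g
    using that by (auto simp: differential_def fun_eq_iff fmult_def vector_fieldsD(4))
  have d_fmult: "fmult f (differential g) \<in> one_forms \<A>" if "f \<in> SF" "g \<in> SF" for f g
    using TM.dual_closed_fmult that d by simp
  have X: "X \<in> VF"
    unfolding vector_fields_def
  proof (intro CollectI conjI ballI allI impI)
    fix f assume f: "f \<in> SF"
    show "X f \<in> SF" using f by (simp add: X_def \<Phi>(1) d)
    show "X (\<lambda>p. c * f p) = (\<lambda>p. c * X f p)" for c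
      using f by (simp add: X_def SF_scale d_scale \<Phi>(3)[OF SF_const d[OF f]] func_times)
    fix g assume g: "g \<in> SF"
    show "X (f + g) = X f + X g"
      using f g by (simp add: X_def SF_add d_add \<Phi>(2)[OF d d])
    show "X (f * g) = f * X g + X f * g"
      using f g by (simp add: X_def SF_mult d_mult \<Phi>(2)[OF d_fmult d_fmult] \<Phi>(3)[OF _ d])
  qed (simp add: X_def)
  have "\<alpha> X p = \<Phi> \<alpha> p" if \<alpha>: "\<alpha> \<in> one_forms \<A>" for \<alpha> p
  proof -
    obtain E :: "'b \<Rightarrow> 'a vfield" and x where E: "\<And>i. E i \<in> VF" "\<And>i. x i \<in> SF" and
      ev: "\<forall>\<^sub>F q in nhds p. \<forall>X\<in>VF. \<forall>\<alpha>\<in>one_forms \<A>. \<alpha> X q = (\<Sum>i\<in>Basis. X (x i) q * \<alpha> (E i) q)"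
      by (rule coframe[of p]) blast
    obtain W where W: "open W" "p \<in> W" and
      frame: "\<And>q X \<alpha>. q \<in> W \<Longrightarrow> X \<in> VF \<Longrightarrow> \<alpha> \<in> one_forms \<A> \<Longrightarrow> \<alpha> X q = (\<Sum>i\<in>Basis. X (x i) q * \<alpha> (E i) q)"
      using ev by (auto simp: eventually_nhds)
    obtain h where h: "h \<in> SF" "h p = 1" "\<And>q. q \<notin> W \<Longrightarrow> h q = 0"
      using bump_function[OF W] by blast
    have \<alpha>E: "\<alpha> (E i) \<in> SF" for i using TM.dual_ring[OF \<alpha>] E by simp
    define \<beta> where "\<beta> I = (\<Sum>i\<in>I. fmult (\<alpha> (E i)) (differential (x i)))" for I
    have form_0: "0 \<in> one_forms \<A>" by (auto simp: dual_def linear_maps_def SF_0)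
    have \<beta>: "\<beta> I \<in> one_forms \<A>" "\<Phi> (\<beta> I) = (\<Sum>i\<in>I. \<alpha> (E i) * \<Phi> (differential (x i)))" for I
      using linear_maps_sum[OF assms form_0 TM.dual_closed_add, of "\<lambda>i. \<alpha> (E i)" "\<lambda>i. differential (x i)" I]
        TM.dual_closed_fmult \<alpha>E d E
      unfolding \<beta>_def by simp_all
    \<comment> \<open>\<open>\<beta> Basis\<close> is the coordinate expansion of \<open>\<alpha>\<close>, valid near \<open>p\<close>; the bump \<open>h\<close> makes the equality global.\<close>
    have "fmult h \<alpha> = fmult h (\<beta> Basis)"
    proof (intro ext)
      fix Y q
      show "fmult h \<alpha> Y q = fmult h (\<beta> Basis) Y q"
      proof (cases "Y \<in> VF \<and> q \<in> W")
        case True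
        then show ?thesis
          using frame[of q Y \<alpha>] \<alpha>
          by (simp add: fmult_apply \<beta>_def sum_fun_apply differential_def mult.commute)
      next
        case False
        then show ?thesis
          using h(3) \<alpha> \<beta>(1)[of Basis] by (auto simp: fmult_apply dual_def linear_maps_def)
      qed
    qed
    then have "h * \<Phi> \<alpha> = h * \<Phi> (\<beta> Basis)"
      using \<Phi>(3)[OF h(1) \<alpha>] \<Phi>(3)[OF h(1) \<beta>(1)] by simp
    from fun_cong[OF this, of p] have "\<Phi> \<alpha> p = \<Phi> (\<beta> Basis) p" using h(2) by simp
    also have "\<dots> = (\<Sum>i\<in>Basis. X (x i) p * \<alpha> (E i) p)"
      using E by (simp add: \<beta>(2) sum_fun_apply X_def mult.commute)
    also have "\<dots> = \<alpha> X p" using frame[OF W(2) X \<alpha>] by simp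
    finally show ?thesis by simp
  qed
  with X show ?thesis by (intro bexI[of _ X]) auto
qed

end


section \<open>Sections and covectors of \<open>TM \<oplus> \<real>\<close>\<close>

lemma TMR_simps [simp]:
  "base_ring (TMR \<A> \<Omega>) = smooth_functions \<A>"
  "sections (TMR \<A> \<Omega>) = vector_fields \<A> \<times> smooth_functions \<A>"
  "smul (TMR \<A> \<Omega>) h (X, f) = (fmult h X, h * f)"
  "anchor (TMR \<A> \<Omega>) (X, f) = X"
  "bracket (TMR \<A> \<Omega>) (X, f) (Y, g) = (lie_bracket X Y, X g - Y f + \<Omega> X Y)"
  by (simp_all add: TMR_def)

locale manifold_with_two_form = smooth_manifold \<A>
  for \<A> :: "('a::{t2_space, second_countable_topology}, 'b::euclidean_space) chart set" +
  fixes \<Omega> :: "'a vfield \<Rightarrow> 'a vfield \<Rightarrow> 'a \<Rightarrow> real"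
  assumes two_form: "\<Omega> \<in> two_forms \<A>"
begin

lemma \<Omega>_skew: "X \<in> VF \<Longrightarrow> Y \<in> VF \<Longrightarrow> \<Omega> X Y = - \<Omega> Y X"
  using alternating_mapsD(2)[OF two_form[unfolded two_forms_def]] .

lemma \<Omega>_linear:
  assumes "X \<in> VF" "Y \<in> VF"
  shows "\<Omega> X Y \<in> SF" "Z \<in> VF \<Longrightarrow> \<Omega> X (Y + Z) = \<Omega> X Y + \<Omega> X Z" "f \<in> SF \<Longrightarrow> \<Omega> X (fmult f Y) = f * \<Omega> X Y"
  using linear_mapsD[OF alternating_mapsD(1)[OF two_form[unfolded two_forms_def] assms(1)]] assms(2) by auto

abbreviation "forms \<equiv> one_forms \<A>"
abbreviation "pair_forms \<equiv> dual (TMR \<A> \<Omega>)"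

definition restrict_form :: "('a vfield \<times> ('a \<Rightarrow> real) \<Rightarrow> 'a \<Rightarrow> real) \<Rightarrow> 'a vfield \<Rightarrow> 'a \<Rightarrow> real" where
  "restrict_form \<xi> = (\<lambda>X. \<xi> (X, 0))"

definition pull_back :: "('a vfield \<Rightarrow> 'a \<Rightarrow> real) \<Rightarrow> 'a vfield \<times> ('a \<Rightarrow> real) \<Rightarrow> 'a \<Rightarrow> real" where
  "pull_back \<alpha> = (\<lambda>(X, f). if X \<in> VF \<and> f \<in> SF then \<alpha> X else 0)"

text \<open>
  The covector that spans, over the ring of functions, a complement of the pulled back 1-forms.
\<close>

definition dt :: "'a vfield \<times> ('a \<Rightarrow> real) \<Rightarrow> 'a \<Rightarrow> real" where
  "dt = (\<lambda>(X, f). if X \<in> VF \<and> f \<in> SF then f else 0)"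

lemma pull_back_apply [simp]: "X \<in> VF \<Longrightarrow> f \<in> SF \<Longrightarrow> pull_back \<alpha> (X, f) = \<alpha> X"
  by (simp add: pull_back_def)

lemma dt_apply [simp]: "X \<in> VF \<Longrightarrow> f \<in> SF \<Longrightarrow> dt (X, f) = f"
  by (simp add: dt_def)

lemma dt_form: "dt \<in> pair_forms"
  unfolding dual_def linear_maps_def by (auto simp: dt_def VF_add VF_fmult SF_add SF_mult)

lemma pull_back_form: "\<alpha> \<in> forms \<Longrightarrow> pull_back \<alpha> \<in> pair_forms"
  unfolding dual_def linear_maps_def by (auto simp: pull_back_def VF_add VF_fmult SF_add SF_mult)

lemma restrict_form_form:
  assumes "\<xi> \<in> pair_forms"
  shows "restrict_form \<xi> \<in> forms"
proof -
  note \<xi> = linear_mapsD[OF assms[unfolded dual_def TMR_simps]]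
  show ?thesis
    unfolding dual_def linear_maps_def TM_simps restrict_form_def
  proof (intro CollectI conjI ballI allI impI)
    fix X assume X: "X \<in> VF"
    then show "\<xi> (X, 0) \<in> SF" by (simp add: \<xi>(1) SF_0)
    show "\<xi> (fmult f X, 0) = f * \<xi> (X, 0)" if "f \<in> SF" for f
      using \<xi>(3)[OF that, of "(X, 0)"] X by (simp add: SF_0)
    show "\<xi> (X + Y, 0) = \<xi> (X, 0) + \<xi> (Y, 0)" if "Y \<in> VF" for Y
      using \<xi>(2)[of "(X, 0)" "(Y, 0)"] X that by (simp add: SF_0)
  next
    fix X assume "X \<notin> VF"
    then show "\<xi> (X, 0) = 0" by (simp add: \<xi>(4))
  qed
qed

lemma pair_form_apply:
  assumes "\<xi> \<in> pair_forms" "X \<in> VF" "f \<in> SF"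
  shows "\<xi> (X, f) = restrict_form \<xi> X + f * \<xi> (0, 1)"
proof -
  note \<xi> = linear_mapsD[OF assms(1)[unfolded dual_def TMR_simps]]
  have "fmult f (0 :: 'a vfield) = 0" by (simp add: fmult_def fun_eq_iff)
  then show ?thesis
    using \<xi>(2)[of "(X, 0)" "(0, f)"] \<xi>(3)[OF assms(3), of "(0, 1)"] assms(2,3)
    by (simp add: restrict_form_def SF_0 SF_1 VF_0)
qed

lemma pair_form_split:
  assumes "\<xi> \<in> pair_forms"
  shows "\<xi> = pull_back (restrict_form \<xi>) + fmult (\<xi> (0, 1)) dt"
proof
  fix s :: "'a vfield \<times> ('a \<Rightarrow> real)"
  obtain X f where s: "s = (X, f)" by (cases s)
  show "\<xi> s = (pull_back (restrict_form \<xi>) + fmult (\<xi> (0, 1)) dt) s"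
  proof (cases "X \<in> VF \<and> f \<in> SF")
    case True
    then show ?thesis using pair_form_apply[OF assms, of X f] by (simp add: s fmult_def mult.commute)
  next
    case False
    then show ?thesis
      using linear_mapsD(4)[OF assms[unfolded dual_def TMR_simps], of s]
      by (auto simp: s fmult_def pull_back_def dt_def)
  qed
qed

lemma VF_separating: "X \<in> VF \<Longrightarrow> (\<And>\<alpha>. \<alpha> \<in> forms \<Longrightarrow> \<alpha> X = 0) \<Longrightarrow> X = 0"
  by (rule TM.separating[unfolded TM_simps])

lemma local_algebroid_TMR: "local_algebroid (TMR \<A> \<Omega>)"
proof
  note anchor_ring = TM.anchor_ring[unfolded TM_simps]
  fix s t u :: "'a vfield \<times> ('a \<Rightarrow> real)" and f g :: "'a \<Rightarrow> real"
  obtain X a where s: "s = (X, a)" by (cases s)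
  obtain Y b where t: "t = (Y, b)" by (cases t)
  obtain Z c where u: "u = (Z, c)" by (cases u)
  show "f \<in> base_ring (TMR \<A> \<Omega>) \<Longrightarrow> g \<in> base_ring (TMR \<A> \<Omega>) \<Longrightarrow> f + g \<in> base_ring (TMR \<A> \<Omega>)"
    and "f \<in> base_ring (TMR \<A> \<Omega>) \<Longrightarrow> g \<in> base_ring (TMR \<A> \<Omega>) \<Longrightarrow> f * g \<in> base_ring (TMR \<A> \<Omega>)"
    by (simp_all add: SF_add SF_mult)
  show "(\<lambda>_. k) \<in> base_ring (TMR \<A> \<Omega>)" for k by (simp add: SF_const)
  show "0 \<in> sections (TMR \<A> \<Omega>)" by (simp add: VF_0 SF_0 zero_prod_def)
  show "f \<in> base_ring (TMR \<A> \<Omega>) \<Longrightarrow> s \<in> sections (TMR \<A> \<Omega>) \<Longrightarrow> smul (TMR \<A> \<Omega>) f s \<in> sections (TMR \<A> \<Omega>)"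
    and "f \<in> base_ring (TMR \<A> \<Omega>) \<Longrightarrow> s \<in> sections (TMR \<A> \<Omega>) \<Longrightarrow>
      anchor (TMR \<A> \<Omega>) (smul (TMR \<A> \<Omega>) f s) g = f * anchor (TMR \<A> \<Omega>) s g" for s
    by (cases s; simp add: SF_mult VF_fmult fmult_apply)+
  assume sS: "s \<in> sections (TMR \<A> \<Omega>)"
  then have X: "X \<in> VF" "a \<in> SF" by (simp_all add: s)
  show "- s \<in> sections (TMR \<A> \<Omega>)" using X by (simp add: s VF_uminus SF_uminus)
  show "f \<in> base_ring (TMR \<A> \<Omega>) \<Longrightarrow> anchor (TMR \<A> \<Omega>) s f \<in> base_ring (TMR \<A> \<Omega>)"
    using X by (simp add: s anchor_ring)
  show "f \<in> base_ring (TMR \<A> \<Omega>) \<Longrightarrow> g \<in> base_ring (TMR \<A> \<Omega>) \<Longrightarrow>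
      anchor (TMR \<A> \<Omega>) s (f + g) = anchor (TMR \<A> \<Omega>) s f + anchor (TMR \<A> \<Omega>) s g"
    using vector_fieldsD(2)[OF X(1), of f g] by (simp add: s)
  show "f \<in> base_ring (TMR \<A> \<Omega>) \<Longrightarrow> g \<in> base_ring (TMR \<A> \<Omega>) \<Longrightarrow>
      anchor (TMR \<A> \<Omega>) s (f * g) = f * anchor (TMR \<A> \<Omega>) s g + anchor (TMR \<A> \<Omega>) s f * g"
    using vector_fieldsD(4)[OF X(1), of f g] by (simp add: s)
  show "s = 0" if "\<And>\<xi>. \<xi> \<in> pair_forms \<Longrightarrow> \<xi> s = 0"
  proof -
    have "\<alpha> X = 0" if "\<alpha> \<in> forms" for \<alpha>
      using \<open>\<And>\<xi>. \<xi> \<in> pair_forms \<Longrightarrow> \<xi> s = 0\<close>[OF pull_back_form[OF that]] X by (simp add: s)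
    then have "X = 0" by (rule VF_separating[OF X(1)])
    moreover have "a = 0" using that[OF dt_form] X by (simp add: s)
    ultimately show ?thesis by (simp add: s zero_prod_def)
  qed
  assume tS: "t \<in> sections (TMR \<A> \<Omega>)"
  then have Y: "Y \<in> VF" "b \<in> SF" by (simp_all add: t)
  show "s + t \<in> sections (TMR \<A> \<Omega>)" using X Y by (simp add: s t VF_add SF_add)
  show "anchor (TMR \<A> \<Omega>) (s + t) f = anchor (TMR \<A> \<Omega>) s f + anchor (TMR \<A> \<Omega>) t f" by (simp add: s t)
  show "bracket (TMR \<A> \<Omega>) s t \<in> sections (TMR \<A> \<Omega>)"
    using X Y by (simp add: s t VF_lie_bracket SF_add SF_minus anchor_ring \<Omega>_linear)
  show "bracket (TMR \<A> \<Omega>) s t = - bracket (TMR \<A> \<Omega>) t s"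
    using X Y \<Omega>_skew[of X Y] TM.bracket_skew[of X Y] by (simp add: s t)
  show "bracket (TMR \<A> \<Omega>) s (smul (TMR \<A> \<Omega>) f t) =
      smul (TMR \<A> \<Omega>) f (bracket (TMR \<A> \<Omega>) s t) + smul (TMR \<A> \<Omega>) (anchor (TMR \<A> \<Omega>) s f) t"
    if "f \<in> base_ring (TMR \<A> \<Omega>)"
    using X Y that TM.bracket_smul[of X Y f] vector_fieldsD(4)[OF X(1), of f b]
    by (simp add: s t \<Omega>_linear fmult_apply algebra_simps)
  assume "u \<in> sections (TMR \<A> \<Omega>)"
  then have Z: "Z \<in> VF" "c \<in> SF" by (simp_all add: u)
  show "bracket (TMR \<A> \<Omega>) s (t + u) = bracket (TMR \<A> \<Omega>) s t + bracket (TMR \<A> \<Omega>) s u"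
    using X Y Z TM.bracket_add[of X Y Z] vector_fieldsD(2)[OF X(1), of b c]
    by (simp add: s t u \<Omega>_linear algebra_simps)
next
  show "open U \<Longrightarrow> p \<in> U \<Longrightarrow> \<exists>h\<in>base_ring (TMR \<A> \<Omega>). h p = 1 \<and> (\<forall>q. q \<notin> U \<longrightarrow> h q = 0)" for U and p :: 'a
    using bump_function by simp
qed

sublocale TMR: local_algebroid "TMR \<A> \<Omega>"
  by (rule local_algebroid_TMR)

lemma framed_algebroid_TMR: "framed_algebroid (TMR \<A> \<Omega>)"
proof
  fix p
  obtain E :: "'b \<Rightarrow> 'a vfield" and x where E: "\<And>i. E i \<in> VF" "\<And>i. x i \<in> SF" and
    ev: "\<forall>\<^sub>F q in nhds p. \<forall>X\<in>VF. \<forall>\<alpha>\<in>forms. \<alpha> X q = (\<Sum>i\<in>Basis. X (x i) q * \<alpha> (E i) q)"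
    by (rule coframe[of p]) blast
  obtain bs where bs: "set bs = (Basis :: 'b set)" "distinct bs"
    using finite_distinct_list[OF finite_Basis] by blast
  define fs where "fs = ((0, 1), dt) # map (\<lambda>i. ((E i, 0 :: 'a \<Rightarrow> real), pull_back (differential (x i)))) bs"
  have "\<xi> (X, f) q = (\<Sum>(e, \<epsilon>)\<leftarrow>fs. \<epsilon> (X, f) q * \<xi> e q)"
    if q: "\<forall>X\<in>VF. \<forall>\<alpha>\<in>forms. \<alpha> X q = (\<Sum>i\<in>Basis. X (x i) q * \<alpha> (E i) q)"
      and \<xi>: "\<xi> \<in> pair_forms" and "X \<in> VF" "f \<in> SF" for \<xi> X f q
  proof -
    have "restrict_form \<xi> X q = (\<Sum>i\<in>Basis. X (x i) q * restrict_form \<xi> (E i) q)"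
      using q restrict_form_form[OF \<xi>] that(3) by blast
    then show ?thesis
      using that(3,4) bs
      by (simp add: pair_form_apply[OF \<xi>] fs_def o_def differential_def sum_list_distinct_conv_sum_set
          restrict_form_def[symmetric]) (simp add: restrict_form_def)
  qed
  then have "set fs \<subseteq> sections (TMR \<A> \<Omega>) \<times> pair_forms \<and>
      (\<forall>\<^sub>F q in nhds p. \<forall>s\<in>sections (TMR \<A> \<Omega>). \<forall>\<xi>\<in>pair_forms. \<xi> s q = (\<Sum>(e, \<epsilon>)\<leftarrow>fs. \<epsilon> s q * \<xi> e q))"
    using ev E by (auto simp: fs_def differential_one_form dt_form pull_back_form VF_0 SF_0 SF_1
        elim!: eventually_mono)
  then show "\<exists>fs. set fs \<subseteq> sections (TMR \<A> \<Omega>) \<times> pair_forms \<and>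
      (\<forall>\<^sub>F q in nhds p. \<forall>s\<in>sections (TMR \<A> \<Omega>). \<forall>\<xi>\<in>pair_forms. \<xi> s q = (\<Sum>(e, \<epsilon>)\<leftarrow>fs. \<epsilon> s q * \<xi> e q))"
    by blast
qed

sublocale TMR: framed_algebroid "TMR \<A> \<Omega>"
  by (rule framed_algebroid_TMR)


section \<open>The bivector \<open>Q + \<partial>/\<partial>t \<and> E\<close>\<close>

lemma form_0: "0 \<in> forms"
  by (auto simp: dual_def linear_maps_def SF_0)

lemma bivector_field:
  assumes "Q \<in> bivector_fields \<A>"
  shows "\<alpha> \<in> forms \<Longrightarrow> Q \<alpha> \<in> linear_maps SF forms fmult"
    and "\<alpha> \<in> forms \<Longrightarrow> \<beta> \<in> forms \<Longrightarrow> Q \<alpha> \<beta> = - Q \<beta> \<alpha>"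
    and "\<alpha> \<notin> forms \<Longrightarrow> Q \<alpha> = 0" and "\<alpha> \<in> forms \<Longrightarrow> Q \<alpha> \<alpha> = 0"
  using alternating_mapsD[OF assms[unfolded bivectors_def TM_simps]] by blast+

text \<open>
  Existence is the reflexivity of the 1-forms, uniqueness their separation of vector fields.
\<close>

lemma sharp_is_sharp:
  assumes "Q \<in> bivector_fields \<A>"
  shows "TM.is_sharp Q (sharp \<A> Q)"
proof -
  have "sharp \<A> Q \<alpha> \<in> VF \<and> (\<forall>\<beta>\<in>forms. \<beta> (sharp \<A> Q \<alpha>) = Q \<alpha> \<beta>)" if \<alpha>: "\<alpha> \<in> forms" for \<alpha>
    unfolding sharp_def
  proof (rule theI'[where P = "\<lambda>X. X \<in> VF \<and> (\<forall>\<beta>\<in>forms. \<beta> X = Q \<alpha> \<beta>)"])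
    obtain X where X: "X \<in> VF" "\<forall>\<beta>\<in>forms. \<beta> X = Q \<alpha> \<beta>"
      using one_forms_reflexive[OF bivector_field(1)[OF assms \<alpha>]] by blast
    have "Y = X" if "Y \<in> VF" "\<forall>\<beta>\<in>forms. \<beta> Y = Q \<alpha> \<beta>" for Y
    proof -
      have "\<beta> (Y - X) = 0" if "\<beta> \<in> forms" for \<beta>
        using TM.dual_minus[OF that, of Y X] X \<open>Y \<in> VF\<close> \<open>\<forall>\<beta>\<in>forms. \<beta> Y = Q \<alpha> \<beta>\<close> that by simp
      moreover have "Y - X \<in> VF" using TM.section_minus[of Y X] X that by simp
      ultimately have "Y - X = 0" using VF_separating by blast
      then show ?thesis by simp
    qed
    with X show "\<exists>!X. X \<in> VF \<and> (\<forall>\<beta>\<in>forms. \<beta> X = Q \<alpha> \<beta>)" by blast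
  qed
  then show ?thesis by (simp add: TM.is_sharp_def)
qed

lemma lie_one_form_form:
  assumes "E \<in> VF" "\<alpha> \<in> forms"
  shows "lie_one_form \<A> E \<alpha> \<in> forms"
proof -
  note \<alpha> = TM.dual_linear[OF assms(2), unfolded TM_simps]
  note E = vector_fieldsD[OF assms(1)]
  have "lie_bracket E (X + Y) = lie_bracket E X + lie_bracket E Y" if "X \<in> VF" "Y \<in> VF" for X Y
    using TM.bracket_add[of E X Y] that assms(1) by simp
  moreover have "\<alpha> (lie_bracket E (fmult f X)) = f * \<alpha> (lie_bracket E X) + E f * \<alpha> X" if "X \<in> VF" "f \<in> SF" for X f
    using TM.dual_bracket_smul[OF assms(2), of E X f] that assms(1) by simp
  ultimately show ?thesis
    unfolding dual_def linear_maps_def lie_one_form_def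
    by (auto simp: VF_add VF_fmult SF_minus E \<alpha> VF_lie_bracket assms(1) algebra_simps)
qed

lemma restrict_add: "restrict_form (\<xi> + \<eta>) = restrict_form \<xi> + restrict_form \<eta>"
  and restrict_fmult: "restrict_form (fmult f \<xi>) = fmult f (restrict_form \<xi>)"
  by (simp_all add: restrict_form_def fmult_def fun_eq_iff)

lemma restrict_pull_back [simp]: "\<alpha> \<in> forms \<Longrightarrow> restrict_form (pull_back \<alpha>) = \<alpha>"
  by (auto simp: restrict_form_def pull_back_def SF_0 dual_def linear_maps_def)

lemma restrict_dt [simp]: "restrict_form dt = 0"
  by (auto simp: restrict_form_def dt_def fun_eq_iff)

lemma assemble_apply:
  assumes "\<xi> \<in> pair_forms" "\<eta> \<in> pair_forms"
  shows "assemble \<A> \<Omega> Q E \<xi> \<eta> = Q (restrict_form \<xi>) (restrict_form \<eta>)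
    + (\<eta> (0, 1) * restrict_form \<xi> E - \<xi> (0, 1) * restrict_form \<eta> E)"
  using assms
  by (simp add: assemble_def include_bivector_def wedge_def d_dt_def restrict_form_def mult.commute)

lemma assemble_0: "\<not> (\<xi> \<in> pair_forms \<and> \<eta> \<in> pair_forms) \<Longrightarrow> assemble \<A> \<Omega> Q E \<xi> \<eta> = 0"
  by (auto simp: assemble_def include_bivector_def wedge_def)

text \<open>
  With \<open>\<xi> = \<alpha> + f dt\<close> this is \<open>(\<sharp>\<^sub>Q \<alpha> - f E) + \<alpha>(E) \<partial>/\<partial>t\<close>, the sharp map of
  \<open>Q + \<partial>/\<partial>t \<and> E\<close>.
\<close>

definition assembled_sharp ::
  "('a, 'a vfield) bivector \<Rightarrow> 'a vfield \<Rightarrow> ('a vfield \<times> ('a \<Rightarrow> real) \<Rightarrow> 'a \<Rightarrow> real)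
    \<Rightarrow> 'a vfield \<times> ('a \<Rightarrow> real)" where
  "assembled_sharp Q E \<xi> = (sharp \<A> Q (restrict_form \<xi>) - fmult (\<xi> (0, 1)) E, restrict_form \<xi> E)"

context
  fixes Q E
  assumes Q: "Q \<in> bivector_fields \<A>" and E: "E \<in> VF"
begin

lemma sharp_VF: "\<alpha> \<in> forms \<Longrightarrow> sharp \<A> Q \<alpha> \<in> VF"
  and form_sharp: "\<alpha> \<in> forms \<Longrightarrow> \<beta> \<in> forms \<Longrightarrow> \<beta> (sharp \<A> Q \<alpha>) = Q \<alpha> \<beta>"
  using TM.is_sharpD[OF sharp_is_sharp[OF Q]] by auto

lemma assembled_sharp: "TMR.is_sharp (assemble \<A> \<Omega> Q E) (assembled_sharp Q E)"
  unfolding TMR.is_sharp_def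
proof (intro ballI conjI)
  fix \<xi> assume \<xi>: "\<xi> \<in> pair_forms"
  note r\<xi> = restrict_form_form[OF \<xi>]
  have \<xi>1: "\<xi> (0, 1) \<in> SF" using TMR.dual_ring[OF \<xi>, of "(0, 1)"] by (simp add: VF_0 SF_1)
  have sec: "sharp \<A> Q (restrict_form \<xi>) - fmult (\<xi> (0, 1)) E \<in> VF" "restrict_form \<xi> E \<in> SF"
    using TM.section_minus[of "sharp \<A> Q (restrict_form \<xi>)"] TM.dual_ring[OF r\<xi>]
    by (simp_all add: sharp_VF r\<xi> VF_fmult \<xi>1 E)
  then show "assembled_sharp Q E \<xi> \<in> sections (TMR \<A> \<Omega>)" by (simp add: assembled_sharp_def)
  fix \<eta> assume \<eta>: "\<eta> \<in> pair_forms"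
  note r\<eta> = restrict_form_form[OF \<eta>]
  show "\<eta> (assembled_sharp Q E \<xi>) = assemble \<A> \<Omega> Q E \<xi> \<eta>"
    using TM.dual_minus[OF r\<eta>, of "sharp \<A> Q (restrict_form \<xi>)" "fmult (\<xi> (0, 1)) E"]
      TM.dual_smul[OF r\<eta>, of "\<xi> (0, 1)" E]
    by (simp add: assembled_sharp_def pair_form_apply[OF \<eta> sec] assemble_apply[OF \<xi> \<eta>] sharp_VF r\<xi> r\<eta>
        VF_fmult \<xi>1 E form_sharp algebra_simps)
qed

lemma assemble_bivector: "assemble \<A> \<Omega> Q E \<in> bivectors (TMR \<A> \<Omega>)"
proof -
  let ?P = "assemble \<A> \<Omega> Q E"
  note r = restrict_form_form
  have "?P \<xi> \<in> linear_maps SF pair_forms fmult" if \<xi>: "\<xi> \<in> pair_forms" for \<xi>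
    unfolding linear_maps_def
  proof (intro CollectI conjI ballI allI impI)
    note Ql = linear_mapsD[OF bivector_field(1)[OF Q r[OF \<xi>]]]
    fix \<eta> assume \<eta>: "\<eta> \<in> pair_forms"
    show "?P \<xi> \<eta> \<in> SF"
      using TMR.dual_ring[OF \<xi>] TMR.dual_ring[OF \<eta>] TM.dual_ring[OF r[OF \<xi>]] TM.dual_ring[OF r[OF \<eta>]]
      by (simp add: assemble_apply \<xi> \<eta> SF_add SF_minus SF_mult Ql r E VF_0 SF_1)
    show "?P \<xi> (\<eta> + \<zeta>) = ?P \<xi> \<eta> + ?P \<xi> \<zeta>" if "\<zeta> \<in> pair_forms" for \<zeta>
      using that \<xi> \<eta> by (simp add: assemble_apply TMR.dual_closed_add restrict_add Ql r algebra_simps)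
    show "?P \<xi> (fmult f \<eta>) = f * ?P \<xi> \<eta>" if "f \<in> SF" for f
      using that \<xi> \<eta>
      by (simp add: assemble_apply TMR.dual_closed_fmult restrict_fmult Ql r fmult_apply
          algebra_simps)
  qed (simp add: assemble_0)
  moreover have "?P \<xi> \<xi> = 0" if "\<xi> \<in> pair_forms" for \<xi>
    using that by (simp add: assemble_apply bivector_field(4)[OF Q] r)
  moreover have "?P \<xi> \<eta> = - ?P \<eta> \<xi>" if "\<xi> \<in> pair_forms" "\<eta> \<in> pair_forms" for \<xi> \<eta>
    using that bivector_field(2)[OF Q r[OF that(1)] r[OF that(2)]] by (simp add: assemble_apply)
  moreover have "?P \<xi> = 0" if "\<xi> \<notin> pair_forms" for \<xi>
    using that by (simp add: assemble_0 fun_eq_iff)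
  ultimately show ?thesis
    unfolding bivectors_def alternating_maps_def TMR_simps by blast
qed

lemma assembled_sharp_pull_back:
  assumes "\<alpha> \<in> forms"
  shows "assembled_sharp Q E (pull_back \<alpha>) = (sharp \<A> Q \<alpha>, \<alpha> E)"
proof -
  have "fmult 0 E = 0" by (simp add: fmult_def fun_eq_iff)
  then show ?thesis
    using assms by (simp add: assembled_sharp_def VF_0 SF_1 TM.dual_0[OF assms] func_zero[symmetric])
qed

lemma assembled_sharp_dt: "assembled_sharp Q E dt = (- E, 0)"
proof -
  have "sharp \<A> Q 0 = 0"
  proof -
    have "\<beta> (sharp \<A> Q 0) = 0" if "\<beta> \<in> forms" for \<beta>
    proof -
      have "Q \<beta> 0 = 0"
        using linear_mapsD(2)[OF bivector_field(1)[OF Q that] form_0 form_0] by simp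
      then show ?thesis
        using form_sharp[OF form_0 that] bivector_field(2)[OF Q form_0 that] by simp
    qed
    then show ?thesis by (rule VF_separating[OF sharp_VF[OF form_0]])
  qed
  moreover have "fmult 1 E = E" by (simp add: fmult_def)
  ultimately show ?thesis by (simp add: assembled_sharp_def VF_0 SF_1)
qed

text \<open>
  A pulled back covector does not see the \<open>\<partial>/\<partial>t\<close> component of a bracket, which is where \<open>E\<close>
  and \<open>\<Omega>\<close> enter.
\<close>

lemma assembled_form_pull_back:
  assumes "\<alpha> \<in> forms" "\<beta> \<in> forms" "\<gamma> \<in> forms"
  shows "TMR.schouten_form (assembled_sharp Q E) (assembled_sharp Q E) (pull_back \<alpha>) (pull_back \<beta>) (pull_back \<gamma>)
    = TM.schouten_form (sharp \<A> Q) (sharp \<A> Q) \<alpha> \<beta> \<gamma>"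
proof -
  have "TMR.koszul (assembled_sharp Q E) (assembled_sharp Q E) (pull_back \<alpha>) (pull_back \<beta>) (pull_back \<gamma>)
    = TM.koszul (sharp \<A> Q) (sharp \<A> Q) \<alpha> \<beta> \<gamma>" if "\<alpha> \<in> forms" "\<beta> \<in> forms" "\<gamma> \<in> forms" for \<alpha> \<beta> \<gamma>
  proof -
    have "bracket (TMR \<A> \<Omega>) (sharp \<A> Q \<alpha>, \<alpha> E) (sharp \<A> Q \<beta>, \<beta> E) \<in> sections (TMR \<A> \<Omega>)"
      by (rule TMR.bracket_section)
        (use that sharp_VF TM.dual_ring[of \<alpha> E] TM.dual_ring[of \<beta> E] E in auto)
    moreover have "\<beta> E \<in> SF" using TM.dual_ring[of \<beta> E] that E by simp
    ultimately show ?thesis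
      using that by (simp add: TMR.koszul_def TM.koszul_def assembled_sharp_pull_back sharp_VF)
  qed
  with assms show ?thesis by (simp add: TMR.schouten_form_def TM.schouten_form_def)
qed

text \<open>
  Let \<open>X = \<sharp>\<^sub>Q \<alpha>\<close> and \<open>Y = \<sharp>\<^sub>Q \<beta>\<close>. The covector \<open>dt\<close> extracts from the bracket of the sharps of \<open>\<alpha>\<close>
  and \<open>\<beta>\<close> the component containing \<open>\<Omega>(X, Y)\<close>; the sharp \<open>-E\<close> of \<open>dt\<close> contributes the derivatives along \<open>E\<close>
  that make up the Lie derivative of \<open>Q\<close>.
\<close>

lemma assembled_form_dt:
  assumes "\<alpha> \<in> forms" "\<beta> \<in> forms"
  shows "TMR.schouten_form (assembled_sharp Q E) (assembled_sharp Q E) (pull_back \<alpha>) (pull_back \<beta>) dt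
    = 2 * (lie_bivector \<A> E Q \<alpha> \<beta> - sharp_two_form \<A> Q \<Omega> \<alpha> \<beta>)"
proof -
  note \<alpha> = TM.dual_linear[OF assms(1), unfolded TM_simps] and \<beta> = TM.dual_linear[OF assms(2), unfolded TM_simps]
  define X Y where "X = sharp \<A> Q \<alpha>" and "Y = sharp \<A> Q \<beta>"
  have X: "X \<in> VF" and Y: "Y \<in> VF" by (simp_all add: X_def Y_def sharp_VF assms)
  have sh: "assembled_sharp Q E (pull_back \<alpha>) = (X, \<alpha> E)" "assembled_sharp Q E (pull_back \<beta>) = (Y, \<beta> E)"
    by (simp_all add: X_def Y_def assembled_sharp_pull_back assms)
  have EX: "lie_bracket E X \<in> VF" and EY: "lie_bracket E Y \<in> VF"
    using X Y E by (simp_all add: VF_lie_bracket)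
  have br: "lie_bracket Y (- E) = lie_bracket E Y" "lie_bracket (- E) X = - lie_bracket E X"
    using TM.bracket_uminus[of Y E] TM.bracket_skew[of Y E] TM.bracket_uminus[of X E] TM.bracket_skew[of "- E" X]
      TM.bracket_skew[of X E] X Y E VF_uminus[OF E] by simp_all
  have "TMR.schouten_form (assembled_sharp Q E) (assembled_sharp Q E) (pull_back \<alpha>) (pull_back \<beta>) dt
     = 2 * (- \<Omega> X Y - \<alpha> (lie_bracket E Y) - E (\<beta> X) + \<beta> (lie_bracket E X))"
  proof -
    have "TMR.koszul (assembled_sharp Q E) (assembled_sharp Q E) (pull_back \<alpha>) (pull_back \<beta>) dt
      = 2 * (Y (\<alpha> E) - \<Omega> X Y)"
      using X Y E VF_lie_bracket[OF X Y] vector_fieldsD(1)[OF X \<beta>(1)[OF E]] vector_fieldsD(1)[OF Y \<alpha>(1)[OF E]]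
      by (simp add: TMR.koszul_def sh \<alpha>(1) \<beta>(1) \<Omega>_linear SF_add SF_minus algebra_simps)
    moreover have Y_uminus: "Y (\<lambda>p. - \<alpha> E p) = - Y (\<alpha> E)"
      using VF_apply_uminus[OF Y \<alpha>(1)[OF E]] by (simp only: fun_Compl_def)
    moreover have "TMR.koszul (assembled_sharp Q E) (assembled_sharp Q E) (pull_back \<beta>) dt (pull_back \<alpha>)
      = 2 * (- Y (\<alpha> E) - \<alpha> (lie_bracket E Y))"
      using Y E EY VF_uminus[OF E] VF_apply_0[OF Y]
        \<Omega>_linear(1)[OF Y VF_uminus[OF E]] vector_fieldsD(1)[OF E \<beta>(1)[OF E]]
        Y_uminus
      by (simp add: TMR.koszul_def sh assembled_sharp_dt \<alpha>(1,5) \<beta>(1) SF_0 SF_add br algebra_simps)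
    moreover have "TMR.koszul (assembled_sharp Q E) (assembled_sharp Q E) dt (pull_back \<alpha>) (pull_back \<beta>)
      = 2 * (- E (\<beta> X) + \<beta> (lie_bracket E X))"
      using X E EX VF_uminus[OF E] VF_uminus[OF EX] VF_apply_0[OF X]
        \<Omega>_linear(1)[OF VF_uminus[OF E] X] vector_fieldsD(1)[OF E \<alpha>(1)[OF E]]
      by - (rule ext, simp add: TMR.koszul_def sh assembled_sharp_dt \<alpha>(1) \<beta>(1,5) SF_0 SF_add SF_minus
        SF_uminus br)
    ultimately show ?thesis by (simp add: TMR.schouten_form_def algebra_simps)
  qed
  moreover have "lie_bivector \<A> E Q \<alpha> \<beta> = - \<alpha> (lie_bracket E Y) - E (\<beta> X) + \<beta> (lie_bracket E X)"
  proof -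
    have L: "lie_one_form \<A> E \<alpha> \<in> forms" "lie_one_form \<A> E \<beta> \<in> forms"
      using lie_one_form_form E assms by blast+
    have "Q \<alpha> (lie_one_form \<A> E \<beta>) = E (\<beta> X) - \<beta> (lie_bracket E X)"
      using form_sharp[OF assms(1) L(2)] X by (simp add: X_def lie_one_form_def)
    moreover have "Q \<beta> (lie_one_form \<A> E \<alpha>) = E (\<alpha> Y) - \<alpha> (lie_bracket E Y)"
      using form_sharp[OF assms(2) L(1)] Y by (simp add: Y_def lie_one_form_def)
    moreover have \<beta>X: "\<beta> X = Q \<alpha> \<beta>" and "\<alpha> Y = Q \<beta> \<alpha>"
      by (simp_all add: X_def Y_def form_sharp assms)
    then have "\<alpha> Y = - \<beta> X"
      using bivector_field(2)[OF Q assms(2,1)] by (simp only:)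
    moreover note \<beta>X
    moreover have "E (- \<beta> X) = - E (\<beta> X)" using VF_apply_uminus[OF E \<beta>(1)[OF X]] .
    moreover have "Q (lie_one_form \<A> E \<alpha>) \<beta> = - Q \<beta> (lie_one_form \<A> E \<alpha>)"
      by (rule bivector_field(2)[OF Q L(1) assms(2)])
    ultimately have "E (Q \<alpha> \<beta>) - Q (lie_one_form \<A> E \<alpha>) \<beta> - Q \<alpha> (lie_one_form \<A> E \<beta>)
        = - \<alpha> (lie_bracket E Y) - E (\<beta> X) + \<beta> (lie_bracket E X)"
      by (simp only:) (simp add: algebra_simps)
    then show ?thesis using assms by (simp add: lie_bivector_def)
  qed
  moreover have "sharp_two_form \<A> Q \<Omega> \<alpha> \<beta> = \<Omega> X Y"
    using assms by (simp add: sharp_two_form_def X_def Y_def)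
  ultimately show ?thesis by (simp only:) (simp add: algebra_simps)
qed

lemma Omega_Poisson_assemble_iff:
  "Omega_Poisson \<A> \<Omega> (assemble \<A> \<Omega> Q E) \<longleftrightarrow>
    poisson_bivector (TM \<A>) Q \<and> lie_bivector \<A> E Q = sharp_two_form \<A> Q \<Omega>"
proof -
  let ?P = "assemble \<A> \<Omega> Q E"
  note eqR = TMR.schouten_eq_form[OF assemble_bivector assemble_bivector assembled_sharp assembled_sharp]
  note eqT = TM.schouten_eq_form[OF Q Q sharp_is_sharp[OF Q] sharp_is_sharp[OF Q]]
  have 1: "schouten (TMR \<A> \<Omega>) ?P ?P (pull_back \<alpha>) (pull_back \<beta>) (pull_back \<gamma>) = schouten (TM \<A>) Q Q \<alpha> \<beta> \<gamma>"
    if "\<alpha> \<in> forms" "\<beta> \<in> forms" "\<gamma> \<in> forms" for \<alpha> \<beta> \<gamma>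
    using that by (simp add: eqR eqT pull_back_form assembled_form_pull_back)
  have 2: "schouten (TMR \<A> \<Omega>) ?P ?P (pull_back \<alpha>) (pull_back \<beta>) dt
      = 2 * (lie_bivector \<A> E Q \<alpha> \<beta> - sharp_two_form \<A> Q \<Omega> \<alpha> \<beta>)" if "\<alpha> \<in> forms" "\<beta> \<in> forms" for \<alpha> \<beta>
    using that by (simp add: eqR pull_back_form dt_form assembled_form_dt)
  show ?thesis
  proof
    assume "Omega_Poisson \<A> \<Omega> ?P"
    then have 0: "schouten (TMR \<A> \<Omega>) ?P ?P = 0" by (simp add: poisson_bivector_def)
    have "schouten (TM \<A>) Q Q \<alpha> \<beta> \<gamma> p = 0" for \<alpha> \<beta> \<gamma> p
    proof (cases "\<alpha> \<in> forms \<and> \<beta> \<in> forms \<and> \<gamma> \<in> forms")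
      case True
      then show ?thesis using 1[of \<alpha> \<beta> \<gamma>] 0 by simp
    next
      case False
      then show ?thesis by (auto simp: schouten_def)
    qed
    moreover have "lie_bivector \<A> E Q \<alpha> \<beta> p = sharp_two_form \<A> Q \<Omega> \<alpha> \<beta> p" for \<alpha> \<beta> p
    proof (cases "\<alpha> \<in> forms \<and> \<beta> \<in> forms")
      case True
      then show ?thesis using fun_cong[OF 2[of \<alpha> \<beta>], of p] 0 by simp
    next
      case False
      then show ?thesis by (auto simp: lie_bivector_def sharp_two_form_def)
    qed
    ultimately show "poisson_bivector (TM \<A>) Q \<and> lie_bivector \<A> E Q = sharp_two_form \<A> Q \<Omega>"
      using Q by (simp add: poisson_bivector_def fun_eq_iff)
  next
    assume PL: "poisson_bivector (TM \<A>) Q \<and> lie_bivector \<A> E Q = sharp_two_form \<A> Q \<Omega>"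
    then have 0: "schouten (TM \<A>) Q Q = 0" "lie_bivector \<A> E Q = sharp_two_form \<A> Q \<Omega>"
      by (simp_all add: poisson_bivector_def)
    have "schouten (TMR \<A> \<Omega>) ?P ?P = 0"
    proof (rule TMR.schouten_eq_0I[OF assemble_bivector assemble_bivector assembled_sharp assembled_sharp,
          where K = "pull_back ` forms" and \<tau> = dt])
      show "pull_back ` forms \<subseteq> pair_forms" using pull_back_form by blast
      show "dt \<in> pair_forms" by (rule dt_form)
      show "\<exists>\<kappa>\<in>pull_back ` forms. \<exists>f\<in>base_ring (TMR \<A> \<Omega>). \<xi> = \<kappa> + fmult f dt" if "\<xi> \<in> pair_forms" for \<xi>
      proof -
        have "\<xi> (0, 1) \<in> SF" using TMR.dual_ring[OF that, of "(0, 1)"] by (simp add: VF_0 SF_1)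
        then show ?thesis using pair_form_split[OF that] restrict_form_form[OF that] by auto
      qed
      fix \<kappa>1 \<kappa>2 assume "\<kappa>1 \<in> pull_back ` forms" "\<kappa>2 \<in> pull_back ` forms"
      then obtain \<alpha> \<beta> where \<alpha>\<beta>: "\<alpha> \<in> forms" "\<beta> \<in> forms" "\<kappa>1 = pull_back \<alpha>" "\<kappa>2 = pull_back \<beta>" by blast
      show "schouten (TMR \<A> \<Omega>) ?P ?P \<kappa>1 \<kappa>2 dt = 0" using \<alpha>\<beta> 2 0 by simp
      fix \<kappa>3 assume "\<kappa>3 \<in> pull_back ` forms"
      then show "schouten (TMR \<A> \<Omega>) ?P ?P \<kappa>1 \<kappa>2 \<kappa>3 = 0" using \<alpha>\<beta> 1 0 by auto
    qed
    then show "Omega_Poisson \<A> \<Omega> ?P" using assemble_bivector by (simp add: poisson_bivector_def)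
  qed
qed

lemma assemble_pull_back: "\<alpha> \<in> forms \<Longrightarrow> \<beta> \<in> forms \<Longrightarrow> assemble \<A> \<Omega> Q E (pull_back \<alpha>) (pull_back \<beta>) = Q \<alpha> \<beta>"
  by (simp add: assemble_apply pull_back_form VF_0 SF_1 TM.dual_0[of \<alpha>] TM.dual_0[of \<beta>] func_zero[symmetric])

lemma assemble_pull_back_dt:
  assumes "\<alpha> \<in> forms"
  shows "assemble \<A> \<Omega> Q E (pull_back \<alpha>) dt = \<alpha> E"
proof -
  have "Q \<alpha> 0 = 0"
    using linear_mapsD(2)[OF bivector_field(1)[OF Q assms] form_0 form_0] by simp
  then show ?thesis using assms by (simp add: assemble_apply pull_back_form dt_form VF_0 SF_1)
qed

end


section \<open>The pair belonging to a bivector\<close>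

lemma assemble_inj:
  assumes "Q \<in> bivector_fields \<A>" "E \<in> VF" "Q' \<in> bivector_fields \<A>" "E' \<in> VF"
    and eq: "assemble \<A> \<Omega> Q E = assemble \<A> \<Omega> Q' E'"
  shows "Q = Q' \<and> E = E'"
proof
  show "Q = Q'"
  proof (intro ext)
    fix \<alpha> \<beta> p
    show "Q \<alpha> \<beta> p = Q' \<alpha> \<beta> p"
    proof (cases "\<alpha> \<in> forms \<and> \<beta> \<in> forms")
      case True
      then show ?thesis
        using assemble_pull_back[OF assms(1,2), of \<alpha> \<beta>] assemble_pull_back[OF assms(3,4), of \<alpha> \<beta>] eq by simp
    next
      case False
      have "R \<alpha> \<beta> = 0" if "R \<in> bivector_fields \<A>" for R
        using False bivector_field(3)[OF that, of \<alpha>] linear_mapsD(4)[OF bivector_field(1)[OF that], of \<alpha> \<beta>]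
        by (cases "\<alpha> \<in> forms") auto
      then show ?thesis using assms(1,3) by simp
    qed
  qed
  have "\<alpha> (E - E') = 0" if "\<alpha> \<in> forms" for \<alpha>
    using assemble_pull_back_dt[OF assms(1,2) that] assemble_pull_back_dt[OF assms(3,4) that] eq
      TM.dual_minus[OF that, of E E'] assms(2,4) by simp
  moreover have "E - E' \<in> VF" using TM.section_minus[of E E'] assms(2,4) by simp
  ultimately have "E - E' = 0" using VF_separating by blast
  then show "E = E'" by simp
qed

text \<open>
  \<open>Q\<close> is the restriction of \<open>P\<close> to pulled back covectors, and \<open>E\<close> is the vector field representing
  the functional \<open>\<alpha> \<mapsto> P(\<alpha>, dt)\<close>. Since \<open>P(dt, dt) = 0\<close>, nothing else is left.
\<close>

lemma assemble_surj:
  assumes P: "P \<in> bivectors (TMR \<A> \<Omega>)"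
  obtains Q E where "Q \<in> bivector_fields \<A>" "E \<in> VF" "P = assemble \<A> \<Omega> Q E"
proof -
  note Pa = alternating_mapsD[OF P[unfolded bivectors_def TMR_simps]]
  note Pl = linear_mapsD[OF Pa(1)]
  have pb_add: "pull_back (\<alpha> + \<beta>) = pull_back \<alpha> + pull_back \<beta>"
    and pb_fmult: "pull_back (fmult f \<alpha>) = fmult f (pull_back \<alpha>)" for \<alpha> \<beta> f
    by (auto simp: pull_back_def fmult_def fun_eq_iff)
  have left_add: "P (\<xi> + \<eta>) \<zeta> = P \<xi> \<zeta> + P \<eta> \<zeta>" if "\<xi> \<in> pair_forms" "\<eta> \<in> pair_forms" "\<zeta> \<in> pair_forms" for \<xi> \<eta> \<zeta>
    using Pl(2)[OF that(3,1,2)] Pa(2)[OF that(1,3)] Pa(2)[OF that(2,3)] Pa(2)[OF TMR.dual_closed_add[OF that(1,2)] that(3)]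
    by simp
  have left_fmult: "P (fmult f \<xi>) \<zeta> = f * P \<xi> \<zeta>" if "\<xi> \<in> pair_forms" "f \<in> SF" "\<zeta> \<in> pair_forms" for f \<xi> \<zeta>
    using Pl(3)[OF that(3,2,1)] Pa(2)[OF that(1,3)] Pa(2)[OF TMR.dual_closed_fmult[of f, OF _ that(1)] that(3)] that(2)
    by simp
  define Q where "Q \<alpha> \<beta> = (if \<alpha> \<in> forms \<and> \<beta> \<in> forms then P (pull_back \<alpha>) (pull_back \<beta>) else 0)" for \<alpha> \<beta>
  define \<Phi> where "\<Phi> \<alpha> = (if \<alpha> \<in> forms then P (pull_back \<alpha>) dt else 0)" for \<alpha>
  have cl: "\<alpha> + \<beta> \<in> forms" "f \<in> SF \<Longrightarrow> fmult f \<alpha> \<in> forms" if "\<alpha> \<in> forms" "\<beta> \<in> forms" for \<alpha> \<beta> f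
    using TM.dual_closed_add[OF that] TM.dual_closed_fmult[of f, OF _ that(1)] by auto
  have "Q \<alpha> \<in> linear_maps SF forms fmult" if "\<alpha> \<in> forms" for \<alpha>
    using that unfolding linear_maps_def
    by (auto simp: Q_def cl pb_add pb_fmult Pl(1,2,3) pull_back_form)
  moreover have "Q \<alpha> \<beta> = - Q \<beta> \<alpha>" if "\<alpha> \<in> forms" "\<beta> \<in> forms" for \<alpha> \<beta>
    using that Pa(2)[of "pull_back \<alpha>" "pull_back \<beta>"] by (simp add: Q_def pull_back_form)
  moreover have "Q \<alpha> \<alpha> = 0" if "\<alpha> \<in> forms" for \<alpha>
    using Pa(4)[OF pull_back_form[OF that]] that by (simp add: Q_def)
  moreover have "Q \<alpha> = 0" if "\<alpha> \<notin> forms" for \<alpha>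
    using that by (simp add: Q_def fun_eq_iff)
  ultimately have Q: "Q \<in> bivector_fields \<A>"
    unfolding bivectors_def alternating_maps_def TM_simps by blast
  have "\<Phi> \<in> linear_maps SF forms fmult"
    unfolding linear_maps_def
    by (auto simp: \<Phi>_def cl pb_add pb_fmult Pl(1) left_add left_fmult pull_back_form dt_form)
  from one_forms_reflexive[OF this] obtain E where E: "E \<in> VF" "\<And>\<alpha>. \<alpha> \<in> forms \<Longrightarrow> \<alpha> E = \<Phi> \<alpha>" by blast
  have "P \<xi> \<eta> = assemble \<A> \<Omega> Q E \<xi> \<eta>" for \<xi> \<eta>
  proof (cases "\<xi> \<in> pair_forms \<and> \<eta> \<in> pair_forms")
    case True
    then have \<xi>: "\<xi> \<in> pair_forms" and \<eta>: "\<eta> \<in> pair_forms" by auto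
    define a f b g where "a = restrict_form \<xi>" and "f = \<xi> (0, 1)" and "b = restrict_form \<eta>" and "g = \<eta> (0, 1)"
    have ab: "a \<in> forms" "b \<in> forms" by (simp_all add: a_def b_def restrict_form_form \<xi> \<eta>)
    have fg: "f \<in> SF" "g \<in> SF"
      using TMR.dual_ring[OF \<xi>, of "(0, 1)"] TMR.dual_ring[OF \<eta>, of "(0, 1)"] by (simp_all add: f_def g_def VF_0 SF_1)
    note pb = pull_back_form[OF ab(1)] pull_back_form[OF ab(2)]
    have fd: "fmult f dt \<in> pair_forms" "fmult g dt \<in> pair_forms"
      using TMR.dual_closed_fmult[OF _ dt_form] fg by auto
    have "P \<xi> \<eta> = P (pull_back a + fmult f dt) (pull_back b + fmult g dt)"
      using pair_form_split[OF \<xi>] pair_form_split[OF \<eta>] by (simp add: a_def b_def f_def g_def)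
    also have "\<dots> = P (pull_back a) (pull_back b) + g * P (pull_back a) dt + f * P dt (pull_back b) + f * g * P dt dt"
      using pb fd fg dt_form
      by (simp add: left_add left_fmult TMR.dual_closed_add Pl(2,3) algebra_simps)
    also have "\<dots> = Q a b + (g * a E - f * b E)"
      using Pa(4)[OF dt_form] Pa(2)[OF dt_form pb(2)] ab by (simp add: Q_def E(2) \<Phi>_def)
    also have "\<dots> = assemble \<A> \<Omega> Q E \<xi> \<eta>"
      by (simp add: assemble_apply[OF \<xi> \<eta>] a_def b_def f_def g_def)
    finally show ?thesis .
  next
    case False
    then have "P \<xi> \<eta> = 0"
      using Pa(3)[of \<xi>] Pl(4)[of \<xi> \<eta>] by (cases "\<xi> \<in> pair_forms") auto
    with False show ?thesis by (simp add: assemble_0)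
  qed
  then have "P = assemble \<A> \<Omega> Q E" by (simp add: fun_eq_iff)
  with Q E(1) show thesis by (rule that)
qed

end

theorem proposition4p2:
  fixes \<A> :: "('a::{t2_space, second_countable_topology}, 'b::euclidean_space) chart set"
    and \<Omega> :: "'a vfield \<Rightarrow> 'a vfield \<Rightarrow> 'a \<Rightarrow> real"
  assumes "smooth_atlas \<A>"
    and "closed_two_form \<A> \<Omega>"
  shows "bij_betw (\<lambda>(Q, E). assemble \<A> \<Omega> Q E)
           {(Q, E). poisson_bivector (TM \<A>) Q \<and> E \<in> vector_fields \<A> \<and>
                    lie_bivector \<A> E Q = sharp_two_form \<A> Q \<Omega>}
           {P. Omega_Poisson \<A> \<Omega> P} \<and>
         (\<forall>Q\<in>bivector_fields \<A>. \<forall>E\<in>vector_fields \<A>.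
           Omega_Poisson \<A> \<Omega> (assemble \<A> \<Omega> Q E) \<longleftrightarrow>
           poisson_bivector (TM \<A>) Q \<and> lie_bivector \<A> E Q = sharp_two_form \<A> Q \<Omega>)"
proof -
  interpret manifold_with_two_form \<A> \<Omega>
    using assms by unfold_locales (simp_all add: closed_two_form_def)
  let ?S = "{(Q, E). poisson_bivector (TM \<A>) Q \<and> E \<in> vector_fields \<A> \<and>
                    lie_bivector \<A> E Q = sharp_two_form \<A> Q \<Omega>}"
  have biv: "Q \<in> bivector_fields \<A>" if "poisson_bivector (TM \<A>) Q" for Q
    using that by (simp add: poisson_bivector_def)
  have "inj_on (\<lambda>(Q, E). assemble \<A> \<Omega> Q E) ?S"
  proof (rule inj_onI)
    fix z z' assume "z \<in> ?S" "z' \<in> ?S" "(\<lambda>(Q, E). assemble \<A> \<Omega> Q E) z = (\<lambda>(Q, E). assemble \<A> \<Omega> Q E) z'"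
    then show "z = z'"
      using assemble_inj[of "fst z" "snd z" "fst z'" "snd z'"] biv by (cases z, cases z') simp
  qed
  moreover have "(\<lambda>(Q, E). assemble \<A> \<Omega> Q E) ` ?S = {P. Omega_Poisson \<A> \<Omega> P}"
  proof (intro equalityI subsetI)
    fix P assume "P \<in> (\<lambda>(Q, E). assemble \<A> \<Omega> Q E) ` ?S"
    then show "P \<in> {P. Omega_Poisson \<A> \<Omega> P}"
      using Omega_Poisson_assemble_iff biv by auto
  next
    fix P assume P: "P \<in> {P. Omega_Poisson \<A> \<Omega> P}"
    then obtain Q E where QE: "Q \<in> bivector_fields \<A>" "E \<in> vector_fields \<A>" "P = assemble \<A> \<Omega> Q E"
      using assemble_surj[of P] by (auto simp: poisson_bivector_def)
    with P Omega_Poisson_assemble_iff[OF QE(1,2)] have "(Q, E) \<in> ?S" by simp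
    with QE(3) show "P \<in> (\<lambda>(Q, E). assemble \<A> \<Omega> Q E) ` ?S" by force
  qed
  ultimately show ?thesis
    unfolding bij_betw_def using Omega_Poisson_assemble_iff by blast
qed

end
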